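(* Let $n\ge1$, $s\in(0,n]$ and $\Omega\subset\mathbb{R}^{n+1}$ with $\Omega\in\mathrm{AR}(s)$. If $f\in\Lambda_\beta(\partial\Omega)$ for some $\beta\in(0,1)$, there exist a function $F:\overline\Omega\to\mathbb{R}$ and $c_0\in(0,1/2]$ such that for any $c\in(0,c_0]$: (i) $F\in C^\infty(\Omega)$; (ii) $\sup_{\xi\in\partial\Omega}\mathcal N^{(\beta)}_{\sharp,c}(F)(\xi)+\sup_{x\in\Omega}\delta_\Omega(x)^{1-\beta}|\nabla F(x)|\lesssim\|f\|_{\Lambda_\beta(\partial\Omega)}$; (iii) $\sup_{\xi\in\partial\Omega}\mathcal C^{(\beta)}_{s,c}(\nabla F)(\xi)\lesssim\|f\|_{\Lambda_\beta(\partial\Omega)}$; (iv) $F$ converges non-tangentially to $f$ at $\xi$ for $\sigma_s$-a.e. $\xi\in\partial\Omega$. Moreover, if $f\in\mathrm{Lip}_\beta(\partial\Omega)$, then $F\in\mathrm{Lip}_\beta(\overline\Omega)$ and $F|_{\partial\Omega}=f$ continuously. The constant $c_0$ depends only on the dimension, the Ahlfors regularity constants and the corkscrew condition.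
   Context: A closed set $E\subset\mathbb{R}^{n+1}$ is $s$-Ahlfors regular if there is $C_0>0$ with $C_0^{-1}r^s\le\mathcal H^s(E\cap B(x,r))\le C_0r^s$ for all $x\in E$, $0<r<\operatorname{diam}E$. An open set $\Omega$ satisfies the corkscrew condition if there is $c_*\in(0,1/2)$ such that for every $\xi\in\partial\Omega$ and $0<r<\operatorname{diam}\Omega$ there is $x\in\Omega\cap B(\xi,r)$ with $B(x,c_*r)\subset\Omega\cap B(\xi,r)$. For $s\in(0,n]$, $\Omega\in\mathrm{AR}(s)$ means: if $s=n$, $\Omega\subset\mathbb R^{n+1}$ is open, satisfies the corkscrew condition, and $\partial\Omega$ is $n$-Ahlfors regular; if $s<n$, $\Omega=\mathbb{R}^{n+1}\setminus E$ for some $s$-Ahlfors regular set $E$. Put $\sigma_s=\mathcal H^s|_{\partial\Omega}$, $\delta_\Omega(x)=\operatorname{dist}(x,\Omega^c)$. $\Lambda_\beta(\partial\Omega)$ (Campanato space) is the set of $f\in L^1_{\rm loc}(\sigma_s)$ with $\|f\|_{\Lambda_\beta(\partial\Omega)}=\sup\frac1{r^\beta}\frac1{\sigma_s(B(x,r))}\int_{B(x,r)}|f-m_{\sigma_s,B(x,r)}f|\,d\sigma_s<\infty$, the supremum being over $x\in\partial\Omega$, $r\in(0,2\operatorname{diam}\partial\Omega)$, with $m_{\sigma_s,B}f$ the $\sigma_s$-average of $f$ on $B$. $\mathrm{Lip}_\beta(\Sigma)$ is the space of functions with $\sup_{x\ne y\in\Sigma}|f(x)-f(y)|/|x-y|^\beta<\infty$.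 Cone: $\gamma_\alpha(\xi)=\{x\in\Omega:|x-\xi|<(1+\alpha)\operatorname{dist}(x,\partial\Omega)\}$, $\alpha>0$ fixed. For $c\in(0,1/2]$ let $B_x=B(x,c\,\delta_\Omega(x))$. Then $\mathcal N^{(\beta)}_{\sharp,c}(w)(\xi)=\sup_{x\in\gamma_\alpha(\xi)}\delta_\Omega(x)^{-\beta}\sup_{y\in B_x}\big|w(y)-\frac1{|B_x|}\int_{B_x}w\big|$ and $\mathcal C^{(\beta)}_{s,c}(G)(\xi)=\sup_{r>0}\frac1{r^{s+\beta}}\int_{B(\xi,r)\cap\Omega}\big(\sup_{y\in B_x}|G(y)|\big)\,\delta_\Omega(x)^{s-n}\,dx$. $F$ converges non-tangentially to $f$ at $\xi$ if there is $\alpha>0$ such that $F(x_k)\to f(\xi)$ for every sequence $x_k\in\gamma_\alpha(\xi)$ with $x_k\to\xi$. $A\lesssim B$ means $A\le CB$ with $C>0$ independent of $f$. *)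

theory Defs
  imports "HOL-Analysis.Analysis"
begin

section \<open>Hausdorff measure\<close>

text \<open>The real-valued \<open>diameter\<close> is unspecified on unbounded sets; \<open>ediam\<close> is \<open>\<infinity>\<close> there.\<close>

definition ediam :: "'a::metric_space set \<Rightarrow> ennreal" where
  "ediam E = (SUP x\<in>E. SUP y\<in>E. ennreal (dist x y))"

text \<open>
  Only exponents \<open>s > 0\<close> matter, and then \<open>0 powr s = 0\<close> is the right value for empty sets and
  singletons. Covers by unbounded sets never have diameter at most \<open>d\<close>.
\<close>

definition hausdorff_content :: "real \<Rightarrow> real \<Rightarrow> 'a::metric_space set \<Rightarrow> ennreal" where
  "hausdorff_content s d A =
    (INF U\<in>{U :: nat \<Rightarrow> 'a set. A \<subseteq> (\<Union>i. U i) \<and> (\<forall>i. bounded (U i) \<and> diameter (U i) \<le> d)}.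
       \<Sum>i. ennreal (diameter (U i) powr s))"

definition hausdorff_outer :: "real \<Rightarrow> 'a::metric_space set \<Rightarrow> ennreal" where
  "hausdorff_outer s A = (SUP d\<in>{0<..}. hausdorff_content s d A)"

text \<open>
  The measure on all Caratheodory-measurable sets. \<open>measure_of\<close> does not degenerate to the null
  measure here, see \<open>emeasure_hausdorff\<close> below; Borel sets are measurable because
  \<open>hausdorff_outer s\<close> is a metric outer measure.
\<close>

definition hausdorff :: "real \<Rightarrow> 'a::metric_space measure" where
  "hausdorff s = measure_of UNIV
     (lambda_system UNIV (Pow UNIV) (hausdorff_outer s)) (hausdorff_outer s)"

lemma hausdorff_content_mono: "A \<subseteq> B \<Longrightarrow> hausdorff_content s d A \<le> hausdorff_content s d B"
  unfolding hausdorff_content_def by (rule INF_superset_mono) auto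

lemma hausdorff_content_UN:
  fixes A :: "nat \<Rightarrow> 'a::metric_space set"
  shows "hausdorff_content s d (\<Union>n. A n) \<le> (\<Sum>n. hausdorff_content s d (A n))"
proof (rule ennreal_le_epsilon)
  fix e :: real
  assume e: "0 < e" and fin: "(\<Sum>n. hausdorff_content s d (A n)) < top"
  define f :: "'a set \<Rightarrow> ennreal" where "f = (\<lambda>U. ennreal (diameter U powr s))"
  have *: "hausdorff_content s d (A n) < hausdorff_content s d (A n) + e * (1/2)^Suc n" for n
  proof -
    have "hausdorff_content s d (A n) < top"
      using fin by (rule ennreal_suminf_lessD)
    moreover have "0 < ennreal (e * (1/2)^Suc n)"
      using e by (simp add: ennreal_less_zero_iff)
    ultimately show ?thesis
      by (simp add: ennreal_add_left_cancel_less less_top)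
  qed
  have "\<exists>U. A n \<subseteq> (\<Union>i. U i) \<and> (\<forall>i. bounded (U i) \<and> diameter (U i) \<le> d) \<and>
      (\<Sum>i. f (U i)) \<le> hausdorff_content s d (A n) + e * (1/2)^Suc n" for n
    using *[of n] unfolding hausdorff_content_def[of s d "A n"] INF_less_iff f_def
    by (auto intro: less_imp_le)
  then obtain U where U: "\<And>n. A n \<subseteq> (\<Union>i. U n i)"
      "\<And>n i. bounded (U n i) \<and> diameter (U n i) \<le> d"
      "\<And>n. (\<Sum>i. f (U n i)) \<le> hausdorff_content s d (A n) + e * (1/2)^Suc n"
    by metis
  define C where "C = case_prod U o prod_decode"
  have C: "(\<Union>n. A n) \<subseteq> (\<Union>i. C i)"
    using U(1) by (auto simp add: C_def subset_eq) (metis prod.case prod_encode_inverse)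
  have "hausdorff_content s d (\<Union>n. A n) \<le> (\<Sum>i. f (C i))"
    unfolding hausdorff_content_def f_def
    by (rule INF_lower) (use C U(2) in \<open>auto simp: C_def split: prod.split\<close>)
  also have "\<dots> = (\<Sum>n. \<Sum>i. f (U n i))"
    unfolding C_def comp_def by (intro suminf_ennreal_2dimen) auto
  also have "\<dots> \<le> (\<Sum>n. hausdorff_content s d (A n) + e * (1/2) ^ Suc n)"
    by (intro suminf_le allI U(3)) auto
  also have "\<dots> = (\<Sum>n. hausdorff_content s d (A n)) + (\<Sum>n. ennreal e * ennreal ((1/2) ^ Suc n))"
    using e by (subst suminf_add[symmetric])
      (auto simp del: ennreal_suminf_cmult simp add: ennreal_mult[symmetric])
  also have "\<dots> = (\<Sum>n. hausdorff_content s d (A n)) + e"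
    unfolding ennreal_suminf_cmult
    by (subst suminf_ennreal_eq[OF zero_le_power power_half_series]) auto
  finally show "hausdorff_content s d (\<Union>n. A n) \<le> (\<Sum>n. hausdorff_content s d (A n)) + e" .
qed

lemma outer_measure_space_hausdorff:
  "outer_measure_space (Pow UNIV) (hausdorff_outer s :: 'a::metric_space set \<Rightarrow> ennreal)"
  unfolding outer_measure_space_def
proof (intro conjI)
  have "hausdorff_content s d ({} :: 'a set) = 0" if "d > 0" for d
  proof -
    have "hausdorff_content s d ({} :: 'a set) \<le> (\<Sum>i::nat. ennreal (diameter ({} :: 'a set) powr s))"
      unfolding hausdorff_content_def by (rule INF_lower) (use that in auto)
    then show ?thesis by simp
  qed
  then show "positive (Pow UNIV) (hausdorff_outer s :: 'a set \<Rightarrow> ennreal)"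
    by (auto simp: positive_def hausdorff_outer_def intro!: SUP_eq_const)
  show "increasing (Pow UNIV) (hausdorff_outer s :: 'a set \<Rightarrow> ennreal)"
    unfolding increasing_def hausdorff_outer_def
    by (intro ballI impI SUP_mono' hausdorff_content_mono)
  show "countably_subadditive (Pow UNIV) (hausdorff_outer s :: 'a set \<Rightarrow> ennreal)"
    unfolding countably_subadditive_def
  proof safe
    fix A :: "nat \<Rightarrow> 'a set"
    show "hausdorff_outer s (\<Union>n. A n) \<le> (\<Sum>n. hausdorff_outer s (A n))"
      unfolding hausdorff_outer_def[of s "\<Union>n. A n"]
    proof (rule SUP_least)
      fix d :: real assume d: "d \<in> {0<..}"
      have "hausdorff_content s d (\<Union>n. A n) \<le> (\<Sum>n. hausdorff_content s d (A n))"
        by (rule hausdorff_content_UN)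
      also have "\<dots> \<le> (\<Sum>n. hausdorff_outer s (A n))"
        unfolding hausdorff_outer_def by (intro suminf_le SUP_upper d) auto
      finally show "hausdorff_content s d (\<Union>n. A n) \<le> (\<Sum>n. hausdorff_outer s (A n))" .
    qed
  qed
qed

lemma measure_space_hausdorff:
  "measure_space (UNIV :: 'a::metric_space set)
     (lambda_system UNIV (Pow UNIV) (hausdorff_outer s)) (hausdorff_outer s)"
  by (rule sigma_algebra.caratheodory_lemma[OF sigma_algebra_Pow outer_measure_space_hausdorff])

lemma space_hausdorff [simp]: "space (hausdorff s) = UNIV"
  by (simp add: hausdorff_def)

lemma sets_hausdorff:
  "sets (hausdorff s) = lambda_system UNIV (Pow UNIV) (hausdorff_outer s)"
  unfolding hausdorff_def using measure_space_hausdorff[of s]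
  unfolding measure_space_def by (elim conjE) (rule sigma_algebra.sets_measure_of_eq)

lemma emeasure_hausdorff:
  "A \<in> sets (hausdorff s) \<Longrightarrow> emeasure (hausdorff s) A = hausdorff_outer s A"
  unfolding sets_hausdorff unfolding hausdorff_def using measure_space_hausdorff[of s]
  unfolding measure_space_def by (elim conjE) (rule emeasure_measure_of_sigma)


section \<open>The class of domains\<close>

definition ahlfors_regular :: "real \<Rightarrow> real \<Rightarrow> 'a::metric_space set \<Rightarrow> bool" where
  "ahlfors_regular s C0 E \<longleftrightarrow> closed E \<and> C0 > 0 \<and>
     (\<forall>x\<in>E. \<forall>r>0. ennreal r < ediam E \<longrightarrow>
        ennreal (inverse C0 * r powr s) \<le> emeasure (hausdorff s) (E \<inter> ball x r) \<and>
        emeasure (hausdorff s) (E \<inter> ball x r) \<le> ennreal (C0 * r powr s))"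

definition corkscrew :: "real \<Rightarrow> 'a::metric_space set \<Rightarrow> bool" where
  "corkscrew cs \<Omega> \<longleftrightarrow> cs \<in> {0<..<1/2} \<and>
     (\<forall>\<xi>\<in>frontier \<Omega>. \<forall>r>0. ennreal r < ediam \<Omega> \<longrightarrow>
        (\<exists>x\<in>\<Omega> \<inter> ball \<xi> r. ball x (cs * r) \<subseteq> \<Omega> \<inter> ball \<xi> r))"

text \<open>
  The class \<open>AR(s)\<close> in an ambient space of dimension \<open>n + 1\<close>, with Ahlfors constant \<open>C0\<close> and
  corkscrew constant \<open>cs\<close> made explicit; \<open>cs\<close> plays no role if \<open>s < n\<close>.
\<close>

definition AR_with :: "nat \<Rightarrow> real \<Rightarrow> real \<Rightarrow> real \<Rightarrow> 'a::euclidean_space set \<Rightarrow> bool" where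
  "AR_with n s C0 cs \<Omega> \<longleftrightarrow>
     (if s = real n then open \<Omega> \<and> corkscrew cs \<Omega> \<and> ahlfors_regular (real n) C0 (frontier \<Omega>)
      else \<exists>E. ahlfors_regular s C0 E \<and> \<Omega> = - E)"

text \<open>
  \<open>\<sigma>\<^sub>s\<close> lives on the space \<open>frontier \<Omega>\<close>: sets that are not contained in it are not measurable,
  so balls have to be intersected with the boundary.
\<close>

definition surface_measure :: "real \<Rightarrow> 'a::metric_space set \<Rightarrow> 'a measure" where
  "surface_measure s \<Omega> = restrict_space (hausdorff s) (frontier \<Omega>)"

text \<open>
  Distance to the complement. The convention \<open>infdist x {} = 0\<close> only concerns \<open>\<Omega> = UNIV\<close>, whose
  boundary is empty.
\<close>

definition dist_compl :: "'a::metric_space set \<Rightarrow> 'a \<Rightarrow> real" where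
  "dist_compl \<Omega> x = infdist x (- \<Omega>)"


section \<open>Function spaces on the boundary\<close>

definition mean :: "'a measure \<Rightarrow> 'a set \<Rightarrow> ('a \<Rightarrow> real) \<Rightarrow> real" where
  "mean M B f = (LINT y:B|M. f y) / measure M B"

definition locally_integrable :: "'a::topological_space measure \<Rightarrow> ('a \<Rightarrow> real) \<Rightarrow> bool" where
  "locally_integrable M f \<longleftrightarrow>
     f \<in> borel_measurable M \<and> (\<forall>K\<subseteq>space M. compact K \<longrightarrow> set_integrable M K f)"

definition campanato_norm ::
    "real \<Rightarrow> real \<Rightarrow> 'a::metric_space set \<Rightarrow> ('a \<Rightarrow> real) \<Rightarrow> ennreal" where
  "campanato_norm s \<beta> \<Omega> f =
     (SUP x\<in>frontier \<Omega>. SUP r\<in>{r. 0 < r \<and> ennreal r < 2 * ediam (frontier \<Omega>)}.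
        let \<sigma> = surface_measure s \<Omega>; B = ball x r \<inter> frontier \<Omega>
        in ennreal (1 / r powr \<beta> * mean \<sigma> B (\<lambda>y. \<bar>f y - mean \<sigma> B f\<bar>)))"

definition campanato :: "real \<Rightarrow> real \<Rightarrow> 'a::metric_space set \<Rightarrow> ('a \<Rightarrow> real) set" where
  "campanato s \<beta> \<Omega> =
     {f. locally_integrable (surface_measure s \<Omega>) f \<and> campanato_norm s \<beta> \<Omega> f < top}"

definition Lip :: "real \<Rightarrow> 'a::metric_space set \<Rightarrow> ('a \<Rightarrow> real) set" where
  "Lip \<beta> \<Sigma> = {f. (SUP x\<in>\<Sigma>. SUP y\<in>\<Sigma> - {x}. ennreal (\<bar>f x - f y\<bar> / dist x y powr \<beta>)) < top}"


section \<open>Smoothness and gradient\<close>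

primrec C_on :: "nat \<Rightarrow> ('a::real_normed_vector \<Rightarrow> real) \<Rightarrow> 'a set \<Rightarrow> bool" where
  "C_on 0 f S \<longleftrightarrow> continuous_on S f"
| "C_on (Suc k) f S \<longleftrightarrow>
     (\<forall>x\<in>S. f differentiable (at x)) \<and> (\<forall>v. C_on k (\<lambda>x. frechet_derivative f (at x) v) S)"

definition smooth_on :: "('a::real_normed_vector \<Rightarrow> real) \<Rightarrow> 'a set \<Rightarrow> bool" where
  "smooth_on f S \<longleftrightarrow> (\<forall>k. C_on k f S)"

definition grad :: "('a::real_inner \<Rightarrow> real) \<Rightarrow> 'a \<Rightarrow> 'a" where
  "grad f x = (THE D. GDERIV f x :> D)"


section \<open>Cones, sharp maximal function and Carleson functional\<close>

definition cone :: "'a::metric_space set \<Rightarrow> real \<Rightarrow> 'a \<Rightarrow> 'a set" where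
  "cone \<Omega> \<alpha> \<xi> = {x\<in>\<Omega>. dist x \<xi> < (1 + \<alpha>) * infdist x (frontier \<Omega>)}"

definition whitney_ball :: "'a::metric_space set \<Rightarrow> real \<Rightarrow> 'a \<Rightarrow> 'a set" where
  "whitney_ball \<Omega> c x = ball x (c * dist_compl \<Omega> x)"

definition N_sharp ::
    "'a::euclidean_space set \<Rightarrow> real \<Rightarrow> real \<Rightarrow> real \<Rightarrow> ('a \<Rightarrow> real) \<Rightarrow> 'a \<Rightarrow> ennreal" where
  "N_sharp \<Omega> \<alpha> \<beta> c w \<xi> =
     (SUP x\<in>cone \<Omega> \<alpha> \<xi>. ennreal (dist_compl \<Omega> x powr (- \<beta>)) *
        (SUP y\<in>whitney_ball \<Omega> c x. ennreal \<bar>w y - mean lebesgue (whitney_ball \<Omega> c x) w\<bar>))"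

definition carleson ::
    "nat \<Rightarrow> 'a::euclidean_space set \<Rightarrow> real \<Rightarrow> real \<Rightarrow> real \<Rightarrow> ('a \<Rightarrow> 'b::real_normed_vector) \<Rightarrow>
      'a \<Rightarrow> ennreal" where
  "carleson n \<Omega> s \<beta> c G \<xi> =
     (SUP r\<in>{0<..}. ennreal (1 / r powr (s + \<beta>)) *
        (\<integral>\<^sup>+ x\<in>ball \<xi> r \<inter> \<Omega>. (SUP y\<in>whitney_ball \<Omega> c x. ennreal (norm (G y))) *
            ennreal (dist_compl \<Omega> x powr (s - real n)) \<partial>lebesgue))"

definition nontangential_limit_at ::
    "'a::metric_space set \<Rightarrow> ('a \<Rightarrow> real) \<Rightarrow> ('a \<Rightarrow> real) \<Rightarrow> 'a \<Rightarrow> bool" where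
  "nontangential_limit_at \<Omega> F f \<xi> \<longleftrightarrow>
     (\<exists>\<alpha>>0. \<forall>X :: nat \<Rightarrow> 'a. (\<forall>k. X k \<in> cone \<Omega> \<alpha> \<xi>) \<and> X \<longlonglongrightarrow> \<xi> \<longrightarrow>
        (\<lambda>k. F (X k)) \<longlonglongrightarrow> f \<xi>)"

end

theory Submission
  imports Defs
begin

text \<open>
  The boundary \<open>E\<close> of the domain carries a measure \<open>\<sigma>\<close> under which balls of radius \<open>r\<close> have measure
  comparable to \<open>r powr s\<close>. The proof replaces the Campanato function by a Hoelder function and
  extends that one by an explicit smooth weighted average.

  Averages of \<open>f\<close> over concentric boundary balls change by at most a multiple of \<open>r powr \<beta>\<close> times the
  Campanato norm between the scales \<open>r\<close> and \<open>r / 2\<close>. Summing over scales, they converge everywhere, and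
  the limit \<open>g\<close> is Hoelder continuous of exponent \<open>\<beta>\<close> with a constant comparable to the norm
  (\<open>rep_holder\<close>). It agrees with \<open>f\<close> almost everywhere (\<open>AE_rep\<close>), and everywhere if \<open>f\<close> is continuous.

  For \<open>x\<close> off \<open>E\<close> let \<open>F x\<close> be the average of \<open>g\<close> with the weights \<open>dist x y powr (- 2 * k)\<close>, where \<open>k\<close> is
  large. Numerator and denominator are potentials with a rational kernel and hence smooth
  (\<open>pot_C_on\<close>). The weights concentrate at the scale \<open>\<delta>\<close>, the distance of \<open>x\<close> to \<open>E\<close>
  (\<open>nn_integral_kernel_ratio\<close>). Subtracting from \<open>g\<close> its value at the nearest boundary point, one
  finds that \<open>F x\<close> differs from that value by at most a multiple of \<open>\<delta> powr \<beta>\<close> and that the gradient is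
  at most a multiple of \<open>\<delta> powr (\<beta> - 1)\<close> (\<open>F_boundary\<close>, \<open>F_gradient\<close>).

  These two bounds make \<open>F\<close>, with boundary values \<open>g\<close>, Hoelder continuous on the closed domain
  (\<open>holder_closure\<close>). The sharp maximal function, the non-tangential limits and the final assertion about
  Lipschitz functions are read off from this. For the Carleson functional it remains to bound the
  integral of \<open>\<delta> powr (\<beta> + s - (n + 1))\<close> over the part of the domain in a ball of radius \<open>r\<close> centred on
  \<open>E\<close> by a multiple of \<open>r powr (s + \<beta>)\<close>; regularity turns \<open>\<delta> powr s\<close> into the measure of a boundary
  ball, and Tonelli's theorem reduces the claim to a radial integral (\<open>nn_integral_infdist_powr\<close>). On a
  Whitney ball of aperture at most \<open>1/2\<close> the distance to the boundary is comparable to that at the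
  centre, so \<open>1/2\<close> is a possible value of \<open>c0\<close> for every domain.

  Measure theory has to provide that Borel sets are measurable for Hausdorff measure
  (\<open>closed_sets_hausdorff\<close>), and that a regular set of dimension less than that of the space has empty
  interior, so that it is the boundary of its complement (\<open>empty_interior\<close>).
\<close>

section \<open>Powers and linear functionals\<close>

text \<open>
  Exponents at most \<open>1\<close> let a factor \<open>m\<close> in a distance reappear as the same factor \<open>m\<close> in its
  power, so that the triangle inequality costs numerical constants only.
\<close>

lemma powr_mult_le:
  fixes \<beta> :: real
  assumes "0 < \<beta>" "\<beta> \<le> 1" "1 \<le> m" "0 \<le> t" "0 \<le> d" "d \<le> m * t"
  shows "d powr \<beta> \<le> m * t powr \<beta>"
proof -
  have "d powr \<beta> \<le> (m * t) powr \<beta>" using assms by (intro powr_mono2) auto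
  also have "\<dots> = m powr \<beta> * t powr \<beta>" using assms by (simp add: powr_mult)
  also have "\<dots> \<le> m * t powr \<beta>"
    using powr_mono[of \<beta> 1 m] assms by (intro mult_right_mono) auto
  finally show ?thesis .
qed

lemma linear_eq_sum_Basis:
  fixes D :: "'a::euclidean_space \<Rightarrow> real"
  assumes "linear D"
  shows "D h = (\<Sum>b\<in>Basis. (h \<bullet> b) * D b)"
proof -
  have "D h = D (\<Sum>b\<in>Basis. (h \<bullet> b) *\<^sub>R b)" by (simp add: euclidean_representation)
  also have "\<dots> = (\<Sum>b\<in>Basis. (h \<bullet> b) * D b)"
    using linear_sum[OF assms, of "\<lambda>b. (h \<bullet> b) *\<^sub>R b" Basis] by (simp add: linear_cmul[OF assms])
  finally show ?thesis .
qed

section \<open>Borel sets and Hausdorff measure\<close>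

lemma hausdorff_content_antimono:
  "d \<le> d' \<Longrightarrow> hausdorff_content s d' A \<le> hausdorff_content s d A"
  unfolding hausdorff_content_def by (rule INF_superset_mono) (auto intro: order_trans)

lemma hausdorff_outer_mono: "A \<subseteq> B \<Longrightarrow> hausdorff_outer s A \<le> hausdorff_outer s B"
  unfolding hausdorff_outer_def by (intro SUP_mono' hausdorff_content_mono)

lemma hausdorff_outer_empty [simp]: "hausdorff_outer s ({} :: 'a::metric_space set) = 0"
  using outer_measure_space_hausdorff[where 'a='a, of s]
  by (simp add: outer_measure_space_def positive_def)

lemma hausdorff_outer_UN:
  fixes A :: "nat \<Rightarrow> 'a::metric_space set"
  shows "hausdorff_outer s (\<Union>n. A n) \<le> (\<Sum>n. hausdorff_outer s (A n))"
proof -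
  have sub: "hausdorff_outer s (\<Union>n. disjointed A n) \<le> (\<Sum>n. hausdorff_outer s (disjointed A n))"
    using outer_measure_space_hausdorff[where 'a='a, of s] disjoint_family_disjointed[of A]
    unfolding outer_measure_space_def countably_subadditive_def by blast
  also have "\<dots> \<le> (\<Sum>n. hausdorff_outer s (A n))"
    by (intro suminf_le allI hausdorff_outer_mono disjointed_subset) auto
  finally show ?thesis by (simp add: UN_disjointed_eq)
qed

lemma hausdorff_outer_Un:
  "hausdorff_outer s (A \<union> B) \<le> hausdorff_outer s A + hausdorff_outer s B"
proof -
  have "hausdorff_outer s (\<Union>n. binaryset A B n) \<le> (\<Sum>n. hausdorff_outer s (binaryset A B n))"
    by (rule hausdorff_outer_UN)
  also have "\<dots> = hausdorff_outer s A + hausdorff_outer s B"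
    by (rule suminf_binaryset_eq) simp
  finally show ?thesis by (simp add: UN_binaryset_eq)
qed

text \<open>
  A set of diameter at most \<open>d < e\<close> cannot meet both \<open>A\<close> and \<open>B\<close>. Hence every cover of the union
  splits into a cover of \<open>A\<close> and a cover of \<open>B\<close> that share no member.
\<close>

lemma hausdorff_content_separated:
  assumes sep: "\<And>a b. a \<in> A \<Longrightarrow> b \<in> B \<Longrightarrow> e \<le> dist a b" and d: "0 < d" "d < e"
  shows "hausdorff_content s d A + hausdorff_content s d B \<le> hausdorff_content s d (A \<union> B)"
  unfolding hausdorff_content_def[of s d "A \<union> B"]
proof (rule INF_greatest)
  fix U :: "nat \<Rightarrow> 'a set"
  assume U: "U \<in> {U. A \<union> B \<subseteq> (\<Union>i. U i) \<and> (\<forall>i. bounded (U i) \<and> diameter (U i) \<le> d)}"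
  define pick where "pick = (\<lambda>X i. if U i \<inter> X = {} then {} else U i)"
  have pick_cover: "hausdorff_content s d X \<le> (\<Sum>i. ennreal (diameter (pick X i) powr s))"
    if "X \<subseteq> A \<union> B" for X
    unfolding hausdorff_content_def
    by (rule INF_lower) (use that U d in \<open>auto simp: pick_def\<close>, blast)
  have excl: "U i \<inter> A = {} \<or> U i \<inter> B = {}" for i
  proof (rule ccontr)
    assume "\<not> ?thesis"
    then obtain a b where ab: "a \<in> U i" "a \<in> A" "b \<in> U i" "b \<in> B" by blast
    have "dist a b \<le> diameter (U i)" using U ab diameter_bounded_bound by blast
    also have "\<dots> \<le> d" using U by blast
    finally show False using sep[OF ab(2,4)] d by simp
  qed
  have "hausdorff_content s d A + hausdorff_content s d B
      \<le> (\<Sum>i. ennreal (diameter (pick A i) powr s)) + (\<Sum>i. ennreal (diameter (pick B i) powr s))"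
    by (intro add_mono pick_cover) auto
  also have "\<dots> = (\<Sum>i. ennreal (diameter (pick A i) powr s) + ennreal (diameter (pick B i) powr s))"
    by (rule suminf_add) auto
  also have "\<dots> \<le> (\<Sum>i. ennreal (diameter (U i) powr s))"
    by (intro suminf_le allI) (use excl in \<open>auto simp: pick_def\<close>)
  finally show "hausdorff_content s d A + hausdorff_content s d B
      \<le> (\<Sum>i. ennreal (diameter (U i) powr s))" .
qed

text \<open>
  The two suprema over scales may be taken at a common scale, since contents grow as the scale
  shrinks. This makes Hausdorff outer measure a metric outer measure.
\<close>

lemma hausdorff_outer_separated:
  assumes sep: "\<And>a b. a \<in> A \<Longrightarrow> b \<in> B \<Longrightarrow> e \<le> dist a b" and e: "0 < e"
  shows "hausdorff_outer s A + hausdorff_outer s B \<le> hausdorff_outer s (A \<union> B)"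
proof -
  have "hausdorff_content s d A + hausdorff_content s d' B \<le> hausdorff_outer s (A \<union> B)"
    if "d > 0" "d' > 0" for d d'
  proof -
    define t where "t = min (min d d') (e/2)"
    have t: "0 < t" "t < e" "t \<le> d" "t \<le> d'" using that e by (auto simp: t_def)
    have "hausdorff_content s d A + hausdorff_content s d' B
        \<le> hausdorff_content s t A + hausdorff_content s t B"
      by (intro add_mono hausdorff_content_antimono t)
    also have "\<dots> \<le> hausdorff_content s t (A \<union> B)"
      by (rule hausdorff_content_separated[OF sep t(1,2)])
    also have "\<dots> \<le> hausdorff_outer s (A \<union> B)"
      unfolding hausdorff_outer_def by (rule SUP_upper) (use t in auto)
    finally show ?thesis .
  qed
  then have "(SUP d'\<in>{0<..}. SUP d\<in>{0<..}. hausdorff_content s d A + hausdorff_content s d' B)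
      \<le> hausdorff_outer s (A \<union> B)"
    by (intro SUP_least) auto
  moreover have "(SUP d'\<in>{0<..}. SUP d\<in>{0<..}. hausdorff_content s d A + hausdorff_content s d' B)
      = hausdorff_outer s A + hausdorff_outer s B"
    unfolding hausdorff_outer_def
    by (simp add: ennreal_SUP_add_left ennreal_SUP_add_right)
  ultimately show ?thesis by simp
qed

lemma hausdorff_outer_sum_separated:
  fixes R :: "nat \<Rightarrow> 'a::metric_space set"
  assumes sep: "\<And>k. \<exists>e>0. \<forall>a\<in>(\<Union>i<k. R i). \<forall>b\<in>R k. e \<le> dist a b"
  shows "(\<Sum>i<k. hausdorff_outer s (R i)) \<le> hausdorff_outer s (\<Union>i<k. R i)"
proof (induction k)
  case (Suc k)
  obtain e where e: "e > 0" "\<forall>a\<in>(\<Union>i<k. R i). \<forall>b\<in>R k. e \<le> dist a b" using sep by blast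
  have "(\<Sum>i<Suc k. hausdorff_outer s (R i)) \<le> hausdorff_outer s (\<Union>i<k. R i) + hausdorff_outer s (R k)"
    using Suc.IH by (simp add: add_mono)
  also have "\<dots> \<le> hausdorff_outer s ((\<Union>i<k. R i) \<union> R k)"
    by (rule hausdorff_outer_separated[OF _ e(1)]) (use e(2) in blast)
  also have "(\<Union>i<k. R i) \<union> R k = (\<Union>i<Suc k. R i)"
    by (auto simp: lessThan_Suc)
  finally show ?case .
qed simp

text \<open>
  Consecutive rings may touch, but rings whose indices have the same parity are separated, so the
  even and the odd subfamily each have total mass at most that of \<open>T\<close>.
\<close>

lemma hausdorff_outer_rings_finite:
  fixes R :: "nat \<Rightarrow> 'a::metric_space set"
  assumes sep: "\<And>j. \<exists>e>0. \<forall>i<j. \<forall>a\<in>R i. \<forall>b\<in>R (Suc j). e \<le> dist a b"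
    and sub: "\<And>i. R i \<subseteq> T"
  shows "(\<Sum>i. hausdorff_outer s (R i)) \<le> 2 * hausdorff_outer s T"
proof -
  have sep': "\<exists>e>0. \<forall>a\<in>(\<Union>i<k. R (2*i+p)). \<forall>b\<in>R (2*k+p). e \<le> dist a b" for k p
  proof (cases k)
    case (Suc m)
    obtain e where e: "e > 0" "\<forall>i<2*m+p+1. \<forall>a\<in>R i. \<forall>b\<in>R (Suc (2*m+p+1)). e \<le> dist a b"
      using sep by blast
    have idx: "2 * i + p < 2 * m + p + 1" if "i < k" for i using that Suc by simp
    have "e \<le> dist a b" if "i < k" "a \<in> R (2*i+p)" "b \<in> R (2*k+p)" for a b i
      using e(2)[rule_format, OF idx[OF that(1)] that(2), of b] that(3) Suc by simp
    then show ?thesis using e(1) by blast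
  qed (auto intro: exI[of _ 1])
  have half: "(\<Sum>i<k. hausdorff_outer s (R (2*i+p))) \<le> hausdorff_outer s T" for k p
  proof -
    have "(\<Sum>i<k. hausdorff_outer s (R (2*i+p))) \<le> hausdorff_outer s (\<Union>i<k. R (2*i+p))"
      by (rule hausdorff_outer_sum_separated[of "\<lambda>i. R (2*i+p)"]) (use sep' in blast)
    also have "\<dots> \<le> hausdorff_outer s T" by (rule hausdorff_outer_mono) (use sub in blast)
    finally show ?thesis .
  qed
  show ?thesis
  proof (rule suminf_le_const)
    fix m
    have split: "(\<Sum>i<2*k. g i) = (\<Sum>i<k. g (2*i+0)) + (\<Sum>i<k. g (2*i+1))" for g :: "nat \<Rightarrow> ennreal" and k
      by (induction k) (auto simp: algebra_simps)
    have "(\<Sum>i<m. hausdorff_outer s (R i)) \<le> (\<Sum>i<2*m. hausdorff_outer s (R i))"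
      by (rule sum_mono2) auto
    also have "\<dots> \<le> hausdorff_outer s T + hausdorff_outer s T"
      unfolding split by (intro add_mono half)
    finally show "(\<Sum>i<m. hausdorff_outer s (R i)) \<le> 2 * hausdorff_outer s T"
      by (simp add: mult_2)
  qed auto
qed

text \<open>
  Caratheodory's criterion. The part \<open>F n\<close> of \<open>T\<close> at distance at least \<open>1 / (n + 1)\<close> from \<open>C\<close> is
  separated from \<open>T \<inter> C\<close>, and what is missing from \<open>T - C\<close> is covered by the rings \<open>R i\<close> with
  \<open>i \<ge> n\<close>. Their total mass is the tail of a convergent series.
\<close>

lemma closed_sets_hausdorff:
  fixes C :: "'a::metric_space set"
  assumes "closed C"
  shows "C \<in> sets (hausdorff s)"
proof (cases "C = {}")
  case False
  have key: "hausdorff_outer s (T \<inter> C) + hausdorff_outer s (T - C) \<le> hausdorff_outer s T" for T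
  proof (cases "hausdorff_outer s T = top")
    case fin: False
    define q where "q i = 1 / (real i + 1)" for i
    have q_dec: "q j \<le> q i" if "i \<le> j" for i j using that by (simp add: q_def frac_le)
    have q_dec': "q j < q i" if "i < j" for i j using that by (simp add: q_def field_simps)
    have q_pos: "q i > 0" for i by (simp add: q_def)
    define R where "R i = {x\<in>T. q (Suc i) \<le> infdist x C \<and> infdist x C < q i}" for i
    define F where "F n = {x\<in>T. q n \<le> infdist x C}" for n
    have "\<exists>e>0. \<forall>i<j. \<forall>a\<in>R i. \<forall>b\<in>R (Suc j). e \<le> dist a b" for j
    proof (intro exI[of _ "q j - q (Suc j)"] conjI allI impI ballI)
      show "q j - q (Suc j) > 0" using q_dec'[of j "Suc j"] by simp
      fix i a b assume "i < j" "a \<in> R i" "b \<in> R (Suc j)"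
      moreover have "infdist a C \<le> infdist b C + dist a b" by (rule infdist_triangle)
      ultimately show "q j - q (Suc j) \<le> dist a b" using q_dec[of "Suc i" j] by (simp add: R_def)
    qed
    then have "(\<Sum>i. hausdorff_outer s (R i)) \<le> 2 * hausdorff_outer s T"
      by (rule hausdorff_outer_rings_finite) (auto simp: R_def)
    also have "\<dots> < top" using fin by (simp add: less_top ennreal_mult_less_top)
    finally have sum_fin: "(\<Sum>i. hausdorff_outer s (R i)) < top" .
    have cover: "T - C \<subseteq> F n \<union> (\<Union>i. R (i + n))" for n
    proof
      fix x assume x: "x \<in> T - C"
      then have pos: "infdist x C > 0" using assms False by (simp add: infdist_pos_not_in_closed)
      show "x \<in> F n \<union> (\<Union>i. R (i + n))"
      proof (cases "q n \<le> infdist x C")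
        case False
        have "q \<longlonglongrightarrow> 0"
          using LIMSEQ_inverse_real_of_nat unfolding q_def divide_inverse by (simp add: add.commute)
        then obtain N where "q N < infdist x C"
          using pos order_tendstoD(2) by (metis eventually_sequentially order_refl)
        then have ex: "\<exists>N. q N \<le> infdist x C" by (auto intro: less_imp_le)
        \<comment> \<open>the first threshold below the distance determines the ring; it exceeds \<open>n\<close>\<close>
        define m where "m = (LEAST N. q N \<le> infdist x C)"
        have m: "q m \<le> infdist x C" unfolding m_def by (rule LeastI_ex[OF ex])
        have "\<not> m \<le> n" using False m q_dec[of m n] by auto
        then obtain i where i: "m = Suc (i + n)" by (metis less_iff_Suc_add not_le add.commute)
        have "\<not> q (i + n) \<le> infdist x C"
          using not_less_Least[of "i + n" "\<lambda>N. q N \<le> infdist x C"] i unfolding m_def by auto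
        then show ?thesis using x m i by (auto simp: R_def intro!: exI[of _ i])
      qed (use x in \<open>auto simp: F_def\<close>)
    qed
    have step: "hausdorff_outer s (T \<inter> C) + hausdorff_outer s (T - C)
        \<le> hausdorff_outer s T + (\<Sum>i. hausdorff_outer s (R (i + n)))" for n
    proof -
      have "hausdorff_outer s (T - C) \<le> hausdorff_outer s (F n) + hausdorff_outer s (\<Union>i. R (i + n))"
        by (rule order_trans[OF hausdorff_outer_mono[OF cover] hausdorff_outer_Un])
      also have "\<dots> \<le> hausdorff_outer s (F n) + (\<Sum>i. hausdorff_outer s (R (i + n)))"
        by (intro add_left_mono hausdorff_outer_UN)
      finally have "hausdorff_outer s (T \<inter> C) + hausdorff_outer s (T - C)
         \<le> (hausdorff_outer s (T \<inter> C) + hausdorff_outer s (F n)) + (\<Sum>i. hausdorff_outer s (R (i + n)))"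
        by (simp add: add.assoc add_left_mono)
      also have "hausdorff_outer s (T \<inter> C) + hausdorff_outer s (F n) \<le> hausdorff_outer s (T \<inter> C \<union> F n)"
      proof (rule hausdorff_outer_separated[OF _ q_pos[of n]])
        fix a b assume "a \<in> T \<inter> C" "b \<in> F n"
        then show "q n \<le> dist a b" using infdist_le[of a C b] by (auto simp: F_def dist_commute)
      qed
      also have "\<dots> \<le> hausdorff_outer s T" by (rule hausdorff_outer_mono) (auto simp: F_def)
      finally show ?thesis by (simp add: add_right_mono)
    qed
    have "(\<lambda>n. \<Sum>i. hausdorff_outer s (R (i + n))) \<longlonglongrightarrow> 0"
    proof -
      define r where "r i = enn2real (hausdorff_outer s (R i))" for i
      have r: "hausdorff_outer s (R i) = ennreal (r i)" for i
        using ennreal_suminf_lessD[OF sum_fin, of i] by (simp add: r_def)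
      have r_nn: "0 \<le> r i" for i by (simp add: r_def)
      have sr: "summable r"
        using sum_fin unfolding r by (intro summable_suminf_not_top r_nn) auto
      have "(\<lambda>n. \<Sum>i. r (i + n)) \<longlonglongrightarrow> 0"
        using suminf_exist_split2[OF sr] .
      then have "(\<lambda>n. ennreal (\<Sum>i. r (i + n))) \<longlonglongrightarrow> ennreal 0" by (intro tendsto_ennrealI)
      moreover have "ennreal (\<Sum>i. r (i + n)) = (\<Sum>i. hausdorff_outer s (R (i + n)))" for n
        unfolding r using sr r_nn by (subst suminf_ennreal2) (auto simp: summable_iff_shift)
      ultimately show ?thesis by simp
    qed
    then have "(\<lambda>n. hausdorff_outer s T + (\<Sum>i. hausdorff_outer s (R (i + n)))) \<longlonglongrightarrow> hausdorff_outer s T + 0"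
      by (intro tendsto_add tendsto_const)
    from LIMSEQ_le_const[OF this] show ?thesis using step by auto
  qed simp
  have "hausdorff_outer s (C \<inter> T) + hausdorff_outer s ((UNIV - C) \<inter> T) = hausdorff_outer s T" for T
  proof (rule antisym)
    show "hausdorff_outer s (C \<inter> T) + hausdorff_outer s ((UNIV - C) \<inter> T) \<le> hausdorff_outer s T"
      using key[of T] by (simp add: Int_commute Diff_eq)
    have "T = (C \<inter> T) \<union> ((UNIV - C) \<inter> T)" by blast
    then show "hausdorff_outer s T \<le> hausdorff_outer s (C \<inter> T) + hausdorff_outer s ((UNIV - C) \<inter> T)"
      using hausdorff_outer_Un by metis
  qed
  then show ?thesis by (simp add: sets_hausdorff lambda_system_def)
qed (simp)

lemma measurable_hausdorff_borel: "(\<lambda>x. x) \<in> measurable (hausdorff s) borel"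
proof (rule borel_measurableI)
  fix S :: "'a set" assume "open S"
  then have "space (hausdorff s) - (- S) \<in> sets (hausdorff s)"
    using closed_sets_hausdorff[of "- S"] by (metis closed_Compl sets.compl_sets)
  then show "(\<lambda>x. x) -` S \<inter> space (hausdorff s) \<in> sets (hausdorff s)"
    by (simp add: Diff_eq)
qed

lemma borel_sets_hausdorff:
  assumes "A \<in> sets borel" shows "A \<in> sets (hausdorff s)"
  using measurable_sets[OF measurable_hausdorff_borel assms, of s] by simp

lemma hausdorff_singleton: "emeasure (hausdorff s) {p :: 'a::metric_space} = 0"
proof -
  have "hausdorff_content s d {p} \<le> 0" if "d > 0" for d
  proof -
    have "hausdorff_content s d {p} \<le> (\<Sum>i::nat. ennreal (diameter {p} powr s))"
      unfolding hausdorff_content_def by (rule INF_lower) (use that in auto)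
    then show ?thesis by simp
  qed
  then have "hausdorff_outer s {p} \<le> 0" unfolding hausdorff_outer_def by (intro SUP_least) auto
  then show ?thesis by (subst emeasure_hausdorff) (auto intro!: closed_sets_hausdorff)
qed

section \<open>Smooth functions and gradients\<close>

lemma C_on_SucD:
  "C_on (Suc k) f S \<Longrightarrow> x \<in> S \<Longrightarrow> (f has_derivative frechet_derivative f (at x)) (at x)"
  by (simp add: frechet_derivative_works)

lemma C_on_cong:
  assumes "open S" "\<And>x. x \<in> S \<Longrightarrow> f x = g x" "C_on k f S"
  shows "C_on k g S"
  using assms(2,3)
proof (induction k arbitrary: f g)
  case 0
  then show ?case by (simp cong: continuous_on_cong)
next
  case (Suc k)
  have der: "(g has_derivative frechet_derivative f (at x)) (at x)" if "x \<in> S" for x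
    by (rule has_derivative_transform_within_open[OF C_on_SucD[OF Suc.prems(2) that] assms(1) that])
      (use Suc.prems in auto)
  then have eq: "frechet_derivative f (at x) = frechet_derivative g (at x)" if "x \<in> S" for x
    using frechet_derivative_at that by blast
  have "C_on k (\<lambda>x. frechet_derivative g (at x) v) S" for v
    by (rule Suc.IH[of "\<lambda>x. frechet_derivative f (at x) v"]) (use eq Suc.prems in auto)
  moreover have "g differentiable (at x)" if "x \<in> S" for x
    using der[OF that] by (auto simp: differentiable_def)
  ultimately show ?case by simp
qed

text \<open>
  On an open set the derivative may be given by any formula. Products, inverses and potentials can
  thus be differentiated by the usual rules, without computing \<open>frechet_derivative\<close>.
\<close>

lemma C_on_SucI:
  assumes "open S" and der: "\<And>x. x \<in> S \<Longrightarrow> (f has_derivative D x) (at x)"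
    and "\<And>v. C_on k (\<lambda>x. D x v) S"
  shows "C_on (Suc k) f S"
proof -
  have "D x = frechet_derivative f (at x)" if "x \<in> S" for x
    by (rule frechet_derivative_at[OF der[OF that]])
  then have "C_on k (\<lambda>x. frechet_derivative f (at x) v) S" for v
    by (intro C_on_cong[OF assms(1) _ assms(3)[of v]]) auto
  then show ?thesis using der by (auto simp: differentiable_def)
qed

lemma C_on_Suc_imp: "C_on (Suc k) f S \<Longrightarrow> C_on k f S"
proof (induction k arbitrary: f)
  case 0
  then show ?case
    by (auto intro!: continuous_at_imp_continuous_on differentiable_imp_continuous_within)
next
  case (Suc k)
  from Suc.prems have "\<And>v. C_on (Suc k) (\<lambda>x. frechet_derivative f (at x) v) S"
    and d: "\<forall>x\<in>S. f differentiable (at x)" by auto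
  then show ?case using Suc.IH by simp
qed

lemma C_on_le: "j \<le> k \<Longrightarrow> C_on k f S \<Longrightarrow> C_on j f S"
  by (induction k rule: dec_induct) (auto dest: C_on_Suc_imp simp del: C_on.simps)

lemma C_on_imp_continuous: "C_on k f S \<Longrightarrow> continuous_on S f"
  using C_on_le[of 0 k f S] by simp

lemma C_on_subset: "C_on k f S \<Longrightarrow> T \<subseteq> S \<Longrightarrow> C_on k f T"
  by (induction k arbitrary: f) (auto intro: continuous_on_subset)

lemma C_on_const [simp]: "C_on k (\<lambda>x. c) S"
  by (induction k arbitrary: c) auto

lemma C_on_add: "open S \<Longrightarrow> C_on k f S \<Longrightarrow> C_on k g S \<Longrightarrow> C_on k (\<lambda>x. f x + g x) S"
proof (induction k arbitrary: f g)
  case (Suc k)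
  show ?case
  proof (rule C_on_SucI[OF Suc.prems(1)])
    fix x assume "x \<in> S"
    then show "((\<lambda>x. f x + g x) has_derivative
        (\<lambda>v. frechet_derivative f (at x) v + frechet_derivative g (at x) v)) (at x)"
      using C_on_SucD[OF Suc.prems(2)] C_on_SucD[OF Suc.prems(3)] by (intro has_derivative_add) auto
  qed (use Suc in simp)
qed (simp add: continuous_on_add)

lemma C_on_mult: "open S \<Longrightarrow> C_on k f S \<Longrightarrow> C_on k g S \<Longrightarrow> C_on k (\<lambda>x. f x * g x) S"
proof (induction k arbitrary: f g)
  case (Suc k)
  note f = C_on_Suc_imp[OF Suc.prems(2)] and g = C_on_Suc_imp[OF Suc.prems(3)]
  show ?case
  proof (rule C_on_SucI[OF Suc.prems(1)])
    fix x assume "x \<in> S"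
    then show "((\<lambda>x. f x * g x) has_derivative
        (\<lambda>v. f x * frechet_derivative g (at x) v + frechet_derivative f (at x) v * g x)) (at x)"
      using C_on_SucD[OF Suc.prems(2)] C_on_SucD[OF Suc.prems(3)] by (intro has_derivative_mult) auto
  next
    fix v
    show "C_on k (\<lambda>x. f x * frechet_derivative g (at x) v + frechet_derivative f (at x) v * g x) S"
      by (intro C_on_add Suc.IH f g Suc.prems(1)) (use Suc.prems in auto)
  qed
qed (simp add: continuous_on_mult)

lemma C_on_inverse:
  "open S \<Longrightarrow> C_on k f S \<Longrightarrow> (\<And>x. x \<in> S \<Longrightarrow> f x \<noteq> 0) \<Longrightarrow> C_on k (\<lambda>x. inverse (f x)) S"
proof (induction k)
  case (Suc k)
  have inv: "C_on k (\<lambda>x. inverse (f x)) S"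
    using Suc.IH Suc.prems C_on_Suc_imp by blast
  show ?case
  proof (rule C_on_SucI[OF Suc.prems(1)])
    fix x assume x: "x \<in> S"
    show "((\<lambda>x. inverse (f x)) has_derivative
        (\<lambda>v. (- 1) * (inverse (f x) * frechet_derivative f (at x) v * inverse (f x)))) (at x)"
      using Deriv.has_derivative_inverse[OF Suc.prems(3)[OF x] C_on_SucD[OF Suc.prems(2) x]] by simp
  next
    fix v
    show "C_on k (\<lambda>x. (- 1) * (inverse (f x) * frechet_derivative f (at x) v * inverse (f x))) S"
      by (intro C_on_mult C_on_const inv Suc.prems(1)) (use Suc.prems in auto)
  qed
qed (simp add: continuous_on_inverse)

lemma C_on_linear: "bounded_linear f \<Longrightarrow> open S \<Longrightarrow> C_on k f S"
  by (cases k) (auto simp: linear_continuous_on intro!: C_on_SucI bounded_linear_imp_has_derivative simp del: C_on.simps(2))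

lemma C_on_power: "open S \<Longrightarrow> C_on k f S \<Longrightarrow> C_on k (\<lambda>x. f x ^ n) S"
  by (induction n) (auto intro: C_on_mult)

lemma C_on_sum:
  "open S \<Longrightarrow> (\<And>i. i \<in> I \<Longrightarrow> C_on k (f i) S) \<Longrightarrow> C_on k (\<lambda>x. \<Sum>i\<in>I. f i x) S"
  by (induction I rule: infinite_finite_induct) (auto intro: C_on_add)

text \<open>
  The gradient is a definite description; the Riesz representation of the derivative shows that it
  denotes something.
\<close>

lemma has_derivative_grad:
  fixes F :: "'a::euclidean_space \<Rightarrow> real"
  assumes D: "(F has_derivative D) (at x)"
  shows "D = (\<lambda>h. h \<bullet> grad F x)"
proof -
  define v where "v = (\<Sum>b\<in>Basis. D b *\<^sub>R b)"
  have lin: "linear D" by (rule has_derivative_linear[OF D])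
  have "D h = h \<bullet> v" for h
    by (subst linear_eq_sum_Basis[OF lin]) (simp add: v_def inner_sum_right mult.commute)
  then have Dv: "D = (\<lambda>h. h \<bullet> v)" by auto
  then have g: "GDERIV F x :> v" using D by (simp add: gderiv_def)
  have "grad F x = v" unfolding grad_def
  proof (rule the_equality)
    show "GDERIV F x :> v" by (rule g)
    fix w assume "GDERIV F x :> w"
    then have "(\<lambda>h. h \<bullet> w) = (\<lambda>h. h \<bullet> v)"
      using g unfolding gderiv_def by (rule has_derivative_unique)
    then have "(w - v) \<bullet> w = (w - v) \<bullet> v" by meson
    then have "(w - v) \<bullet> (w - v) = 0" by (simp add: inner_diff_right)
    then show "w = v" by simp
  qed
  with Dv show ?thesis by simp
qed

lemma norm_grad_le:
  fixes F :: "'a::euclidean_space \<Rightarrow> real"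
  assumes D: "(F has_derivative D) (at x)" and le: "\<And>h. \<bar>D h\<bar> \<le> B * norm h"
  shows "norm (grad F x) \<le> B"
proof (cases "grad F x = 0")
  case True
  obtain b :: 'a where "b \<in> Basis" using nonempty_Basis by blast
  then show ?thesis using le[of b] True by simp
next
  case False
  let ?v = "grad F x"
  have "norm ?v * norm ?v = D ?v"
    by (subst has_derivative_grad[OF D]) (simp add: power2_norm_eq_inner[symmetric] power2_eq_square)
  also have "\<dots> \<le> B * norm ?v" using le[of ?v] by simp
  finally show ?thesis using False by (simp add: mult_le_cancel_right)
qed

lemma grad_const [simp]: "grad (\<lambda>_. c) (x :: 'a::euclidean_space) = 0"
proof -
  have "(\<lambda>h::'a. 0) = (\<lambda>h. h \<bullet> grad (\<lambda>_. c) x)"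
    by (rule has_derivative_grad) simp
  then have "grad (\<lambda>_. c) x \<bullet> grad (\<lambda>_. c) x = 0" by metis
  then show ?thesis by simp
qed

lemma smooth_on_const [simp]: "smooth_on (\<lambda>_. c) S"
  by (simp add: smooth_on_def)

section \<open>Potentials with homogeneous kernels\<close>

text \<open>
  Kernels are only ever evaluated at differences of distinct points, so their value at the origin is
  left free.
\<close>

definition homogeneous :: "real \<Rightarrow> ('a::real_vector \<Rightarrow> real) \<Rightarrow> bool" where
  "homogeneous m \<kappa> \<longleftrightarrow> (\<forall>t>0. \<forall>z. z \<noteq> 0 \<longrightarrow> \<kappa> (t *\<^sub>R z) = t powr m * \<kappa> z)"

text \<open>
  The unit sphere is compact, and homogeneity carries a bound there to all scales.
\<close>

lemma homogeneous_bound: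
  fixes \<kappa> :: "'a::euclidean_space \<Rightarrow> real"
  assumes cont: "continuous_on (- {0}) \<kappa>" and hom: "homogeneous m \<kappa>"
  obtains C where "C \<ge> 0" "\<And>z. z \<noteq> 0 \<Longrightarrow> \<bar>\<kappa> z\<bar> \<le> C * norm z powr m"
proof -
  have "compact (\<kappa> ` sphere 0 1)"
    by (intro compact_continuous_image continuous_on_subset[OF cont]) auto
  then obtain C where C: "C > 0" "\<And>z. z \<in> sphere 0 1 \<Longrightarrow> \<bar>\<kappa> z\<bar> \<le> C"
    using compact_imp_bounded bounded_pos by (metis imageI real_norm_def)
  show ?thesis
  proof (rule that[of C])
    fix z :: 'a assume z: "z \<noteq> 0"
    have "\<kappa> (norm z *\<^sub>R (z /\<^sub>R norm z)) = norm z powr m * \<kappa> (z /\<^sub>R norm z)"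
      using hom z unfolding homogeneous_def by (metis norm_eq_zero zero_less_norm_iff scaleR_eq_0_iff inverse_zero_imp_zero)
    moreover have "\<bar>\<kappa> (z /\<^sub>R norm z)\<bar> \<le> C" using z by (intro C) simp
    ultimately show "\<bar>\<kappa> z\<bar> \<le> C * norm z powr m" using z by (simp add: abs_mult mult.commute mult_left_mono)
  qed (use C in auto)
qed

lemma homogeneous_derivative:
  fixes \<kappa> :: "'a::real_normed_vector \<Rightarrow> real"
  assumes hom: "homogeneous m \<kappa>" and diff: "\<And>z. z \<noteq> 0 \<Longrightarrow> \<kappa> differentiable (at z)"
  shows "homogeneous (m - 1) (\<lambda>z. frechet_derivative \<kappa> (at z) v)"
  unfolding homogeneous_def
proof (intro allI impI)
  fix t :: real and z :: 'a assume t: "t > 0" and z: "z \<noteq> 0"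
  let ?D = "\<lambda>z. frechet_derivative \<kappa> (at z)"
  have d: "(\<kappa> has_derivative ?D w) (at w)" if "w \<noteq> 0" for w
    using diff[OF that] by (simp add: frechet_derivative_works)
  have "((\<lambda>w. \<kappa> (t *\<^sub>R w)) has_derivative (\<lambda>h. ?D (t *\<^sub>R z) (t *\<^sub>R h))) (at z)"
    using t z by (intro has_derivative_compose[OF _ d]) (auto intro!: derivative_eq_intros)
  moreover have "((\<lambda>w. \<kappa> (t *\<^sub>R w)) has_derivative (\<lambda>h. t powr m * ?D z h)) (at z)"
  proof (rule has_derivative_transform_within_open[OF _ open_delete[OF open_UNIV, of 0]])
    show "((\<lambda>w. t powr m * \<kappa> w) has_derivative (\<lambda>h. t powr m * ?D z h)) (at z)"
      by (intro has_derivative_mult_right d z)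
  qed (use z t hom in \<open>auto simp: homogeneous_def\<close>)
  ultimately have "(\<lambda>h. ?D (t *\<^sub>R z) (t *\<^sub>R h)) = (\<lambda>h. t powr m * ?D z h)"
    by (rule has_derivative_unique)
  then have "?D (t *\<^sub>R z) (t *\<^sub>R v) = t powr m * ?D z v" by meson
  moreover have "?D (t *\<^sub>R z) (t *\<^sub>R v) = t * ?D (t *\<^sub>R z) v"
    using has_derivative_linear[OF d[of "t *\<^sub>R z"]] t z by (simp add: linear_cmul)
  ultimately show "?D (t *\<^sub>R z) v = t powr (m - 1) * ?D z v"
    using t by (simp add: powr_diff field_simps)
qed

text \<open>
  Two applications of the mean value theorem on the segment from \<open>z\<close> to \<open>z + h\<close>. The segment stays
  outside the ball of radius \<open>norm z / 2\<close>, where the second derivatives, being homogeneous of degree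
  \<open>m - 2\<close>, are at most a multiple of \<open>norm z powr (m - 2)\<close>. The constant is uniform in \<open>z\<close>, so the
  estimate can be integrated against a measure.
\<close>

lemma homogeneous_taylor:
  fixes \<kappa> :: "'a::euclidean_space \<Rightarrow> real"
  assumes C2: "C_on 2 \<kappa> (- {0})" and hom: "homogeneous m \<kappa>" and m: "m \<le> 2"
  shows "\<exists>C\<ge>0. \<forall>z h. z \<noteq> 0 \<longrightarrow> norm h \<le> norm z / 2 \<longrightarrow>
    \<bar>\<kappa> (z + h) - \<kappa> z - frechet_derivative \<kappa> (at z) h\<bar> \<le> C * (norm h)\<^sup>2 * norm z powr (m - 2)"
proof -
  define D where "D v z = frechet_derivative \<kappa> (at z) v" for v z
  define D2 where "D2 v w z = frechet_derivative (D v) (at z) w" for v w z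
  have C1: "C_on (Suc 0) (D v) (- {0})" for v
    using C2 by (simp add: D_def[abs_def] numeral_2_eq_2)
  have C1': "C_on (Suc 0) \<kappa> (- {0})" by (rule C_on_le[OF _ C2]) simp
  have dk: "(\<kappa> has_derivative (\<lambda>v. D v z)) (at z)" if "z \<noteq> 0" for z
    using C_on_SucD[OF C1'] that by (simp add: D_def)
  have dD: "(D v has_derivative (\<lambda>w. D2 v w z)) (at z)" if "z \<noteq> 0" for z v
    using C_on_SucD[OF C1] that by (simp add: D2_def)
  have homD: "homogeneous (m - 1) (D v)" for v
    unfolding D_def[abs_def] by (rule homogeneous_derivative[OF hom]) (use dk in \<open>auto simp: differentiable_def\<close>)
  have homD2: "homogeneous (m - 2) (D2 v w)" for v w
    using homogeneous_derivative[OF homD, of v w] dD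
    unfolding D2_def[abs_def] by (auto simp: differentiable_def)
  have contD2: "continuous_on (- {0}) (D2 v w)" for v w
    using C1[of v] by (simp add: D2_def[abs_def])
  have "\<exists>C\<ge>0. \<forall>z. z \<noteq> 0 \<longrightarrow> \<bar>D2 v w z\<bar> \<le> C * norm z powr (m - 2)" for v w
    using homogeneous_bound[OF contD2 homD2] by metis
  then obtain c where c: "\<And>v w. 0 \<le> c v w" "\<And>v w z. z \<noteq> 0 \<Longrightarrow> \<bar>D2 v w z\<bar> \<le> c v w * norm z powr (m - 2)"
    by metis
  define C0 where "C0 = (\<Sum>b\<in>Basis. \<Sum>b'\<in>Basis. c b b')"
  have C0: "C0 \<ge> 0" unfolding C0_def by (intro sum_nonneg c)
  have D_expand: "D h z = (\<Sum>b\<in>Basis. (h \<bullet> b) * D b z)" if "z \<noteq> 0" for h z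
    by (rule linear_eq_sum_Basis[OF has_derivative_linear[OF dk[OF that]]])
  have D2_bound: "\<bar>D2 h h z\<bar> \<le> C0 * (norm h)\<^sup>2 * norm z powr (m - 2)" if z: "z \<noteq> 0" for h z
  proof -
    have "((\<lambda>z. \<Sum>b\<in>Basis. (h \<bullet> b) * D b z) has_derivative (\<lambda>w. \<Sum>b\<in>Basis. (h \<bullet> b) * D2 b w z)) (at z)"
      by (intro has_derivative_sum has_derivative_mult_right dD z)
    then have "(D h has_derivative (\<lambda>w. \<Sum>b\<in>Basis. (h \<bullet> b) * D2 b w z)) (at z)"
      by (rule has_derivative_transform_within_open[OF _ open_delete[OF open_UNIV, of 0]]) (use z D_expand in auto)
    then have "(\<lambda>w. D2 h w z) = (\<lambda>w. \<Sum>b\<in>Basis. (h \<bullet> b) * D2 b w z)"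
      using dD[OF z] has_derivative_unique by blast
    then have "D2 h h z = (\<Sum>b\<in>Basis. (h \<bullet> b) * D2 b h z)" by meson
    also have "\<dots> = (\<Sum>b\<in>Basis. (h \<bullet> b) * (\<Sum>b'\<in>Basis. (h \<bullet> b') * D2 b b' z))"
      by (intro sum.cong refl arg_cong2[where f="(*)"] linear_eq_sum_Basis has_derivative_linear[OF dD[OF z]])
    also have "\<bar>\<dots>\<bar> \<le> (\<Sum>b\<in>Basis. norm h * (\<Sum>b'\<in>Basis. norm h * (c b b' * norm z powr (m - 2))))"
    proof (intro order_trans[OF sum_abs] sum_mono)
      fix b :: 'a assume b: "b \<in> Basis"
      have "\<bar>\<Sum>b'\<in>Basis. (h \<bullet> b') * D2 b b' z\<bar> \<le> (\<Sum>b'\<in>Basis. norm h * (c b b' * norm z powr (m - 2)))"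
        by (intro order_trans[OF sum_abs] sum_mono)
          (auto simp: abs_mult intro!: mult_mono Basis_le_norm c z)
      then show "\<bar>h \<bullet> b * (\<Sum>b'\<in>Basis. (h \<bullet> b') * D2 b b' z)\<bar>
          \<le> norm h * (\<Sum>b'\<in>Basis. norm h * (c b b' * norm z powr (m - 2)))"
        using b by (auto simp: abs_mult intro!: mult_mono Basis_le_norm)
    qed
    also have "\<dots> = C0 * (norm h)\<^sup>2 * norm z powr (m - 2)"
      by (simp add: C0_def sum_distrib_left sum_distrib_right power2_eq_square mult_ac)
    finally show ?thesis .
  qed
  show ?thesis
  proof (intro exI[of _ "C0 * (1/2) powr (m - 2)"] conjI allI impI)
    show "C0 * (1/2) powr (m - 2) \<ge> 0" using C0 by simp
    fix z h :: 'a assume z: "z \<noteq> 0" and h: "norm h \<le> norm z / 2"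
    have seg: "norm z / 2 \<le> norm (z + t *\<^sub>R h)" if "0 \<le> t" "t \<le> 1" for t
    proof -
      have "norm (t *\<^sub>R h) \<le> norm h" using that by (simp add: mult_left_le_one_le)
      then show ?thesis using h norm_diff_ineq[of z "t *\<^sub>R h"] by simp
    qed
    have seg0: "z + t *\<^sub>R h \<noteq> 0" if "0 \<le> t" "t \<le> 1" for t using seg[OF that] z by auto
    have line: "((\<lambda>t. z + t *\<^sub>R h) has_derivative (\<lambda>u. u *\<^sub>R h)) (at t)" for t
      by (auto intro!: derivative_eq_intros)
    have lin: "D (u *\<^sub>R h) w = u * D h w" if "w \<noteq> 0" for u w
      using linear_cmul[OF has_derivative_linear[OF dk[OF that]], of u h] by simp
    have lin2: "D2 h (u *\<^sub>R h) w = u * D2 h h w" if "w \<noteq> 0" for u w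
      using linear_cmul[OF has_derivative_linear[OF dD[OF that]], of h u h] by simp
    have "((\<lambda>t. \<kappa> (z + t *\<^sub>R h) - t * D h z) has_real_derivative (D h (z + t *\<^sub>R h) - D h z)) (at t)"
      if "0 \<le> t" "t \<le> 1" for t
    proof -
      have "((\<lambda>t. \<kappa> (z + t *\<^sub>R h)) has_derivative (\<lambda>u. D (u *\<^sub>R h) (z + t *\<^sub>R h))) (at t)"
        by (rule has_derivative_compose[OF line dk[OF seg0[OF that]]])
      then have "((\<lambda>t. \<kappa> (z + t *\<^sub>R h)) has_real_derivative (D h (z + t *\<^sub>R h))) (at t)"
        unfolding has_field_derivative_def
        by (rule has_derivative_eq_rhs) (simp add: fun_eq_iff lin[OF seg0[OF that]] mult.commute)
      moreover have "((\<lambda>t. t * D h z) has_real_derivative D h z) (at t)"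
        by (rule DERIV_cmult_right[OF DERIV_ident, THEN DERIV_cong]) simp
      ultimately show ?thesis by (rule DERIV_diff)
    qed
    then obtain \<tau> where \<tau>: "0 < \<tau>" "\<tau> < 1"
      "(\<kappa> (z + 1 *\<^sub>R h) - 1 * D h z) - (\<kappa> (z + 0 *\<^sub>R h) - 0 * D h z) = (1 - 0) * (D h (z + \<tau> *\<^sub>R h) - D h z)"
      using MVT2[of 0 1 "\<lambda>t. \<kappa> (z + t *\<^sub>R h) - t * D h z" "\<lambda>t. D h (z + t *\<^sub>R h) - D h z"] by auto
    have "((\<lambda>t. D h (z + t *\<^sub>R h)) has_real_derivative (D2 h h (z + t *\<^sub>R h))) (at t)"
      if "0 \<le> t" "t \<le> \<tau>" for t
    proof -
      have t: "z + t *\<^sub>R h \<noteq> 0" using that \<tau> by (intro seg0) auto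
      have "((\<lambda>t. D h (z + t *\<^sub>R h)) has_derivative (\<lambda>u. D2 h (u *\<^sub>R h) (z + t *\<^sub>R h))) (at t)"
        by (rule has_derivative_compose[OF line dD[OF t]])
      then show ?thesis
        unfolding has_field_derivative_def
        by (rule has_derivative_eq_rhs) (simp add: fun_eq_iff lin2[OF t] mult.commute)
    qed
    then obtain \<sigma> where \<sigma>: "0 < \<sigma>" "\<sigma> < \<tau>"
      "D h (z + \<tau> *\<^sub>R h) - D h (z + 0 *\<^sub>R h) = (\<tau> - 0) * D2 h h (z + \<sigma> *\<^sub>R h)"
      using MVT2[of 0 \<tau> "\<lambda>t. D h (z + t *\<^sub>R h)" "\<lambda>t. D2 h h (z + t *\<^sub>R h)"] \<tau> by auto
    have w: "z + \<sigma> *\<^sub>R h \<noteq> 0" "norm z / 2 \<le> norm (z + \<sigma> *\<^sub>R h)" using \<sigma> \<tau> seg0 seg by auto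
    have "\<kappa> (z + h) - \<kappa> z - D h z = \<tau> * D2 h h (z + \<sigma> *\<^sub>R h)" using \<tau>(3) \<sigma>(3) by simp
    also have "\<bar>\<dots>\<bar> \<le> \<bar>D2 h h (z + \<sigma> *\<^sub>R h)\<bar>" using \<tau> by (simp add: abs_mult mult_left_le_one_le)
    also have "\<dots> \<le> C0 * (norm h)\<^sup>2 * norm (z + \<sigma> *\<^sub>R h) powr (m - 2)" by (rule D2_bound[OF w(1)])
    also have "\<dots> \<le> C0 * (norm h)\<^sup>2 * (norm z / 2) powr (m - 2)"
      using w z C0 m by (intro mult_left_mono powr_mono2') auto
    also have "\<dots> = C0 * (1/2) powr (m - 2) * (norm h)\<^sup>2 * norm z powr (m - 2)"
      by (simp add: powr_divide)
    finally show "\<bar>\<kappa> (z + h) - \<kappa> z - frechet_derivative \<kappa> (at z) h\<bar>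
        \<le> C0 * (1/2) powr (m - 2) * (norm h)\<^sup>2 * norm z powr (m - 2)"
      by (simp add: D_def)
  qed
qed

text \<open>
  A potential integrates a kernel \<open>\<kappa> (x - y)\<close> against a weight \<open>g\<close> carried by \<open>E\<close>. Differentiating
  a homogeneous kernel only increases its rate of decay, so finiteness of all moments of order at
  least \<open>M\<close> is stable under differentiation.
\<close>

locale potential =
  fixes E :: "'a::euclidean_space set" and \<nu> :: "'a measure" and g :: "'a \<Rightarrow> real" and M :: real
  assumes closed_E: "closed E" and space_eq: "space \<nu> = E"
    and id_meas: "(\<lambda>x. x) \<in> borel_measurable \<nu>" and g_meas: "g \<in> borel_measurable \<nu>"
    and M_nonneg: "0 \<le> M"
    and moments: "\<And>x m. x \<notin> E \<Longrightarrow> M \<le> m \<Longrightarrow> integrable \<nu> (\<lambda>y. g y * norm (x - y) powr (- m))"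
begin

definition pot :: "('a \<Rightarrow> real) \<Rightarrow> 'a \<Rightarrow> real" where
  "pot \<kappa> x = (LINT y|\<nu>. g y * \<kappa> (x - y))"

lemma kernel_meas:
  assumes "continuous_on (- {0}) \<kappa>"
  shows "(\<lambda>y. g y * \<kappa> (x - y)) \<in> borel_measurable \<nu>"
proof -
  have "\<kappa> \<in> borel_measurable borel"
    by (rule borel_measurable_continuous_countable_exceptions[where X = "{0}"]) (use assms in auto)
  moreover have "(\<lambda>y. x - y) \<in> borel_measurable \<nu>"
    using id_meas by (intro borel_measurable_diff) auto
  ultimately have "(\<lambda>y. \<kappa> (x - y)) \<in> borel_measurable \<nu>" by (rule measurable_compose[rotated])
  then show ?thesis by (rule borel_measurable_times[OF g_meas])
qed

lemma pot_integrable: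
  assumes x: "x \<notin> E" and cont: "continuous_on (- {0}) \<kappa>" and hom: "homogeneous (- m) \<kappa>" and m: "M \<le> m"
  shows "integrable \<nu> (\<lambda>y. g y * \<kappa> (x - y))"
proof -
  obtain C where C: "C \<ge> 0" "\<And>z. z \<noteq> 0 \<Longrightarrow> \<bar>\<kappa> z\<bar> \<le> C * norm z powr (- m)"
    using homogeneous_bound[OF cont hom] by blast
  show ?thesis
  proof (rule Bochner_Integration.integrable_bound)
    show "integrable \<nu> (\<lambda>y. C * (g y * norm (x - y) powr (- m)))"
      by (intro integrable_mult_right moments x m)
    show "AE y in \<nu>. norm (g y * \<kappa> (x - y)) \<le> norm (C * (g y * norm (x - y) powr (- m)))"
    proof (rule AE_I2)
      fix y assume "y \<in> space \<nu>"
      then have "x - y \<noteq> 0" using x space_eq by auto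
      then have "\<bar>g y\<bar> * \<bar>\<kappa> (x - y)\<bar> \<le> \<bar>g y\<bar> * (C * norm (x - y) powr (- m))"
        by (intro mult_left_mono C) auto
      then show "norm (g y * \<kappa> (x - y)) \<le> norm (C * (g y * norm (x - y) powr (- m)))"
        using C(1) by (simp add: abs_mult mult_ac)
    qed
  qed (rule kernel_meas[OF cont])
qed

text \<open>
  The Taylor remainder of the kernel is bounded by \<open>(norm h)\<^sup>2\<close> times a fixed integrable function of
  \<open>y\<close>, so the remainder of the potential is quadratic in \<open>h\<close>.
\<close>

lemma pot_has_derivative:
  assumes x: "x \<notin> E" and C2: "C_on 2 \<kappa> (- {0})" and hom: "homogeneous (- m) \<kappa>" and m: "M \<le> m"
  shows "(pot \<kappa> has_derivative (\<lambda>v. pot (\<lambda>z. frechet_derivative \<kappa> (at z) v) x)) (at x)"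
proof -
  let ?D = "\<lambda>v z. frechet_derivative \<kappa> (at z) v"
  have C1: "C_on (Suc 0) \<kappa> (- {0})" by (rule C_on_le[OF _ C2]) simp
  have diff: "(\<kappa> has_derivative (\<lambda>v. ?D v z)) (at z)" if "z \<noteq> 0" for z
    using C_on_SucD[OF C1] that by simp
  have cont: "continuous_on (- {0}) \<kappa>" by (rule C_on_imp_continuous[OF C2])
  have contD: "continuous_on (- {0}) (?D v)" for v using C1 by simp
  have homD: "homogeneous (- (m + 1)) (?D v)" for v
    using homogeneous_derivative[OF hom, of v] diff by (auto simp: differentiable_def)
  have intD: "integrable \<nu> (\<lambda>y. g y * ?D v (x - y))" for v
    by (rule pot_integrable[OF x contD homD]) (use m in simp)
  have m2: "- m \<le> 2" using m M_nonneg by linarith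
  obtain C where C: "C \<ge> 0" "\<And>z h. z \<noteq> 0 \<Longrightarrow> norm h \<le> norm z / 2 \<Longrightarrow>
    \<bar>\<kappa> (z + h) - \<kappa> z - ?D h z\<bar> \<le> C * (norm h)\<^sup>2 * norm z powr (- m - 2)"
    using homogeneous_taylor[OF C2 hom m2] by metis
  obtain e where e: "e > 0" "ball x (2 * e) \<subseteq> - E"
  proof -
    have "open (- E)" "x \<in> - E" using closed_E x by (auto simp: open_Compl)
    then obtain e where "e > 0" "ball x e \<subseteq> - E" using open_contains_ball by blast
    then show ?thesis using that[of "e / 2"] by simp
  qed
  define W where "W = (LINT y|\<nu>. \<bar>g y\<bar> * norm (x - y) powr (- (m + 2)))"
  have intW: "integrable \<nu> (\<lambda>y. \<bar>g y\<bar> * norm (x - y) powr (- (m + 2)))"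
    using integrable_abs[OF moments[OF x, of "m + 2"]] m by (simp add: abs_mult)
  have lin: "linear (\<lambda>v. pot (?D v) x)"
  proof (rule linearI)
    have linz: "linear (\<lambda>v. ?D v (x - y))" if "y \<in> space \<nu>" for y
      using that x space_eq by (intro has_derivative_linear[OF diff]) auto
    fix v w
    have "pot (?D (v + w)) x = (LINT y|\<nu>. g y * ?D v (x - y) + g y * ?D w (x - y))"
      unfolding pot_def by (intro Bochner_Integration.integral_cong refl)
        (simp add: linear_add[OF linz] algebra_simps)
    also have "\<dots> = pot (?D v) x + pot (?D w) x"
      unfolding pot_def by (intro Bochner_Integration.integral_add intD)
    finally show "pot (?D (v + w)) x = pot (?D v) x + pot (?D w) x" .
    fix r
    have "pot (?D (r *\<^sub>R v)) x = (LINT y|\<nu>. r * (g y * ?D v (x - y)))"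
      unfolding pot_def by (intro Bochner_Integration.integral_cong refl)
        (simp add: linear_cmul[OF linz] algebra_simps)
    then show "pot (?D (r *\<^sub>R v)) x = r *\<^sub>R pot (?D v) x" by (simp add: pot_def)
  qed
  have bound: "\<bar>pot \<kappa> (x + h) - pot \<kappa> x - pot (?D h) x\<bar> \<le> C * (norm h)\<^sup>2 * W" if h: "norm h < e" for h
  proof -
    have xh: "x + h \<notin> E" using e h by (auto simp: subset_iff dist_norm)
    let ?R = "\<lambda>y. g y * \<kappa> (x + h - y) - g y * \<kappa> (x - y) - g y * ?D h (x - y)"
    have i1: "integrable \<nu> (\<lambda>y. g y * \<kappa> (x + h - y))" and i2: "integrable \<nu> (\<lambda>y. g y * \<kappa> (x - y))"
      by (rule pot_integrable[OF _ cont hom m], fact)+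
    have eq: "pot \<kappa> (x + h) - pot \<kappa> x - pot (?D h) x
       = (LINT y|\<nu>. ?R y)"
      unfolding pot_def using i1 i2 intD by simp
    have "\<bar>pot \<kappa> (x + h) - pot \<kappa> x - pot (?D h) x\<bar>
        \<le> (LINT y|\<nu>. \<bar>?R y\<bar>)"
      unfolding eq real_norm_def[symmetric] by (rule integral_norm_bound)
    also have "\<dots> \<le> (LINT y|\<nu>. C * (norm h)\<^sup>2 * (\<bar>g y\<bar> * norm (x - y) powr (- (m + 2))))"
    proof (rule integral_mono)
      show "integrable \<nu> (\<lambda>y. \<bar>?R y\<bar>)"
        by (rule integrable_abs[OF Bochner_Integration.integrable_diff[OF
              Bochner_Integration.integrable_diff[OF i1 i2] intD]])
      show "integrable \<nu> (\<lambda>y. C * (norm h)\<^sup>2 * (\<bar>g y\<bar> * norm (x - y) powr (- (m + 2))))"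
        by (rule integrable_mult_right) (rule intW)
      fix y assume y: "y \<in> space \<nu>"
      then have ne: "x - y \<noteq> 0" using x space_eq by auto
      have "y \<notin> ball x (2 * e)" using y e(2) space_eq by auto
      then have "norm h \<le> norm (x - y) / 2" using h by (simp add: dist_norm)
      then have "\<bar>\<kappa> (x - y + h) - \<kappa> (x - y) - ?D h (x - y)\<bar> \<le> C * (norm h)\<^sup>2 * norm (x - y) powr (- (m + 2))"
        using C(2)[OF ne, of h] by simp
      then have "\<bar>g y\<bar> * \<bar>\<kappa> (x - y + h) - \<kappa> (x - y) - ?D h (x - y)\<bar>
          \<le> \<bar>g y\<bar> * (C * (norm h)\<^sup>2 * norm (x - y) powr (- (m + 2)))"
        by (rule mult_left_mono) simp
      moreover have "?R y
          = g y * (\<kappa> (x - y + h) - \<kappa> (x - y) - ?D h (x - y))"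
        by (simp add: algebra_simps)
      ultimately show "\<bar>?R y\<bar>
          \<le> C * (norm h)\<^sup>2 * (\<bar>g y\<bar> * norm (x - y) powr (- (m + 2)))"
        by (simp only: abs_mult mult_ac)
    qed
    also have "\<dots> = C * (norm h)\<^sup>2 * W" by (simp add: W_def)
    finally show ?thesis .
  qed
  show ?thesis
  proof (rule has_derivativeI_sandwich[OF e(1)])
    show "bounded_linear (\<lambda>v. pot (?D v) x)" using lin by (simp add: linear_conv_bounded_linear)
    show "((\<lambda>y. C * W * norm (y - x)) \<longlongrightarrow> 0) (at x)"
      by (auto intro!: tendsto_eq_intros)
    fix y assume y: "y \<noteq> x" "dist y x < e"
    have "\<bar>pot \<kappa> y - pot \<kappa> x - pot (?D (y - x)) x\<bar> \<le> C * (norm (y - x))\<^sup>2 * W"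
      using bound[of "y - x"] y by (simp add: dist_norm)
    then show "norm (pot \<kappa> y - pot \<kappa> x - pot (?D (y - x)) x) / norm (y - x) \<le> C * W * norm (y - x)"
      using y by (simp add: divide_le_eq power2_eq_square mult_ac)
  qed
qed

text \<open>
  The derivatives of a potential are the potentials of the derived kernels. The two surplus
  derivatives of \<open>\<kappa>\<close> are spent on the Taylor estimate.
\<close>

lemma pot_C_on:
  assumes "C_on (Suc (Suc k)) \<kappa> (- {0})" "homogeneous (- m) \<kappa>" "M \<le> m"
  shows "C_on k (pot \<kappa>) (- E)"
  using assms
proof (induction k arbitrary: \<kappa> m)
  case 0
  have "(pot \<kappa> has_derivative (\<lambda>v. pot (\<lambda>z. frechet_derivative \<kappa> (at z) v) x)) (at x)" if "x \<in> - E" for x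
    using pot_has_derivative[of x \<kappa> m] that 0 by (simp add: numeral_2_eq_2)
  then have "continuous_on (- E) (pot \<kappa>)"
    by (auto intro!: continuous_at_imp_continuous_on has_derivative_continuous)
  then show ?case by simp
next
  case (Suc k)
  note C = Suc.prems(1)
  have C2: "C_on 2 \<kappa> (- {0})"
    by (rule C_on_le[OF _ C]) simp
  have hom: "homogeneous (- (m + 1)) (\<lambda>z. frechet_derivative \<kappa> (at z) v)" for v
    using homogeneous_derivative[OF Suc.prems(2), of v] C by simp
  show ?case
  proof (rule C_on_SucI)
    show "open (- E)" using closed_E by (simp add: open_Compl)
    show "(pot \<kappa> has_derivative (\<lambda>v. pot (\<lambda>z. frechet_derivative \<kappa> (at z) v) x)) (at x)" if "x \<in> - E" for x
      using pot_has_derivative[OF _ C2 Suc.prems(2,3)] that by simp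
    show "C_on k (\<lambda>x. pot (\<lambda>z. frechet_derivative \<kappa> (at z) v) x) (- E)" for v
      using Suc.IH[OF _ hom, of v] C Suc.prems(3) by auto
  qed
qed

end

text \<open>
  The Riesz kernel \<open>norm z powr (- 2 * k)\<close>. An even integer exponent makes it a rational function,
  whose smoothness away from the origin is elementary.
\<close>

definition riesz :: "nat \<Rightarrow> 'a::real_inner \<Rightarrow> real" where
  "riesz k z = inverse (z \<bullet> z) ^ k"

lemma riesz_eq: "z \<noteq> 0 \<Longrightarrow> riesz k z = norm z powr (- real (2 * k))"
proof -
  assume "z \<noteq> 0"
  then have n: "0 < norm z" by simp
  have "norm z powr (- real (2 * k)) = inverse (norm z ^ (2 * k))"
    by (simp only: powr_minus powr_realpow[OF n])
  also have "\<dots> = riesz k z"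
    by (simp add: riesz_def power2_norm_eq_inner[symmetric] power_mult power_inverse)
  finally show ?thesis by simp
qed

lemma riesz_C_on: "C_on j (riesz k :: 'a::euclidean_space \<Rightarrow> real) (- {0})"
proof -
  have "C_on j (\<lambda>z::'a. \<Sum>b\<in>Basis. (z \<bullet> b) * (z \<bullet> b)) (- {0})"
    by (intro C_on_sum C_on_mult C_on_linear bounded_linear_inner_left) auto
  then have "C_on j (\<lambda>z::'a. z \<bullet> z) (- {0})"
    by (simp add: euclidean_inner[symmetric])
  then have "C_on j (\<lambda>z::'a. inverse (z \<bullet> z) ^ k) (- {0})"
    by (intro C_on_power C_on_inverse) auto
  then show ?thesis by (simp add: riesz_def[abs_def])
qed

lemma riesz_homogeneous: "homogeneous (- real (2 * k)) (riesz k :: 'a::real_inner \<Rightarrow> real)"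
  unfolding homogeneous_def by (simp add: riesz_eq powr_mult)

lemma riesz_derivative:
  assumes "z \<noteq> 0"
  shows "frechet_derivative (riesz k) (at z) h = - 2 * real k * (z \<bullet> h) * riesz (Suc k) z"
proof -
  have "(riesz k has_derivative (\<lambda>h. - 2 * real k * (z \<bullet> h) * riesz (Suc k) z)) (at z)"
  proof -
    have "((\<lambda>z. inverse (z \<bullet> z)) has_derivative (\<lambda>h. - 2 * (z \<bullet> h) * (inverse (z \<bullet> z))\<^sup>2)) (at z)"
      using assms by (auto intro!: derivative_eq_intros simp: inner_commute power2_eq_square)
    from has_derivative_power[OF this, of k] show ?thesis
      unfolding riesz_def[abs_def]
      by (rule has_derivative_eq_rhs) (cases k; simp add: fun_eq_iff power2_eq_square algebra_simps)
  qed
  then show ?thesis using frechet_derivative_at by metis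
qed

section \<open>Ahlfors regular measures\<close>

lemma dyadic_scale:
  assumes "1 \<le> (t::real)" shows "\<exists>j. 2 ^ j \<le> t \<and> t < 2 ^ Suc j"
proof -
  obtain N where "t < 2 ^ N" using real_arch_pow[of 2 t] by auto
  define m where "m = (LEAST N. t < 2 ^ N)"
  have m: "t < 2 ^ m" unfolding m_def by (rule LeastI) fact
  then obtain j where j: "m = Suc j" using assms by (cases m) auto
  have "\<not> t < 2 ^ j" using not_less_Least[of j "\<lambda>N. t < 2 ^ N"] j unfolding m_def by auto
  with m j show ?thesis by (intro exI[of _ j]) simp
qed

text \<open>
  The function is dominated by the sum of all \<open>w j\<close> times the indicator of \<open>B j\<close>, as soon as each
  point of its support finds one suitable \<open>j\<close>. The integral is then at most a geometric series.
\<close>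

lemma nn_integral_dyadic_le:
  fixes f :: "'b \<Rightarrow> ennreal" and w m :: "nat \<Rightarrow> real"
  assumes B: "\<And>j. B j \<in> sets M" and w: "\<And>j. 0 \<le> w j"
    and m: "\<And>j. emeasure M (B j) \<le> ennreal (m j)" and geo: "\<And>j. w j * m j \<le> K * q ^ j"
    and q: "0 \<le> q" "q < 1"
    and cover: "\<And>y. y \<in> space M \<Longrightarrow> f y \<noteq> 0 \<Longrightarrow> \<exists>j. y \<in> B j \<and> f y \<le> ennreal (w j)"
  shows "(\<integral>\<^sup>+y. f y \<partial>M) \<le> ennreal (K / (1 - q))"
proof -
  have "(\<integral>\<^sup>+y. f y \<partial>M) \<le> (\<integral>\<^sup>+y. (\<Sum>j. ennreal (w j) * indicator (B j) y) \<partial>M)"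
  proof (rule nn_integral_mono)
    fix y assume y: "y \<in> space M"
    show "f y \<le> (\<Sum>j. ennreal (w j) * indicator (B j) y)"
    proof (cases "f y = 0")
      case False
      then obtain j where j: "y \<in> B j" "f y \<le> ennreal (w j)" using cover[OF y] by blast
      have "ennreal (w j) * indicator (B j) y \<le> (\<Sum>j. ennreal (w j) * indicator (B j) y)"
        using sum_le_suminf[of "\<lambda>j. ennreal (w j) * indicator (B j) y" "{j}"] by (simp del: sum_mult_indicator)
      with j show ?thesis by simp
    qed simp
  qed
  also have "\<dots> = (\<Sum>j. ennreal (w j) * emeasure M (B j))"
    using B by (subst nn_integral_suminf) (auto simp: nn_integral_cmult_indicator)
  also have "\<dots> \<le> (\<Sum>j. ennreal (K * q ^ j))"
  proof (intro suminf_le allI)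
    fix j
    have "ennreal (w j) * emeasure M (B j) \<le> ennreal (w j) * ennreal (m j)"
      by (intro mult_left_mono m) auto
    also have "\<dots> = ennreal (w j * m j)" using w by (simp add: ennreal_mult')
    also have "\<dots> \<le> ennreal (K * q ^ j)" by (rule ennreal_leI[OF geo])
    finally show "ennreal (w j) * emeasure M (B j) \<le> ennreal (K * q ^ j)" .
  qed auto
  also have "\<dots> \<le> ennreal (K / (1 - q))"
  proof (cases "0 \<le> K")
    case True
    have "(\<lambda>j. K * q ^ j) sums (K * (1 / (1 - q)))" using q by (intro sums_mult geometric_sums) auto
    then have "(\<Sum>j. ennreal (K * q ^ j)) = ennreal (K * (1 / (1 - q)))"
      using True q by (intro suminf_ennreal_eq) auto
    then show ?thesis by simp
  next
    case False
    then have "ennreal (K * q ^ j) = 0" for j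
      using q by (intro ennreal_neg mult_nonpos_nonneg) auto
    then show ?thesis by simp
  qed
  finally show ?thesis .
qed

text \<open>
  On the dyadic annulus where the distance is about \<open>2 powr (- j) * r\<close> the integrand is a power
  \<open>\<beta> - DIM('a)\<close> and the volume a power \<open>DIM('a)\<close> of that distance, so the annuli contribute a
  geometric series with ratio \<open>2 powr (- \<beta>)\<close>.
\<close>

lemma nn_integral_ball_powr_dist:
  fixes \<beta> :: real
  assumes \<beta>: "0 < \<beta>" "\<beta> \<le> real DIM('a::euclidean_space)"
  shows "\<exists>K>0. \<forall>x::'a. \<forall>r>0. (\<integral>\<^sup>+z. ennreal (dist z x powr (\<beta> - DIM('a))) * indicator (ball x r) z \<partial>lborel)
     \<le> ennreal (K * r powr \<beta>)"
proof -
  define d where "d = real DIM('a)"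
  define q where "q = (1/2::real) powr \<beta>"
  define V where "V = unit_ball_vol (real DIM('a)) * 2 powr d * 2 powr (d - \<beta>)"
  have q: "0 \<le> q" "q < 1" using \<beta> by (auto simp: q_def powr01_less_one)
  have Vpos: "V > 0" by (simp add: V_def)
  have "(\<integral>\<^sup>+z. ennreal (dist z x powr (\<beta> - d)) * indicator (ball x r) z \<partial>lborel)
      \<le> ennreal ((V * r powr \<beta>) / (1 - q))" if r: "r > 0" for x :: 'a and r
  proof (rule nn_integral_dyadic_le[where B = "\<lambda>j. ball x (2 * r * (1/2)^j)"
        and w = "\<lambda>j. (r * (1/2) ^ Suc j) powr (\<beta> - d)"
        and m = "\<lambda>j. unit_ball_vol (real DIM('a)) * (2 * r * (1/2) ^ j) ^ DIM('a)"])
    show "emeasure lborel (ball x (2 * r * (1 / 2) ^ j))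
        \<le> ennreal (unit_ball_vol (real DIM('a)) * (2 * r * (1/2) ^ j) ^ DIM('a))" for j
      using r by (simp add: emeasure_ball)
    show "(r * (1/2) ^ Suc j) powr (\<beta> - d) * (unit_ball_vol (real DIM('a)) * (2 * r * (1/2) ^ j) ^ DIM('a))
        \<le> (V * r powr \<beta>) * q ^ j" for j
    proof -
      define h where "h = (1/2::real) ^ j"
      have h: "h > 0" by (simp add: h_def)
      have 1: "(2 * r * h) ^ DIM('a) = 2 powr d * r powr d * h powr d"
        using r h by (simp add: d_def powr_realpow power_mult_distrib)
      have 2: "(r * (h / 2)) powr (\<beta> - d) = r powr (\<beta> - d) * h powr (\<beta> - d) * 2 powr (d - \<beta>)"
        using r h powr_minus_divide[of 2 "\<beta> - d"] by (simp add: powr_mult powr_divide)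
      have 3: "q ^ j = h powr \<beta>"
        unfolding q_def h_def by (simp add: powr_powr powr_realpow[symmetric] mult.commute)
      have 4: "r powr \<beta> = r powr (\<beta> - d) * r powr d" "h powr \<beta> = h powr (\<beta> - d) * h powr d"
        by (simp_all add: powr_add[symmetric])
      have "(1/2::real) ^ Suc j = h / 2" by (simp add: h_def)
      then show ?thesis
        unfolding h_def[symmetric] 1 3 V_def 4 using 2 by simp
    qed
    fix z assume "ennreal (dist z x powr (\<beta> - d)) * indicator (ball x r) z \<noteq> 0"
    then have z: "z \<noteq> x" "dist z x < r" by (auto simp: indicator_def dist_commute split: if_splits)
    then have "1 \<le> r / dist z x" by (simp add: le_divide_eq)
    then obtain j where j: "2 ^ j \<le> r / dist z x" "r / dist z x < 2 ^ Suc j"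
      using dyadic_scale by blast
    have lo: "r * (1/2) ^ Suc j \<le> dist z x" and hi: "dist z x \<le> r * (1/2) ^ j"
      using j z by (auto simp: field_simps power_one_over)
    have "r * (1/2)^j > 0" using r by simp
    then have "z \<in> ball x (2 * r * (1/2)^j)" using hi by (simp add: dist_commute)
    moreover have "dist z x powr (\<beta> - d) \<le> (r * (1/2) ^ Suc j) powr (\<beta> - d)"
      using lo r \<beta> by (intro powr_mono2') (auto simp: d_def)
    ultimately show "\<exists>j. z \<in> ball x (2 * r * (1/2)^j) \<and>
       ennreal (dist z x powr (\<beta> - d)) * indicator (ball x r) z \<le> ennreal ((r * (1/2) ^ Suc j) powr (\<beta> - d))"
      by (intro exI[of _ j]) (auto simp: indicator_def ennreal_leI)
  qed (use q in auto)
  then show ?thesis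
    using Vpos q by (intro exI[of _ "V / (1 - q)"]) (auto simp: d_def)
qed

text \<open>
  Two-sided regularity with a lower bound that is allowed to fail once \<open>r\<close> is at least the diameter
  of \<open>E\<close>, as it must for bounded \<open>E\<close>. This form covers bounded and unbounded sets alike, as well
  as a single point carrying the zero measure. The \<sigma>-algebra of \<open>\<nu>\<close> may be larger than the Borel
  one; \<open>id_measurable\<close> says that it contains the traces of all Borel sets.
\<close>

locale ahlfors_measure =
  fixes E :: "'a::euclidean_space set" and s A a :: real and \<nu> :: "'a measure"
  assumes closed: "closed E" and nonempty: "E \<noteq> {}"
    and space_nu: "space \<nu> = E" and id_measurable: "(\<lambda>x. x) \<in> borel_measurable \<nu>"
    and s_pos: "0 < s" and A_pos: "0 < A" and a_pos: "0 < a"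
    and upper: "\<And>x r. x \<in> E \<Longrightarrow> 0 < r \<Longrightarrow> emeasure \<nu> (E \<inter> ball x r) \<le> ennreal (A * r powr s)"
    and lower: "\<And>x r. x \<in> E \<Longrightarrow> 0 < r \<Longrightarrow>
      ennreal (a * r powr s) \<le> emeasure \<nu> (E \<inter> ball x r) \<or> (\<forall>y\<in>E. \<forall>z\<in>E. dist y z \<le> r)"
begin

lemma borel_Int_sets: "S \<in> sets borel \<Longrightarrow> E \<inter> S \<in> sets \<nu>"
  using measurable_sets[OF id_measurable, of S] by (simp add: space_nu Int_commute vimage_def)

lemma ball_sets [measurable, simp]: "E \<inter> ball x r \<in> sets \<nu>"
  by (rule borel_Int_sets) simp

lemma borel_measurable_nu: "f \<in> borel_measurable borel \<Longrightarrow> f \<in> borel_measurable \<nu>"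
  using measurable_compose[OF id_measurable] by auto

lemma emeasure_ball_finite: "x \<in> E \<Longrightarrow> emeasure \<nu> (E \<inter> ball x r) < top"
proof (cases "r > 0")
  case True
  assume "x \<in> E"
  then show ?thesis using upper[OF _ True] by (meson ennreal_less_top le_less_trans)
next
  case False
  then show ?thesis by (simp add: ball_empty)
qed

lemma sigma_finite_nu: "sigma_finite_measure \<nu>"
proof
  obtain x0 where x0: "x0 \<in> E" using nonempty by blast
  define F where "F = range (\<lambda>n. E \<inter> ball x0 (real n))"
  have "\<Union>F = space \<nu>"
  proof -
    have "\<exists>n::nat. y \<in> ball x0 (real n)" for y
      using reals_Archimedean2[of "dist x0 y"] by auto
    then show ?thesis by (auto simp: F_def space_nu)
  qed
  then show "\<exists>F. countable F \<and> F \<subseteq> sets \<nu> \<and> \<Union> F = space \<nu> \<and> (\<forall>a\<in>F. emeasure \<nu> a \<noteq> \<infinity>)"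
    using emeasure_ball_finite[OF x0]
    by (intro exI[of _ F]) (auto simp: F_def less_top)
qed

sublocale nu: sigma_finite_measure \<nu> by (rule sigma_finite_nu)

lemma nearest_point:
  assumes "x \<notin> E"
  obtains x' where "x' \<in> E" "dist x x' = infdist x E" "0 < infdist x E"
    "\<And>y. y \<in> E \<Longrightarrow> infdist x E \<le> dist x y"
proof -
  obtain x' where x': "x' \<in> E" "infdist x E = dist x x'"
    using infdist_attains_inf[OF closed nonempty] by blast
  have "0 < infdist x E" using infdist_pos_not_in_closed[OF closed nonempty assms] .
  then show ?thesis using x' by (intro that[of x'] infdist_le) auto
qed

text \<open>
  The dyadic annuli around \<open>x\<close> start at the distance of \<open>x\<close> to \<open>E\<close> and, seen from the nearest
  point of \<open>E\<close>, are covered by balls of comparable radius. The series converges because \<open>s < p\<close>.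
\<close>

lemma nn_integral_kernel_le:
  assumes p: "s < p"
  shows "\<exists>K>0. \<forall>x. x \<notin> E \<longrightarrow>
    (\<integral>\<^sup>+y. ennreal (dist x y powr (- p)) \<partial>\<nu>) \<le> ennreal (K * infdist x E powr (s - p))"
proof -
  define q where "q = 2 powr (s - p)"
  have q: "0 \<le> q" "q < 1" using p powr_less_cancel_iff[of 2 "s - p" 0] by (auto simp: q_def)
  have "(\<integral>\<^sup>+y. ennreal (dist x y powr (- p)) \<partial>\<nu>) \<le> ennreal ((A * 4 powr s * infdist x E powr (s - p)) / (1 - q))"
    if x: "x \<notin> E" for x
  proof -
    define D where "D = infdist x E"
    obtain x' where x': "x' \<in> E" "dist x x' = D" "0 < D" "\<And>y. y \<in> E \<Longrightarrow> D \<le> dist x y"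
      using nearest_point[OF x] unfolding D_def by blast
    show ?thesis unfolding D_def[symmetric]
    proof (rule nn_integral_dyadic_le[where B = "\<lambda>j. E \<inter> ball x' (4 * (D * 2 ^ j))"
          and w = "\<lambda>j. (D * 2 ^ j) powr (- p)" and m = "\<lambda>j. A * (4 * (D * 2 ^ j)) powr s"])
      show "emeasure \<nu> (E \<inter> ball x' (4 * (D * 2 ^ j))) \<le> ennreal (A * (4 * (D * 2 ^ j)) powr s)" for j
        by (rule upper) (use x' in auto)
      show "(D * 2 ^ j) powr - p * (A * (4 * (D * 2 ^ j)) powr s) \<le> A * 4 powr s * D powr (s - p) * q ^ j" for j
      proof -
        have 1: "q ^ j = (2 ^ j) powr (s - p)"
          unfolding q_def by (simp add: powr_powr powr_realpow[symmetric] mult.commute)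
        have 2: "u powr - p * u powr s = u powr (s - p)" for u :: real
          by (simp add: powr_add[symmetric])
        have "(D * 2 ^ j) powr - p * (A * (4 * (D * 2 ^ j)) powr s)
           = A * 4 powr s * ((D * 2 ^ j) powr - p * (D * 2 ^ j) powr s)"
          using x' by (simp add: powr_mult)
        also have "\<dots> = A * 4 powr s * D powr (s - p) * q ^ j"
          unfolding 1 2 using x' by (simp add: powr_mult)
        finally show ?thesis by (rule eq_refl)
      qed
      fix y assume y: "y \<in> space \<nu>"
      then have "1 \<le> dist x y / D" using x' by (simp add: space_nu)
      then obtain j where j: "2 ^ j \<le> dist x y / D" "dist x y / D < 2 ^ Suc j"
        using dyadic_scale by blast
      have lo: "D * 2 ^ j \<le> dist x y" and hi: "dist x y < 2 * (D * 2 ^ j)"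
        using j x'(3) by (auto simp: field_simps)
      have "dist x' y \<le> D + dist x y" using x'(2) dist_triangle2[of x' y x] dist_commute[of x x']
        by (simp add: dist_commute)
      also have "D \<le> D * 2 ^ j" using x'(3) by simp
      finally have "y \<in> E \<inter> ball x' (4 * (D * 2 ^ j))" using y hi lo x'(3)  by (simp add: space_nu)
      moreover have "dist x y powr (-p) \<le> (D * 2 ^ j) powr (- p)"
        using lo x'(3) p s_pos by (intro powr_mono2') auto
      ultimately show "\<exists>j. y \<in> E \<inter> ball x' (4 * (D * 2 ^ j)) \<and>
          ennreal (dist x y powr - p) \<le> ennreal ((D * 2 ^ j) powr - p)"
        by (auto intro: ennreal_leI)
    qed (use q in auto)
  qed
  then show ?thesis
    using A_pos q by (intro exI[of _ "A * 4 powr s / (1 - q)"]) (auto simp: )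
qed

lemma kernel_measurable [measurable]: "(\<lambda>y. ennreal (dist x y powr p)) \<in> borel_measurable \<nu>"
  by (rule borel_measurable_nu) measurable

lemma nn_integral_ball_ge:
  assumes "\<And>w. w \<in> E \<Longrightarrow> w \<in> ball y r \<Longrightarrow> c \<le> h w"
  shows "ennreal c * emeasure \<nu> (E \<inter> ball y r) \<le> (\<integral>\<^sup>+w\<in>ball y r. ennreal (h w) \<partial>\<nu>)"
proof -
  have "ennreal c * emeasure \<nu> (E \<inter> ball y r) = (\<integral>\<^sup>+w. ennreal c * indicator (E \<inter> ball y r) w \<partial>\<nu>)"
    by (simp add: nn_integral_cmult_indicator)
  also have "\<dots> \<le> (\<integral>\<^sup>+w\<in>ball y r. ennreal (h w) \<partial>\<nu>)"
    using assms by (intro nn_integral_mono) (auto simp: indicator_def space_nu intro: ennreal_leI)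
  finally show ?thesis .
qed

text \<open>
  The ball around the nearest point \<open>x'\<close> with radius \<open>infdist x E\<close> lies within twice that distance of
  \<open>x\<close>, and its measure is at least \<open>a * infdist x E powr s\<close>.
\<close>

lemma nn_integral_kernel_ge:
  assumes x: "x \<notin> E" and x': "x' \<in> E" "dist x x' = infdist x E"
    and a: "ennreal (a * infdist x E powr s) \<le> emeasure \<nu> (E \<inter> ball x' (infdist x E))"
    and p: "0 \<le> p"
  shows "ennreal (a * 2 powr (- p) * infdist x E powr (s - p))
     \<le> (\<integral>\<^sup>+y\<in>ball x' (infdist x E). ennreal (dist x y powr (- p)) \<partial>\<nu>)"
proof -
  define D where "D = infdist x E"
  have D: "0 < D" unfolding D_def using infdist_pos_not_in_closed[OF closed nonempty x] .
  have "ennreal (a * 2 powr (- p) * D powr (s - p)) = ennreal ((2 * D) powr (-p)) * ennreal (a * D powr s)"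
    using D a_pos by (simp add: ennreal_mult[symmetric] powr_mult powr_diff powr_minus field_simps)
  also have "\<dots> \<le> ennreal ((2 * D) powr (-p)) * emeasure \<nu> (E \<inter> ball x' D)"
    using a by (intro mult_left_mono) (auto simp: D_def)
  also have "\<dots> \<le> (\<integral>\<^sup>+y\<in>ball x' D. ennreal (dist x y powr (- p)) \<partial>\<nu>)"
  proof (rule nn_integral_ball_ge)
    fix y assume y: "y \<in> E" "y \<in> ball x' D"
    have "0 < dist x y" "dist x y \<le> 2 * D"
      using y x dist_triangle[of x y x'] x' by (auto simp: D_def)
    then show "(2 * D) powr (-p) \<le> dist x y powr (-p)" using p by (intro powr_mono2') auto
  qed
  finally show ?thesis by (simp add: D_def)
qed

text \<open>
  Normalised to a probability measure, the kernel \<open>dist x y powr (- p)\<close> lives at the scale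
  \<open>infdist x E\<close>, as far as moments of order \<open>\<beta>\<close> are concerned. If the lower bound holds at that scale,
  both integrals are comparable to powers of it; otherwise all of \<open>E\<close> is within twice that
  distance of \<open>x\<close>.
\<close>

lemma nn_integral_kernel_ratio:
  assumes p: "s + \<beta> < p" and \<beta>: "0 < \<beta>"
  shows "\<exists>K>0. \<forall>x. x \<notin> E \<longrightarrow> (\<integral>\<^sup>+y. ennreal (dist x y powr (\<beta> - p)) \<partial>\<nu>)
     \<le> ennreal (K * infdist x E powr \<beta>) * (\<integral>\<^sup>+y. ennreal (dist x y powr (- p)) \<partial>\<nu>)"
proof -
  obtain K1 where K1: "K1 > 0" "\<And>x. x \<notin> E \<Longrightarrow>
     (\<integral>\<^sup>+y. ennreal (dist x y powr (- (p - \<beta>))) \<partial>\<nu>) \<le> ennreal (K1 * infdist x E powr (s - (p - \<beta>)))"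
    using nn_integral_kernel_le[of "p - \<beta>"] p by auto
  define K where "K = max (2 powr \<beta>) (K1 * 2 powr p / a)"
  have Kpos: "K > 0" by (simp add: K_def less_max_iff_disj)
  show ?thesis
  proof (intro exI[of _ K] conjI allI impI Kpos)
    fix x assume x: "x \<notin> E"
    define D where "D = infdist x E"
    obtain x' where x': "x' \<in> E" "dist x x' = D" "0 < D" "\<And>y. y \<in> E \<Longrightarrow> D \<le> dist x y"
      using nearest_point[OF x] unfolding D_def by blast
    let ?u = "\<integral>\<^sup>+y. ennreal (dist x y powr (- p)) \<partial>\<nu>"
    consider "ennreal (a * D powr s) \<le> emeasure \<nu> (E \<inter> ball x' D)" | "\<forall>y\<in>E. \<forall>z\<in>E. dist y z \<le> D"
      using lower[OF x'(1,3)] by blast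
    then show "(\<integral>\<^sup>+y. ennreal (dist x y powr (\<beta> - p)) \<partial>\<nu>) \<le> ennreal (K * infdist x E powr \<beta>) * ?u"
    proof cases
      case 1
      have "ennreal (a * 2 powr (- p) * D powr (s - p)) \<le>
          (\<integral>\<^sup>+y\<in>ball x' D. ennreal (dist x y powr (- p)) \<partial>\<nu>)"
        unfolding D_def by (rule nn_integral_kernel_ge) (use x x' 1 p s_pos \<beta> in \<open>auto simp: D_def\<close>)
      also have "\<dots> \<le> ?u" by (intro nn_integral_mono) (auto simp: indicator_def)
      finally have u: "ennreal (a * 2 powr (- p) * D powr (s - p)) \<le> ?u" .
      have "(\<integral>\<^sup>+y. ennreal (dist x y powr (\<beta> - p)) \<partial>\<nu>) \<le> ennreal (K1 * D powr (s - (p - \<beta>)))"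
        using K1(2)[OF x] by (simp add: D_def)
      also have "K1 * D powr (s - (p - \<beta>)) = (K1 * 2 powr p / a * D powr \<beta>) * (a * 2 powr (- p) * D powr (s - p))"
        using a_pos x'(3) by (simp add: powr_minus powr_diff powr_add field_simps)
      also have "\<dots> \<le> (K * D powr \<beta>) * (a * 2 powr (- p) * D powr (s - p))"
        using a_pos by (intro mult_right_mono) (auto simp: K_def)
      also have "ennreal \<dots> = ennreal (K * D powr \<beta>) * ennreal (a * 2 powr (- p) * D powr (s - p))"
        using Kpos a_pos by (intro ennreal_mult) auto
      also have "\<dots> \<le> ennreal (K * D powr \<beta>) * ?u" by (intro mult_left_mono u) auto
      finally show ?thesis by (simp add: D_def ennreal_leI)
    next
      case 2
      have "(\<integral>\<^sup>+y. ennreal (dist x y powr (\<beta> - p)) \<partial>\<nu>)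
         \<le> (\<integral>\<^sup>+y. ennreal (K * D powr \<beta>) * ennreal (dist x y powr (- p)) \<partial>\<nu>)"
      proof (rule nn_integral_mono)
        fix y assume "y \<in> space \<nu>"
        then have y: "y \<in> E" by (simp add: space_nu)
        have "dist x y \<le> 2 * D" using dist_triangle[of x y x'] 2 y x' by fastforce
        then have "dist x y powr \<beta> \<le> (2 * D) powr \<beta>" using \<beta> by (intro powr_mono2) auto
        also have "\<dots> = 2 powr \<beta> * D powr \<beta>" using x' by (simp add: powr_mult)
        also have "\<dots> \<le> K * D powr \<beta>" by (intro mult_right_mono) (auto simp: K_def)
        finally have "dist x y powr \<beta> * dist x y powr (-p) \<le> K * D powr \<beta> * dist x y powr (-p)"
          by (intro mult_right_mono) auto
        then show "ennreal (dist x y powr (\<beta> - p)) \<le> ennreal (K * D powr \<beta>) * ennreal (dist x y powr (- p))"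
          using Kpos by (simp add: ennreal_mult[symmetric] powr_add[symmetric] ennreal_leI)
      qed
      also have "\<dots> = ennreal (K * D powr \<beta>) * ?u" by (rule nn_integral_cmult) measurable
      finally show ?thesis by (simp add: D_def)
    qed
  qed
qed

lemma nn_integral_kernel_pos:
  assumes x: "x \<notin> E" and p: "0 \<le> p" and two: "y \<in> E" "z \<in> E" "y \<noteq> z"
  shows "0 < (\<integral>\<^sup>+y. ennreal (dist x y powr (- p)) \<partial>\<nu>)"
proof -
  define r where "r = dist y z / 2"
  have r: "r > 0" using two by (simp add: r_def)
  have "\<not> dist y z \<le> r" using r by (simp add: r_def)
  then have l: "ennreal (a * r powr s) \<le> emeasure \<nu> (E \<inter> ball y r)" using lower[OF two(1) r] two by blast
  have "0 < a * r powr s" using a_pos r by simp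
  then have pos: "0 < emeasure \<nu> (E \<inter> ball y r)"
    using l by (metis ennreal_less_zero_iff less_le_trans)
  define R where "R = dist x y + r"
  have R: "R > 0" using r by (simp add: R_def add_nonneg_pos)
  have "0 < ennreal (R powr (-p)) * emeasure \<nu> (E \<inter> ball y r)"
    using pos R by (simp add: ennreal_zero_less_mult_iff)
  also have "\<dots> \<le> (\<integral>\<^sup>+w\<in>ball y r. ennreal (dist x w powr (- p)) \<partial>\<nu>)"
  proof (rule nn_integral_ball_ge)
    fix w assume w: "w \<in> E" "w \<in> ball y r"
    have "0 < dist x w" "dist x w \<le> R"
      using w x dist_triangle[of x w y] by (auto simp: R_def)
    then show "R powr (-p) \<le> dist x w powr (-p)" using p by (intro powr_mono2') auto
  qed
  also have "\<dots> \<le> (\<integral>\<^sup>+y. ennreal (dist x y powr (- p)) \<partial>\<nu>)"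
    by (intro nn_integral_mono) (auto simp: indicator_def)
  finally show ?thesis .
qed

end

context ahlfors_measure begin

text \<open>
  Tonelli's theorem for functions of the distance. The other measure \<open>M\<close> is Lebesgue measure or \<open>\<nu>\<close>
  itself.
\<close>

lemma nn_integral_dist_swap:
  fixes h w :: "'a \<Rightarrow> ennreal" and q :: "real \<Rightarrow> ennreal"
  assumes M: "sigma_finite_measure M" "(\<lambda>x. x) \<in> borel_measurable M"
    and h: "h \<in> borel_measurable M" and q: "q \<in> borel_measurable borel" and w: "w \<in> borel_measurable \<nu>"
  shows "(\<integral>\<^sup>+x. h x * (\<integral>\<^sup>+y. q (dist x y) * w y \<partial>\<nu>) \<partial>M) = (\<integral>\<^sup>+y. w y * (\<integral>\<^sup>+x. q (dist x y) * h x \<partial>M) \<partial>\<nu>)" (is ?swap)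
    and "(\<lambda>x. \<integral>\<^sup>+y. q (dist x y) * w y \<partial>\<nu>) \<in> borel_measurable M" (is ?meas)
proof -
  interpret M: sigma_finite_measure M by (rule M)
  interpret P: pair_sigma_finite M \<nu> ..
  have coord: "fst \<in> borel_measurable (M \<Otimes>\<^sub>M \<nu>)" "snd \<in> borel_measurable (M \<Otimes>\<^sub>M \<nu>)"
    using measurable_compose[OF measurable_fst[of M \<nu>] M(2)]
      measurable_compose[OF measurable_snd[of M \<nu>] id_measurable] by simp_all
  have qw: "(\<lambda>p. q (dist (fst p) (snd p)) * w (snd p)) \<in> borel_measurable (M \<Otimes>\<^sub>M \<nu>)"
    by (intro borel_measurable_times_ennreal measurable_compose[OF borel_measurable_dist[OF coord] q]
        measurable_compose[OF measurable_snd w])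
  have hqw: "(\<lambda>p. h (fst p) * (q (dist (fst p) (snd p)) * w (snd p))) \<in> borel_measurable (M \<Otimes>\<^sub>M \<nu>)"
    by (intro borel_measurable_times_ennreal[OF _ qw] measurable_compose[OF measurable_fst h])
  show ?meas using nu.borel_measurable_nn_integral_fst[OF qw] by simp
  have qy: "(\<lambda>y. q (dist x y) * w y) \<in> borel_measurable \<nu>" for x
    by (intro borel_measurable_times_ennreal w
        measurable_compose[OF borel_measurable_dist[OF borel_measurable_const id_measurable] q])
  have qx: "(\<lambda>x. q (dist x y) * h x) \<in> borel_measurable M" for y
    by (intro borel_measurable_times_ennreal h
        measurable_compose[OF borel_measurable_dist[OF M(2) borel_measurable_const] q])
  have "(\<integral>\<^sup>+x. h x * (\<integral>\<^sup>+y. q (dist x y) * w y \<partial>\<nu>) \<partial>M)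
      = (\<integral>\<^sup>+x. (\<integral>\<^sup>+y. h x * (q (dist x y) * w y) \<partial>\<nu>) \<partial>M)"
    by (simp only: nn_integral_cmult[OF qy])
  also have "\<dots> = (\<integral>\<^sup>+y. (\<integral>\<^sup>+x. h x * (q (dist x y) * w y) \<partial>M) \<partial>\<nu>)"
    using P.Fubini[OF hqw] by simp
  also have "\<dots> = (\<integral>\<^sup>+y. (\<integral>\<^sup>+x. w y * (q (dist x y) * h x) \<partial>M) \<partial>\<nu>)"
    by (simp only: mult_ac)
  also have "\<dots> = (\<integral>\<^sup>+y. w y * (\<integral>\<^sup>+x. q (dist x y) * h x \<partial>M) \<partial>\<nu>)"
    by (simp only: nn_integral_cmult[OF qx])
  finally show ?swap .
qed

lemma nn_integral_emeasure_ball: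
  assumes M: "sigma_finite_measure M" "(\<lambda>x. x) \<in> borel_measurable M" and h: "h \<in> borel_measurable M"
  shows "(\<integral>\<^sup>+x. h x * emeasure \<nu> (E \<inter> ball x r) \<partial>M) = (\<integral>\<^sup>+y. (\<integral>\<^sup>+x. h x * indicator (ball y r) x \<partial>M) \<partial>\<nu>)"
proof -
  have "emeasure \<nu> (E \<inter> ball x r) = (\<integral>\<^sup>+y. indicator {..<r} (dist x y) * 1 \<partial>\<nu>)" for x
  proof -
    have "emeasure \<nu> (E \<inter> ball x r) = (\<integral>\<^sup>+y. indicator (E \<inter> ball x r) y \<partial>\<nu>)" by simp
    also have "\<dots> = (\<integral>\<^sup>+y. indicator {..<r} (dist x y) * 1 \<partial>\<nu>)"
      by (rule nn_integral_cong) (auto simp: indicator_def space_nu)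
    finally show ?thesis .
  qed
  moreover have "1 * (\<integral>\<^sup>+x. indicator {..<r} (dist x y) * h x \<partial>M) = (\<integral>\<^sup>+x. h x * indicator (ball y r) x \<partial>M)" for y
    unfolding mult_1 by (rule nn_integral_cong) (auto simp: indicator_def dist_commute)
  ultimately show ?thesis
    using nn_integral_dist_swap(1)[OF M h, of "indicator {..<r}" "\<lambda>_. 1"] by simp
qed

text \<open>
  Inside a ball contained in \<open>E\<close>, every ball of small radius \<open>t\<close> has measure at least \<open>a * t powr s\<close>.
  By Tonelli, the integral of these measures over the centres is at most a multiple of the volume
  \<open>t powr DIM('a)\<close>, which is smaller than \<open>t powr s\<close> as \<open>t\<close> tends to \<open>0\<close>.
\<close>

lemma empty_interior:
  assumes sd: "s < DIM('a)"
  shows "interior E = {}"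
proof (rule ccontr)
  assume "interior E \<noteq> {}"
  then obtain x0 where "x0 \<in> interior E" by blast
  then obtain \<rho> where \<rho>: "\<rho> > 0" "ball x0 \<rho> \<subseteq> E" by (auto simp: mem_interior)
  define d where "d = real DIM('a)"
  define V where "V = unit_ball_vol (real DIM('a))"
  have V: "V > 0" by (simp add: V_def)
  have x0: "x0 \<in> E" using \<rho> by auto
  have main: "a * (\<rho>/2) powr d \<le> A * \<rho> powr s * t powr (d - s)" if t: "0 < t" "t < \<rho> / 2" for t
  proof -
    obtain b :: 'a where b: "b \<in> Basis" using nonempty_Basis by blast
    define y0 where "y0 = x0 + (\<rho> / 2) *\<^sub>R b"
    have dxy: "dist x0 y0 = \<rho> / 2" using \<rho> b by (simp add: y0_def dist_norm)
    then have y0: "y0 \<in> E" using \<rho> by (intro subsetD[OF \<rho>(2)]) auto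
    have "\<not> dist x0 y0 \<le> t" using dxy t by simp
    then have far: "\<not> (\<forall>y\<in>E. \<forall>z\<in>E. dist y z \<le> t)" using x0 y0 by blast
    have "ennreal (a * t powr s * (V * (\<rho>/2) ^ DIM('a)))
       = ennreal (a * t powr s) * emeasure lborel (ball x0 (\<rho>/2))"
      using a_pos V \<rho> by (simp add: emeasure_ball V_def ennreal_mult[symmetric])
    also have "\<dots> = (\<integral>\<^sup>+x. ennreal (a * t powr s) * indicator (ball x0 (\<rho>/2)) x \<partial>lborel)"
      by (simp add: nn_integral_cmult_indicator)
    also have "\<dots> \<le> (\<integral>\<^sup>+x. indicator (ball x0 (\<rho>/2)) x * emeasure \<nu> (E \<inter> ball x t) \<partial>lborel)"
    proof (rule nn_integral_mono)
      fix x
      have "ennreal (a * t powr s) \<le> emeasure \<nu> (E \<inter> ball x t)" if x: "x \<in> ball x0 (\<rho>/2)"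
      proof -
        have "x \<in> E" using x \<rho> by (intro subsetD[OF \<rho>(2)]) auto
        then show ?thesis using lower[OF _ t(1)] far by blast
      qed
      then show "ennreal (a * t powr s) * indicator (ball x0 (\<rho>/2)) x
          \<le> indicator (ball x0 (\<rho>/2)) x * emeasure \<nu> (E \<inter> ball x t)"
        by (auto simp: indicator_def)
    qed
    also have "\<dots> = (\<integral>\<^sup>+y. (\<integral>\<^sup>+x. indicator (ball x0 (\<rho>/2)) x * indicator (ball y t) x \<partial>lborel) \<partial>\<nu>)"
      by (intro nn_integral_emeasure_ball lborel.sigma_finite_measure_axioms borel_measurable_indicator) auto
    also have "\<dots> \<le> (\<integral>\<^sup>+y. ennreal (V * t ^ DIM('a)) * indicator (E \<inter> ball x0 \<rho>) y \<partial>\<nu>)"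
    proof (rule nn_integral_mono)
      fix y assume y: "y \<in> space \<nu>"
      have "indicator (ball x0 (\<rho>/2)) x * indicator (ball y t) x
          \<le> indicator (ball y t) x * (indicator (E \<inter> ball x0 \<rho>) y :: ennreal)" for x
        using dist_triangle[of x0 y x] t y by (auto simp: indicator_def space_nu dist_commute)
      then have "(\<integral>\<^sup>+x. indicator (ball x0 (\<rho>/2)) x * indicator (ball y t) x \<partial>lborel)
          \<le> (\<integral>\<^sup>+x. indicator (ball y t) x * indicator (E \<inter> ball x0 \<rho>) y \<partial>lborel)"
        by (rule nn_integral_mono)
      also have "\<dots> = ennreal (V * t ^ DIM('a)) * indicator (E \<inter> ball x0 \<rho>) y"
        using t by (subst nn_integral_multc) (auto simp: emeasure_ball V_def intro!: borel_measurable_indicator)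
      finally show "(\<integral>\<^sup>+x. indicator (ball x0 (\<rho>/2)) x * indicator (ball y t) x \<partial>lborel)
          \<le> ennreal (V * t ^ DIM('a)) * indicator (E \<inter> ball x0 \<rho>) y" .
    qed
    also have "\<dots> = ennreal (V * t ^ DIM('a)) * emeasure \<nu> (E \<inter> ball x0 \<rho>)"
      by (simp add: nn_integral_cmult_indicator)
    also have "\<dots> \<le> ennreal (V * t ^ DIM('a)) * ennreal (A * \<rho> powr s)"
      by (intro mult_left_mono upper x0 \<rho>) auto
    also have "\<dots> = ennreal (V * t ^ DIM('a) * (A * \<rho> powr s))"
      using V t A_pos by (intro ennreal_mult[symmetric]) auto
    finally have est: "a * t powr s * (V * (\<rho>/2) ^ DIM('a)) \<le> V * t ^ DIM('a) * (A * \<rho> powr s)"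
      using V t A_pos by (subst (asm) ennreal_le_iff) auto
    have e1: "(\<rho>/2) ^ DIM('a) = (\<rho>/2) powr d" using \<rho> by (simp add: powr_realpow d_def)
    have e2: "t ^ DIM('a) = t powr s * t powr (d - s)"
      using t by (simp add: powr_realpow[symmetric] d_def powr_add[symmetric])
    have "V * t powr s * (a * (\<rho>/2) powr d) \<le> V * t powr s * (A * \<rho> powr s * t powr (d - s))"
      using est unfolding e1 e2 by (simp only: mult_ac)
    moreover have "V * t powr s > 0" using V t by simp
    ultimately show ?thesis by (simp only: mult_le_cancel_left_pos)
  qed
  have "((\<lambda>t. A * \<rho> powr s * t powr (d - s)) \<longlongrightarrow> A * \<rho> powr s * 0) (at_right 0)"
    using sd by (intro tendsto_mult tendsto_const tendsto_zero_powrI[where b="d - s"])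
      (auto simp: d_def eventually_at_filter)
  moreover have "eventually (\<lambda>t. a * (\<rho>/2) powr d \<le> A * \<rho> powr s * t powr (d - s)) (at_right 0)"
    using \<rho> main by (intro eventually_at_rightI[of 0 "\<rho>/2"]) auto
  ultimately have "a * (\<rho>/2) powr d \<le> A * \<rho> powr s * 0"
    by (rule tendsto_lowerbound) simp
  moreover have "a * (\<rho>/2) powr d > 0" using a_pos \<rho> by simp
  ultimately show False by simp
qed

text \<open>
  The estimate behind the Carleson condition. Where the lower bound holds at the scale
  \<open>D = infdist x E\<close>, the factor \<open>D powr s\<close> is at most a multiple of the measure of a ball near \<open>x\<close>, so
  the integrand is dominated by the integral of \<open>dist x y powr (\<beta> - DIM('a))\<close> over \<open>y\<close> in the part of
  \<open>E\<close> within \<open>3 * r\<close> of \<open>\<xi>\<close>; by Tonelli only radial integrals in \<open>x\<close> remain. Elsewhere \<open>E\<close> has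
  diameter at most \<open>D\<close>, hence \<open>dist x \<xi> \<le> 2 * D\<close>, and the same radial integral around \<open>\<xi>\<close> suffices.
\<close>

lemma nn_integral_infdist_powr:
  assumes \<beta>: "0 < \<beta>" "\<beta> < 1"
  shows "\<exists>K>0. \<forall>\<xi>\<in>E. \<forall>r>0. (\<integral>\<^sup>+x\<in>ball \<xi> r - E. ennreal (infdist x E powr (\<beta> + s - DIM('a))) \<partial>lborel)
     \<le> ennreal (K * r powr (s + \<beta>))"
proof -
  define d where "d = real DIM('a)"
  have d: "1 \<le> d" unfolding d_def using DIM_positive[where 'a='a] by linarith
  obtain K0 where K0: "K0 > 0" "\<And>x::'a. \<And>r. r > 0 \<Longrightarrow>
     (\<integral>\<^sup>+z. ennreal (dist z x powr (\<beta> - d)) * indicator (ball x r) z \<partial>lborel) \<le> ennreal (K0 * r powr \<beta>)"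
    using nn_integral_ball_powr_dist[where 'a='a, of \<beta>] \<beta> d unfolding d_def by auto
  define c where "c = 2 powr (d - \<beta>)"
  define K where "K = c / a * (K0 * 4 powr \<beta> * (A * 3 powr s)) + c * K0"
  have c: "c > 0" by (simp add: c_def)
  have K: "K > 0" using c a_pos K0 A_pos by (auto simp: K_def intro!: add_pos_pos)
  show ?thesis
  proof (intro exI[of _ K] conjI K ballI allI impI)
    fix \<xi> r assume \<xi>: "\<xi> \<in> E" and r: "(r::real) > 0"
    \<comment> \<open>\<open>3 * r\<close>: the nearest point \<open>x'\<close> is within \<open>2 * r\<close> of \<open>\<xi>\<close>, and the ball around it has radius below \<open>r\<close>\<close>
    let ?h = "indicator (ball \<xi> r) :: 'a \<Rightarrow> ennreal" and ?w = "indicator (ball \<xi> (3 * r)) :: 'a \<Rightarrow> ennreal"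
    let ?q = "\<lambda>\<tau>::real. ennreal (\<tau> powr (\<beta> - d))"
    define I where "I x = (\<integral>\<^sup>+y. ?q (dist x y) * ?w y \<partial>\<nu>)" for x
    have w: "?w \<in> borel_measurable \<nu>" by (intro borel_measurable_nu borel_measurable_indicator) simp
    have h: "?h \<in> borel_measurable lborel" by (rule borel_measurable_indicator) simp
    have q: "?q \<in> borel_measurable borel" by measurable
    have id: "(\<lambda>x::'a. x) \<in> borel_measurable lborel" by simp
    note swap = nn_integral_dist_swap[OF lborel.sigma_finite_measure_axioms id h q w, folded I_def]
    have pointwise: "ennreal (infdist x E powr (\<beta> + s - d)) * indicator (ball \<xi> r - E) x
       \<le> ennreal (c / a) * (?h x * I x) +
         ennreal (c * r powr s) * (ennreal (dist x \<xi> powr (\<beta> - d)) * indicator (ball \<xi> r) x)" for x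
    proof (cases "x \<in> ball \<xi> r - E")
      case True
      then have xE: "x \<notin> E" and xr: "dist x \<xi> < r" by (auto simp: dist_commute)
      define D where "D = infdist x E"
      obtain x' where x': "x' \<in> E" "dist x x' = D" "0 < D" "\<And>y. y \<in> E \<Longrightarrow> D \<le> dist x y"
        using nearest_point[OF xE] unfolding D_def by blast
      have Dr: "D < r" using x'(4)[OF \<xi>] xr by simp
      consider "ennreal (a * D powr s) \<le> emeasure \<nu> (E \<inter> ball x' D)" | "\<forall>y\<in>E. \<forall>z\<in>E. dist y z \<le> D"
        using lower[OF x'(1,3)] by blast
      then have "ennreal (D powr (\<beta> + s - d))
       \<le> ennreal (c / a) * I x +
         ennreal (c * r powr s) * ennreal (dist x \<xi> powr (\<beta> - d))"
      proof cases
        case 1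
        have "ennreal (a * 2 powr (- (d - \<beta>)) * D powr (s - (d - \<beta>)))
           \<le> (\<integral>\<^sup>+y\<in>ball x' D. ennreal (dist x y powr (- (d - \<beta>))) \<partial>\<nu>)"
          unfolding D_def by (rule nn_integral_kernel_ge) (use xE x' 1 \<beta> d in \<open>auto simp: D_def\<close>)
        also have "\<dots> \<le> I x"
          unfolding I_def
        proof (rule nn_integral_mono)
          fix y
          have "y \<in> ball \<xi> (3 * r)" if "y \<in> ball x' D"
            using that Dr xr x'(2) dist_triangle[of \<xi> y x'] dist_triangle[of \<xi> x' x] by (simp add: dist_commute)
          then show "ennreal (dist x y powr (- (d - \<beta>))) * indicator (ball x' D) y \<le> ?q (dist x y) * ?w y"
            by (auto simp: indicator_def)
        qed
        finally have "ennreal (c / a) * ennreal (a * 2 powr (- (d - \<beta>)) * D powr (s - (d - \<beta>)))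
            \<le> ennreal (c / a) * I x" by (intro mult_left_mono) auto
        moreover have "c / a * (a * 2 powr (- (d - \<beta>)) * D powr (s - (d - \<beta>))) = D powr (\<beta> + s - d)"
        proof -
          have "c * 2 powr (- (d - \<beta>)) = 1" by (simp add: c_def powr_add[symmetric])
          moreover have "s - (d - \<beta>) = \<beta> + s - d" by simp
          ultimately show ?thesis using a_pos by (simp add: algebra_simps)
        qed
        ultimately have "ennreal (D powr (\<beta> + s - d)) \<le> ennreal (c / a) * I x"
          using c a_pos by (simp add: ennreal_mult[symmetric])
        then show ?thesis by (rule add_increasing2[rotated]) simp
      next
        case 2
        have "dist x \<xi> \<le> D + dist x' \<xi>" using dist_triangle[of x \<xi> x'] x'(2) by simp
        also have "dist x' \<xi> \<le> D" using 2 x' \<xi> by blast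
        finally have le: "dist x \<xi> / 2 \<le> D" by simp
        have pos: "0 < dist x \<xi>" using xE \<xi> by auto
        have "D powr (\<beta> + s - d) = D powr s * D powr (\<beta> - d)" by (simp add: powr_add[symmetric] algebra_simps)
        also have "\<dots> \<le> r powr s * (dist x \<xi> / 2) powr (\<beta> - d)"
        proof (intro mult_mono)
          show "D powr s \<le> r powr s" using Dr x'(3) s_pos by (intro powr_mono2) linarith+
          show "D powr (\<beta> - d) \<le> (dist x \<xi> / 2) powr (\<beta> - d)"
            using \<beta> d le pos by (intro powr_mono2') linarith+
        qed auto
        also have "\<dots> = (c * r powr s) * dist x \<xi> powr (\<beta> - d)"
          using powr_minus_divide[of 2 "\<beta> - d"] by (simp add: powr_divide c_def)
        finally have "ennreal (D powr (\<beta> + s - d)) \<le> ennreal (c * r powr s) * ennreal (dist x \<xi> powr (\<beta> - d))"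
          using c by (simp add: ennreal_mult[symmetric] ennreal_leI)
        then show ?thesis by (rule add_increasing[rotated]) simp
      qed
      then show ?thesis using True by (simp add: D_def)
    qed simp
    have inner: "?w y * (\<integral>\<^sup>+x. ?q (dist x y) * ?h x \<partial>lborel) \<le> ennreal (K0 * (4 * r) powr \<beta>) * indicator (E \<inter> ball \<xi> (3 * r)) y"
      if y: "y \<in> E" for y
    proof (cases "y \<in> ball \<xi> (3 * r)")
      case True
      have "(\<integral>\<^sup>+x. ?q (dist x y) * ?h x \<partial>lborel) \<le> (\<integral>\<^sup>+x. ?q (dist x y) * indicator (ball y (4 * r)) x \<partial>lborel)"
      proof (rule nn_integral_mono)
        fix x show "?q (dist x y) * ?h x \<le> ?q (dist x y) * indicator (ball y (4 * r)) x"
          using dist_triangle[of y x \<xi>] True by (auto simp: indicator_def dist_commute)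
      qed
      also have "\<dots> \<le> ennreal (K0 * (4 * r) powr \<beta>)" by (rule K0) (use r in auto)
      finally show ?thesis using True y by simp
    qed simp
    have "(\<integral>\<^sup>+x. ?h x * I x \<partial>lborel) = (\<integral>\<^sup>+y. ?w y * (\<integral>\<^sup>+x. ?q (dist x y) * ?h x \<partial>lborel) \<partial>\<nu>)"
      by (rule swap(1))
    also have "\<dots> \<le> (\<integral>\<^sup>+y. ennreal (K0 * (4 * r) powr \<beta>) * indicator (E \<inter> ball \<xi> (3 * r)) y \<partial>\<nu>)"
      by (intro nn_integral_mono inner) (simp add: space_nu)
    also have "\<dots> = ennreal (K0 * (4 * r) powr \<beta>) * emeasure \<nu> (E \<inter> ball \<xi> (3 * r))"
      by (simp add: nn_integral_cmult_indicator)
    also have "\<dots> \<le> ennreal (K0 * (4 * r) powr \<beta>) * ennreal (A * (3 * r) powr s)"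
      by (intro mult_left_mono upper \<xi>) (use r in auto)
    also have "\<dots> = ennreal (K0 * (4 * r) powr \<beta> * (A * (3 * r) powr s))"
      using K0 by (intro ennreal_mult'[symmetric]) auto
    also have "K0 * (4 * r) powr \<beta> * (A * (3 * r) powr s) = (K0 * 4 powr \<beta> * (A * 3 powr s)) * r powr (s + \<beta>)"
      using r by (simp add: powr_mult powr_add)
    finally have I1: "(\<integral>\<^sup>+x. ?h x * I x \<partial>lborel) \<le> ennreal ((K0 * 4 powr \<beta> * (A * 3 powr s)) * r powr (s + \<beta>))" .
    have "(\<integral>\<^sup>+x\<in>ball \<xi> r - E. ennreal (infdist x E powr (\<beta> + s - d)) \<partial>lborel)
      \<le> (\<integral>\<^sup>+x. (ennreal (c / a) * (?h x * I x) +
         ennreal (c * r powr s) * (ennreal (dist x \<xi> powr (\<beta> - d)) * indicator (ball \<xi> r) x)) \<partial>lborel)"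
      by (intro nn_integral_mono pointwise)
    also have "\<dots> = ennreal (c / a) * (\<integral>\<^sup>+x. ?h x * I x \<partial>lborel) +
        ennreal (c * r powr s) * (\<integral>\<^sup>+x. ennreal (dist x \<xi> powr (\<beta> - d)) * indicator (ball \<xi> r) x \<partial>lborel)"
    proof -
      have m1: "(\<lambda>x. ennreal (dist x \<xi> powr (\<beta> - d)) * indicator (ball \<xi> r) x) \<in> borel_measurable lborel"
      proof (intro borel_measurable_times_ennreal borel_measurable_indicator)
        show "(\<lambda>x. ennreal (dist x \<xi> powr (\<beta> - d))) \<in> borel_measurable lborel" by measurable
      qed simp
      have m2: "(\<lambda>x. ?h x * I x) \<in> borel_measurable lborel"
        by (rule borel_measurable_times_ennreal[OF h swap(2)])
      show ?thesis
        by (simp only: nn_integral_add nn_integral_cmult m1 m2 borel_measurable_times_ennreal borel_measurable_const)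
    qed
    also have "\<dots> \<le> ennreal (c / a) * ennreal ((K0 * 4 powr \<beta> * (A * 3 powr s)) * r powr (s + \<beta>)) +
        ennreal (c * r powr s) * ennreal (K0 * r powr \<beta>)"
      by (intro add_mono mult_left_mono I1 K0 r) auto
    also have "\<dots> = ennreal (c / a * ((K0 * 4 powr \<beta> * (A * 3 powr s)) * r powr (s + \<beta>)) + c * r powr s * (K0 * r powr \<beta>))"
    proof -
      have "0 \<le> c / a" "0 \<le> c * r powr s" using c a_pos by auto
      moreover have "0 \<le> (K0 * 4 powr \<beta> * (A * 3 powr s)) * r powr (s + \<beta>)" "0 \<le> K0 * r powr \<beta>"
        using K0(1) A_pos by auto
      ultimately show ?thesis by (simp only: ennreal_mult[symmetric] ennreal_plus[symmetric] mult_nonneg_nonneg)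
    qed
    also have "c / a * ((K0 * 4 powr \<beta> * (A * 3 powr s)) * r powr (s + \<beta>)) + c * r powr s * (K0 * r powr \<beta>)
        = K * r powr (s + \<beta>)"
      by (simp add: K_def algebra_simps powr_add)
    finally show "(\<integral>\<^sup>+x\<in>ball \<xi> r - E. ennreal (infdist x E powr (\<beta> + s - DIM('a))) \<partial>lborel) \<le> ennreal (K * r powr (s + \<beta>))"
      by (simp add: d_def)
  qed
qed

end

section \<open>Integrals and averages\<close>

lemma abs_integral_le:
  fixes f w :: "'b \<Rightarrow> real"
  assumes "integrable M f" "integrable M w" "\<And>y. y \<in> space M \<Longrightarrow> \<bar>f y\<bar> \<le> w y"
  shows "\<bar>LINT y|M. f y\<bar> \<le> (LINT y|M. w y)"
proof -
  have "\<bar>LINT y|M. f y\<bar> \<le> (LINT y|M. \<bar>f y\<bar>)"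
    unfolding real_norm_def[symmetric] by (rule integral_norm_bound)
  also have "\<dots> \<le> (LINT y|M. w y)"
    by (rule integral_mono[OF integrable_abs[OF assms(1)] assms(2)]) (use assms(3) in auto)
  finally show ?thesis .
qed

lemma holder_imp_continuous_on:
  fixes F :: "'a::metric_space \<Rightarrow> real"
  assumes \<beta>: "0 < \<beta>" and H: "\<And>x y. x \<in> S \<Longrightarrow> y \<in> S \<Longrightarrow> \<bar>F x - F y\<bar> \<le> H * dist x y powr \<beta>"
  shows "continuous_on S F"
  unfolding continuous_on_def
proof
  fix x assume x: "x \<in> S"
  have "((\<lambda>y. H * dist y x powr \<beta>) \<longlongrightarrow> H * 0) (at x within S)"
    using \<beta> by (intro tendsto_mult tendsto_const tendsto_zero_powrI[where b = \<beta>]) (auto intro!: tendsto_eq_intros)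
  then have "((\<lambda>y. F y - F x) \<longlongrightarrow> 0) (at x within S)"
    by (intro Lim_null_comparison[of "\<lambda>y. F y - F x" "\<lambda>y. H * dist y x powr \<beta>"])
      (use H[OF _ x] in \<open>auto simp: eventually_at_filter\<close>)
  then show "(F \<longlongrightarrow> F x) (at x within S)" using LIM_zero_iff by blast
qed

lemma Lip_iff_holder:
  fixes F :: "'a::metric_space \<Rightarrow> real"
  assumes \<beta>: "0 < \<beta>"
  shows "F \<in> Lip \<beta> S \<longleftrightarrow> (\<exists>H. \<forall>x\<in>S. \<forall>y\<in>S. \<bar>F x - F y\<bar> \<le> H * dist x y powr \<beta>)"
proof
  let ?N = "SUP x\<in>S. SUP y\<in>S - {x}. ennreal (\<bar>F x - F y\<bar> / dist x y powr \<beta>)"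
  assume "F \<in> Lip \<beta> S"
  then have fin: "?N < top" by (simp add: Lip_def)
  have "\<bar>F x - F y\<bar> \<le> enn2real ?N * dist x y powr \<beta>" if "x \<in> S" "y \<in> S" for x y
  proof (cases "x = y")
    case False
    have "ennreal (\<bar>F x - F y\<bar> / dist x y powr \<beta>) \<le> ?N"
      using that False by (intro SUP_upper2[of x] SUP_upper2[of y]) auto
    also have "?N = ennreal (enn2real ?N)" using fin by simp
    finally have "\<bar>F x - F y\<bar> / dist x y powr \<beta> \<le> enn2real ?N" by (simp add: ennreal_le_iff)
    then show ?thesis using False by (simp add: divide_le_eq)
  qed simp
  then show "\<exists>H. \<forall>x\<in>S. \<forall>y\<in>S. \<bar>F x - F y\<bar> \<le> H * dist x y powr \<beta>" by blast
next
  assume "\<exists>H. \<forall>x\<in>S. \<forall>y\<in>S. \<bar>F x - F y\<bar> \<le> H * dist x y powr \<beta>"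
  then obtain H where H: "\<And>x y. x \<in> S \<Longrightarrow> y \<in> S \<Longrightarrow> \<bar>F x - F y\<bar> \<le> H * dist x y powr \<beta>" by blast
  have "(SUP x\<in>S. SUP y\<in>S - {x}. ennreal (\<bar>F x - F y\<bar> / dist x y powr \<beta>)) \<le> ennreal H"
    by (intro SUP_least ennreal_leI) (use H in \<open>auto simp: divide_le_eq\<close>)
  then show "F \<in> Lip \<beta> S" by (auto simp: Lip_def intro: le_less_trans)
qed

lemma emeasure_finite_of_measure_pos: "0 < measure M B \<Longrightarrow> emeasure M B < \<infinity>"
  by (metis enn2real_top less_irrefl less_top infinity_ennreal_def measure_def)

lemma mean_diff_le:
  assumes B: "B \<in> sets M" and fin: "0 < measure M B" and int: "set_integrable M B f"
  shows "\<bar>mean M B f - c\<bar> \<le> mean M B (\<lambda>y. \<bar>f y - c\<bar>)"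
proof -
  note finB = emeasure_finite_of_measure_pos[OF fin]
  have c: "set_integrable M B (\<lambda>y. c)" using B finB by (simp add: set_integrable_def integrable_indicator)
  have "mean M B f - c = (LINT y:B|M. f y - c) / measure M B"
    using fin B finB by (simp add: mean_def set_integral_diff(2)[OF int c] set_integral_const diff_divide_distrib)
  also have "\<bar>\<dots>\<bar> = \<bar>LINT y:B|M. f y - c\<bar> / measure M B" using fin by simp
  also have "\<dots> \<le> (LINT y:B|M. \<bar>f y - c\<bar>) / measure M B"
    using fin set_integral_norm_bound[OF set_integral_diff(1)[OF int c]]
    by (intro divide_right_mono) auto
  finally show ?thesis by (simp add: mean_def)
qed

lemma mean_subset_le:
  assumes B: "B' \<in> sets M" "B' \<subseteq> B" and pos: "0 < measure M B'" "0 < measure M B"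
    and int: "set_integrable M B h" and nn: "\<And>y. 0 \<le> h y"
  shows "mean M B' h \<le> measure M B / measure M B' * mean M B h"
proof -
  have int': "set_integrable M B' h" by (rule set_integrable_subset[OF int B])
  have "(LINT y:B'|M. h y) \<le> (LINT y:B|M. h y)"
    unfolding set_lebesgue_integral_def
    using int int' nn B by (intro integral_mono) (auto simp: set_integrable_def indicator_def)
  then show ?thesis using pos by (simp add: mean_def divide_right_mono)
qed

text \<open>
  If \<open>h\<close> is not integrable, its mean is \<open>0\<close> by convention; this case is covered by \<open>0 \<le> K\<close>.
\<close>

lemma mean_le_const:
  assumes B: "B \<in> sets M" and fin: "0 < measure M B" and le: "\<And>y. y \<in> B \<Longrightarrow> h y \<le> K" and nn: "0 \<le> K"
  shows "mean M B h \<le> K"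
proof -
  note finB = emeasure_finite_of_measure_pos[OF fin]
  have c: "set_integrable M B (\<lambda>y. K)" using B finB by (simp add: set_integrable_def integrable_indicator)
  have "(LINT y:B|M. h y) \<le> (LINT y:B|M. K)"
  proof (cases "set_integrable M B h")
    case True
    then show ?thesis using c le unfolding set_lebesgue_integral_def set_integrable_def
      by (intro integral_mono) (auto simp: indicator_def)
  next
    case False
    then have "(LINT y:B|M. h y) = 0"
      unfolding set_lebesgue_integral_def set_integrable_def by (rule not_integrable_integral_eq)
    then show ?thesis using nn B finB by (simp add: set_integral_const)
  qed
  also have "\<dots> = measure M B * K" using B finB by (simp add: set_integral_const)
  finally show ?thesis using fin by (simp add: mean_def divide_le_eq mult.commute)
qed

section \<open>Hoelder representatives of Campanato functions\<close>

text \<open>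
  \<open>N\<close> bounds the Campanato seminorm of \<open>f\<close>. The radii are those strictly below twice the diameter of
  \<open>E\<close>, whether or not the diameter is finite or attained.
\<close>

locale campanato_function = ahlfors_measure E s A a \<nu>
  for E :: "'a::euclidean_space set" and s A a :: real and \<nu> :: "'a measure" +
  fixes f :: "'a \<Rightarrow> real" and \<beta> N :: real
  assumes beta: "0 < \<beta>" "\<beta> < 1" and N_nonneg: "0 \<le> N"
    and two_points: "\<exists>y\<in>E. \<exists>z\<in>E. y \<noteq> z"
    and f_measurable: "f \<in> borel_measurable \<nu>"
    and f_integrable: "\<And>x r. x \<in> E \<Longrightarrow> set_integrable \<nu> (E \<inter> ball x r) f"
    and oscillation: "\<And>x r. x \<in> E \<Longrightarrow> 0 < r \<Longrightarrow> (\<exists>y\<in>E. \<exists>z\<in>E. r < 2 * dist y z) \<Longrightarrow>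
      mean \<nu> (E \<inter> ball x r) (\<lambda>y. \<bar>f y - mean \<nu> (E \<inter> ball x r) f\<bar>) \<le> N * r powr \<beta>"
begin

definition admissible :: "real \<Rightarrow> bool" where
  "admissible r \<longleftrightarrow> 0 < r \<and> (\<exists>y\<in>E. \<exists>z\<in>E. r < 2 * dist y z)"

definition avg :: "'a \<Rightarrow> real \<Rightarrow> real" where
  "avg x r = mean \<nu> (E \<inter> ball x r) f"

text \<open>
  \<open>K_step\<close> compares averages over nested balls of comparable size, \<open>K_scales\<close> averages over
  concentric balls of arbitrary sizes, and \<open>K_holder\<close> is the resulting Hoelder constant. None of them
  involves \<open>f\<close> or \<open>N\<close>.
\<close>

definition "K_step = A * 6 powr s / a"
definition "K_scales = K_step / (1 - (1/2) powr \<beta>)"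
definition "K_holder = K_scales + 2 * (K_step + K_scales)"

lemma K_pos: "0 < K_step" "0 < K_scales" "0 < K_holder"
proof -
  show k0: "0 < K_step" using A_pos a_pos by (simp add: K_step_def)
  have "(1/2::real) powr \<beta> < 1" using beta by (simp add: powr01_less_one)
  then show k1: "0 < K_scales" using k0 by (simp add: K_scales_def)
  show "0 < K_holder" using k0 k1 by (simp add: K_holder_def)
qed

lemma admissible_le: "admissible r \<Longrightarrow> 0 < t \<Longrightarrow> t \<le> r \<Longrightarrow> admissible t"
  unfolding admissible_def by (meson le_less_trans)

text \<open>
  An admissible radius may exceed the diameter of \<open>E\<close>, where the lower bound can fail. Half of
  it is below the diameter.
\<close>

lemma measure_ball_bounds:
  assumes x: "x \<in> E" and r: "admissible r"
  shows "a * (r / 2) powr s \<le> measure \<nu> (E \<inter> ball x r)" "measure \<nu> (E \<inter> ball x r) \<le> A * r powr s"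
    "0 < measure \<nu> (E \<inter> ball x r)"
proof -
  have r0: "0 < r" using r by (simp add: admissible_def)
  have "\<not> (\<forall>y\<in>E. \<forall>z\<in>E. dist y z \<le> r / 2)" using r unfolding admissible_def by fastforce
  then have "ennreal (a * (r / 2) powr s) \<le> emeasure \<nu> (E \<inter> ball x (r / 2))" using lower[OF x, of "r / 2"] r0 by auto
  also have "\<dots> \<le> emeasure \<nu> (E \<inter> ball x r)" using r0 by (intro emeasure_mono) auto
  also have "\<dots> = ennreal (measure \<nu> (E \<inter> ball x r))"
    using emeasure_ball_finite[OF x] by (simp add: emeasure_eq_ennreal_measure less_top)
  finally show lo: "a * (r / 2) powr s \<le> measure \<nu> (E \<inter> ball x r)" by (simp add: ennreal_le_iff)
  have "0 < a * (r / 2) powr s" using a_pos r0 by simp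
  with lo show "0 < measure \<nu> (E \<inter> ball x r)" by linarith
  show "measure \<nu> (E \<inter> ball x r) \<le> A * r powr s"
    using upper[OF x r0] A_pos emeasure_ball_finite[OF x, of r]
    by (simp add: emeasure_eq_ennreal_measure less_top ennreal_le_iff)
qed

lemma set_integrable_abs_diff:
  assumes x: "x \<in> E" shows "set_integrable \<nu> (E \<inter> ball x r) (\<lambda>y. \<bar>f y - c\<bar>)"
proof (rule set_integrable_abs, rule set_integral_diff(1))
  show "set_integrable \<nu> (E \<inter> ball x r) f" by (rule f_integrable[OF x])
  show "set_integrable \<nu> (E \<inter> ball x r) (\<lambda>y. c)"
    using emeasure_ball_finite[OF x, of r] by (simp add: set_integrable_def integrable_indicator)
qed

text \<open>
  The difference of the averages is at most the mean oscillation on the larger ball times the ratio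
  of the measures, which is at most \<open>(A / a) * (2 * r / t) powr s\<close>.
\<close>

lemma avg_step:
  assumes x: "x \<in> E" "y \<in> E" and sub: "ball x t \<subseteq> ball y r" and t: "0 < t" "t \<le> r" "r \<le> 3 * t" and r: "admissible r"
  shows "\<bar>avg x t - avg y r\<bar> \<le> K_step * N * r powr \<beta>"
proof -
  have at: "admissible t" by (rule admissible_le[OF r t(1,2)])
  note mt = measure_ball_bounds[OF x(1) at] and mr = measure_ball_bounds[OF x(2) r]
  have "\<bar>avg x t - avg y r\<bar> \<le> mean \<nu> (E \<inter> ball x t) (\<lambda>z. \<bar>f z - avg y r\<bar>)"
    unfolding avg_def[of x] by (rule mean_diff_le[OF ball_sets mt(3) f_integrable[OF x(1)]])
  also have "\<dots> \<le> measure \<nu> (E \<inter> ball y r) / measure \<nu> (E \<inter> ball x t) * mean \<nu> (E \<inter> ball y r) (\<lambda>z. \<bar>f z - avg y r\<bar>)"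
    by (rule mean_subset_le[OF ball_sets _ mt(3) mr(3) set_integrable_abs_diff[OF x(2)]]) (use sub in auto)
  also have "\<dots> \<le> K_step * (N * r powr \<beta>)"
  proof (intro mult_mono)
    have "(r / t) powr s \<le> 3 powr s" using t s_pos by (intro powr_mono2) (auto simp: divide_le_eq)
    then have le: "r powr s \<le> 3 powr s * t powr s" using t by (simp add: powr_divide divide_le_eq)
    have "measure \<nu> (E \<inter> ball y r) / measure \<nu> (E \<inter> ball x t) \<le> (A * r powr s) / (a * (t / 2) powr s)"
      using mt mr a_pos t by (intro frac_le) auto
    also have "\<dots> \<le> (A * (3 powr s * t powr s)) / (a * (t / 2) powr s)"
      using le a_pos A_pos by (intro divide_right_mono mult_left_mono) auto
    also have "\<dots> = K_step"
    proof -
      have "(6::real) powr s = 3 powr s * 2 powr s" by (simp add: powr_mult[symmetric])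
      then show ?thesis using t a_pos by (simp add: K_step_def powr_divide)
    qed
    finally show "measure \<nu> (E \<inter> ball y r) / measure \<nu> (E \<inter> ball x t) \<le> K_step" .
    show "mean \<nu> (E \<inter> ball y r) (\<lambda>z. \<bar>f z - avg y r\<bar>) \<le> N * r powr \<beta>"
      using oscillation[OF x(2), of r] r unfolding avg_def admissible_def by blast
    show "0 \<le> mean \<nu> (E \<inter> ball y r) (\<lambda>z. \<bar>f z - avg y r\<bar>)"
      unfolding mean_def set_lebesgue_integral_def by (intro divide_nonneg_nonneg integral_nonneg) auto
  qed (use K_pos in auto)
  finally show ?thesis by (simp add: mult.assoc)
qed

text \<open>
  Halving the radius until \<open>t\<close> is reached gives a geometric series; its sum \<open>K_scales\<close> is the fixed
  point of the recursion \<open>K \<mapsto> K * q + K_step\<close>.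
\<close>

lemma avg_scales:
  assumes x: "x \<in> E" and t: "0 < t" "t \<le> r" and r: "admissible r"
  shows "\<bar>avg x t - avg x r\<bar> \<le> K_scales * N * r powr \<beta>"
proof -
  define q where "q = (1/2::real) powr \<beta>"
  have q: "q < 1" using beta by (simp add: powr01_less_one q_def)
  have K01: "K_step \<le> K_scales" "K_scales * q + K_step = K_scales"
  proof -
    have "1 - q \<noteq> 0" using q by simp
    then have 1: "K_scales * (1 - q) = K_step" by (simp add: K_scales_def q_def[symmetric])
    then show "K_scales * q + K_step = K_scales" by (simp add: algebra_simps)
    moreover have "0 \<le> K_scales * q" using K_pos by (simp add: q_def)
    ultimately show "K_step \<le> K_scales" by linarith
  qed
  have ind: "t \<le> r \<Longrightarrow> r \<le> 2 ^ j * t \<Longrightarrow> admissible r \<Longrightarrow> \<bar>avg x t - avg x r\<bar> \<le> K_scales * N * r powr \<beta>" for j r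
  proof (induction j arbitrary: r)
    case 0
    then have "r = t" by simp
    then show ?case using K_pos N_nonneg by simp
  next
    case (Suc j)
    show ?case
    proof (cases "r \<le> 2 * t")
      case True
      have "\<bar>avg x t - avg x r\<bar> \<le> K_step * N * r powr \<beta>"
        by (rule avg_step[OF x x]) (use True Suc.prems t in auto)
      also have "\<dots> \<le> K_scales * N * r powr \<beta>" using K01 N_nonneg by (intro mult_right_mono) auto
      finally show ?thesis .
    next
      case False
      have r0: "0 < r" using t Suc.prems by simp
      have "\<bar>avg x t - avg x (r / 2)\<bar> \<le> K_scales * N * (r / 2) powr \<beta>"
        by (rule Suc.IH) (use False Suc.prems r0 admissible_le[OF Suc.prems(3), of "r / 2"] in auto)
      moreover have "\<bar>avg x (r / 2) - avg x r\<bar> \<le> K_step * N * r powr \<beta>"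
        by (rule avg_step[OF x x]) (use Suc.prems r0 in auto)
      ultimately have "\<bar>avg x t - avg x r\<bar> \<le> K_scales * N * (r / 2) powr \<beta> + K_step * N * r powr \<beta>" by linarith
      also have "(r / 2) powr \<beta> = q * r powr \<beta>" using r0 by (simp add: powr_divide q_def)
      also have "K_scales * N * (q * r powr \<beta>) + K_step * N * r powr \<beta> = (K_scales * q + K_step) * N * r powr \<beta>"
        by (simp add: algebra_simps)
      finally show ?thesis using K01 by simp
    qed
  qed
  obtain j where "r / t < 2 ^ j" using real_arch_pow[of 2 "r / t"] by auto
  then have "r \<le> 2 ^ j * t" using t by (simp add: divide_less_eq)
  then show ?thesis using ind t r by blast
qed

lemma ex_admissible: "\<exists>\<rho>. admissible \<rho>"
proof -
  obtain y z where "y \<in> E" "z \<in> E" "y \<noteq> z" using two_points by blast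
  moreover from this have "dist y z < 2 * dist y z" by simp
  ultimately have "admissible (dist y z)" unfolding admissible_def by (metis zero_less_dist_iff)
  then show ?thesis by blast
qed

lemma avg_limit:
  assumes x: "x \<in> E"
  shows "\<exists>l. \<forall>r. admissible r \<longrightarrow> \<bar>avg x r - l\<bar> \<le> K_scales * N * r powr \<beta>"
proof -
  obtain \<rho> where \<rho>: "admissible \<rho>" using ex_admissible by blast
  have \<rho>0: "\<rho> > 0" using \<rho> by (simp add: admissible_def)
  define t where "t j = \<rho> * (1/2) ^ j" for j :: nat
  have t0: "0 < t j" for j using \<rho>0 by (simp add: t_def)
  have t_le: "t j \<le> t i" if "i \<le> j" for i j
    using that \<rho>0 by (simp add: t_def power_decreasing)
  have t_adm: "admissible (t j)" for j by (rule admissible_le[OF \<rho> t0]) (use t_le[of 0 j] in \<open>simp add: t_def\<close>)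
  have t_lim: "t \<longlonglongrightarrow> 0" unfolding t_def by (intro tendsto_eq_intros LIMSEQ_realpow_zero) auto
  have small: "(\<lambda>j. K_scales * N * t j powr \<beta>) \<longlonglongrightarrow> 0"
    using t_lim t0 beta by (auto intro!: tendsto_eq_intros tendsto_zero_powrI[where b = \<beta>] less_imp_le always_eventually)
  have "Cauchy (\<lambda>j. avg x (t j))"
    unfolding Cauchy_altdef2
  proof (intro allI impI)
    fix e :: real assume e: "e > 0"
    obtain j where "K_scales * N * t j powr \<beta> < e"
      using order_tendstoD(2)[OF small e] unfolding eventually_sequentially by auto
    moreover have "\<bar>avg x (t i) - avg x (t j)\<bar> \<le> K_scales * N * t j powr \<beta>" if "i \<ge> j" for i
      by (rule avg_scales[OF x t0 t_le[OF that] t_adm])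
    ultimately show "\<exists>j. \<forall>i\<ge>j. dist (avg x (t i)) (avg x (t j)) < e"
      by (intro exI[of _ j]) (force simp: dist_real_def)
  qed
  then obtain l where l: "(\<lambda>j. avg x (t j)) \<longlonglongrightarrow> l" using Cauchy_convergent convergent_def by blast
  have "\<bar>avg x r - l\<bar> \<le> K_scales * N * r powr \<beta>" if r: "admissible r" for r
  proof (rule tendsto_upperbound)
    show "(\<lambda>j. \<bar>avg x r - avg x (t j)\<bar>) \<longlonglongrightarrow> \<bar>avg x r - l\<bar>" by (intro tendsto_intros l)
    have "eventually (\<lambda>j. t j < r) sequentially"
      using order_tendstoD(2)[OF t_lim] r by (simp add: admissible_def)
    then show "eventually (\<lambda>j. \<bar>avg x r - avg x (t j)\<bar> \<le> K_scales * N * r powr \<beta>) sequentially"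
      by eventually_elim (use avg_scales[OF x t0 _ r] in \<open>simp add: abs_minus_commute\<close>)
  qed simp
  then show ?thesis by blast
qed

text \<open>
  The limit of the averages as the radius tends to \<open>0\<close>, described by the rate of convergence so that
  no sequence of radii has to be chosen.
\<close>

definition rep :: "'a \<Rightarrow> real" where
  "rep x = (SOME l. \<forall>r. admissible r \<longrightarrow> \<bar>avg x r - l\<bar> \<le> K_scales * N * r powr \<beta>)"

lemma rep_avg: "x \<in> E \<Longrightarrow> admissible r \<Longrightarrow> \<bar>avg x r - rep x\<bar> \<le> K_scales * N * r powr \<beta>"
  using someI_ex[OF avg_limit[of x]] unfolding rep_def by blast

text \<open>
  The radii \<open>d / 2\<close> and \<open>3 / 2 * d\<close> are chosen because \<open>2 * d\<close> itself is not admissible when \<open>d\<close> is the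
  diameter of \<open>E\<close>.
\<close>

lemma rep_holder:
  assumes x: "x \<in> E" "y \<in> E"
  shows "\<bar>rep x - rep y\<bar> \<le> K_holder * N * dist x y powr \<beta>"
proof (cases "x = y")
  case False
  define d where "d = dist x y"
  have d: "d > 0" using False by (simp add: d_def)
  have admissible: "admissible (3 / 2 * d)" unfolding admissible_def using x d
    by (intro conjI bexI[of _ x] bexI[of _ y]) (auto simp: d_def)
  have admissible': "admissible (d / 2)" by (rule admissible_le[OF admissible]) (use d in auto)
  have sub: "ball x (d / 2) \<subseteq> ball y (3 / 2 * d)"
  proof
    fix z assume "z \<in> ball x (d / 2)"
    then show "z \<in> ball y (3 / 2 * d)" using dist_triangle[of y z x] by (simp add: d_def dist_commute)
  qed
  have "\<bar>avg x (d / 2) - avg y (3 / 2 * d)\<bar> \<le> K_step * N * (3 / 2 * d) powr \<beta>"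
    by (rule avg_step[OF x sub _ _ _ admissible]) (use d in auto)
  moreover note rep_avg[OF x(1) admissible'] rep_avg[OF x(2) admissible]
  ultimately have "\<bar>rep x - rep y\<bar> \<le> K_scales * N * (d / 2) powr \<beta> + K_step * N * (3 / 2 * d) powr \<beta> + K_scales * N * (3 / 2 * d) powr \<beta>"
    by linarith
  also have "\<dots> = K_scales * N * (d / 2) powr \<beta> + (K_step + K_scales) * N * (3 / 2 * d) powr \<beta>" by (simp add: algebra_simps)
  also have "\<dots> \<le> K_scales * N * d powr \<beta> + (K_step + K_scales) * N * (2 * d powr \<beta>)"
  proof (intro add_mono mult_left_mono)
    show "(d / 2) powr \<beta> \<le> d powr \<beta>" using d beta by (intro powr_mono2) auto
    show "(3 / 2 * d) powr \<beta> \<le> 2 * d powr \<beta>" using d beta by (intro powr_mult_le) auto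
  qed (use K_pos N_nonneg in auto)
  also have "\<dots> = K_holder * N * d powr \<beta>" by (simp add: K_holder_def algebra_simps)
  finally show ?thesis by (simp add: d_def)
qed simp

lemma continuous_on_rep: "continuous_on E rep"
  by (rule holder_imp_continuous_on[OF beta(1) rep_holder])

lemma continuous_on_measurable: "continuous_on E h \<Longrightarrow> h \<in> borel_measurable \<nu>" for h :: "'a \<Rightarrow> real"
proof -
  assume h: "continuous_on E h"
  have "(\<lambda>x. x) \<in> measurable \<nu> (restrict_space borel E)"
    by (rule measurable_restrict_space2[OF _ id_measurable]) (simp add: space_nu)
  from measurable_compose[OF this borel_measurable_continuous_on_restrict[OF h]] show ?thesis by simp
qed

lemma rep_measurable: "rep \<in> borel_measurable \<nu>"
  by (rule continuous_on_measurable[OF continuous_on_rep])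

text \<open>
  On a ball of radius \<open>r\<close>, the average is close to \<open>f\<close> in the mean and to \<open>rep\<close> everywhere, up to a
  multiple of \<open>r powr \<beta>\<close> in both cases.
\<close>

lemma nn_integral_diff_ball_le:
  assumes y: "y \<in> E" and r: "admissible r"
  shows "(\<integral>\<^sup>+z. ennreal \<bar>f z - rep z\<bar> * indicator (E \<inter> ball y r) z \<partial>\<nu>)
      \<le> ennreal ((1 + K_scales + K_holder) * N * A * r powr (s + \<beta>))"
proof -
  let ?B = "E \<inter> ball y r"
  define c where "c = (K_scales + K_holder) * N * r powr \<beta>"
  have c0: "c \<ge> 0" using K_pos N_nonneg by (simp add: c_def)
  note m = measure_ball_bounds[OF y r]
  have emB: "emeasure \<nu> ?B = ennreal (measure \<nu> ?B)"
    using emeasure_ball_finite[OF y] by (simp add: emeasure_eq_ennreal_measure less_top)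
  have int: "integrable \<nu> (\<lambda>z. indicator ?B z * \<bar>f z - avg y r\<bar>)"
    using set_integrable_abs_diff[OF y, of r "avg y r"] by (simp add: set_integrable_def)
  have pt: "\<bar>f z - rep z\<bar> \<le> \<bar>f z - avg y r\<bar> + c" if z: "z \<in> ?B" for z
  proof -
    have "\<bar>avg y r - rep y\<bar> \<le> K_scales * N * r powr \<beta>" by (rule rep_avg[OF y r])
    moreover have "\<bar>rep y - rep z\<bar> \<le> K_holder * N * dist y z powr \<beta>" using z y by (intro rep_holder) auto
    moreover have "K_holder * N * dist y z powr \<beta> \<le> K_holder * N * r powr \<beta>"
      using z beta K_pos N_nonneg by (intro mult_left_mono powr_mono2) auto
    ultimately show ?thesis by (simp add: c_def algebra_simps)
  qed
  have "(\<integral>\<^sup>+z. ennreal \<bar>f z - rep z\<bar> * indicator ?B z \<partial>\<nu>)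
     \<le> (\<integral>\<^sup>+z. (ennreal (indicator ?B z * \<bar>f z - avg y r\<bar>) + ennreal c * indicator ?B z) \<partial>\<nu>)"
    by (intro nn_integral_mono) (use pt c0 in \<open>auto simp: indicator_def ennreal_plus[symmetric] simp del: ennreal_plus intro!: ennreal_leI\<close>)
  also have "\<dots> = (\<integral>\<^sup>+z. ennreal (indicator ?B z * \<bar>f z - avg y r\<bar>) \<partial>\<nu>) + (\<integral>\<^sup>+z. ennreal c * indicator ?B z \<partial>\<nu>)"
    using borel_measurable_integrable[OF int] by (intro nn_integral_add) auto
  also have "(\<integral>\<^sup>+z. ennreal (indicator ?B z * \<bar>f z - avg y r\<bar>) \<partial>\<nu>) = ennreal (LINT z|\<nu>. indicator ?B z * \<bar>f z - avg y r\<bar>)"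
    by (rule nn_integral_eq_integral[OF int]) auto
  also have "(LINT z|\<nu>. indicator ?B z * \<bar>f z - avg y r\<bar>) = measure \<nu> ?B * mean \<nu> ?B (\<lambda>z. \<bar>f z - avg y r\<bar>)"
    using m(3) by (simp add: mean_def set_lebesgue_integral_def)
  also have "(\<integral>\<^sup>+z. ennreal c * indicator ?B z \<partial>\<nu>) = ennreal (c * measure \<nu> ?B)"
    using c0 by (simp add: nn_integral_cmult_indicator emB ennreal_mult)
  also have "ennreal (measure \<nu> ?B * mean \<nu> ?B (\<lambda>z. \<bar>f z - avg y r\<bar>)) + ennreal (c * measure \<nu> ?B)
     \<le> ennreal (measure \<nu> ?B * (N * r powr \<beta>)) + ennreal (c * measure \<nu> ?B)"
    using oscillation[OF y, of r] r unfolding avg_def admissible_def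
    by (intro add_right_mono ennreal_leI mult_left_mono) auto
  also have "\<dots> = ennreal (measure \<nu> ?B * (N * r powr \<beta> + c))"
    using c0 N_nonneg by (simp add: ennreal_plus[symmetric] algebra_simps del: ennreal_plus)
  also have "\<dots> \<le> ennreal ((A * r powr s) * (N * r powr \<beta> + c))"
    using c0 N_nonneg m by (intro ennreal_leI mult_right_mono) auto
  also have "(A * r powr s) * (N * r powr \<beta> + c) = (1 + K_scales + K_holder) * N * A * r powr (s + \<beta>)"
    by (simp add: c_def powr_add algebra_simps)
  finally show ?thesis .
qed

text \<open>
  The preceding bound is averaged over the centres of the balls. Every \<open>z\<close> belongs to the balls around a set of centres of measure at least about \<open>r powr s\<close>, so by
  Tonelli the integral \<open>I\<close> of \<open>\<bar>f - rep\<bar>\<close> over a fixed ball satisfies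
  \<open>r powr s * I \<le> C * r powr (s + \<beta>)\<close> for all small \<open>r\<close>, and therefore vanishes.
\<close>

lemma AE_rep: "AE x in \<nu>. f x = rep x"
proof -
  obtain x0 where x0: "x0 \<in> E" using nonempty by blast
  obtain \<rho> where \<rho>: "admissible \<rho>" using ex_admissible by blast
  define h where "h z = ennreal \<bar>f z - rep z\<bar>" for z
  have h_meas [measurable]: "h \<in> borel_measurable \<nu>"
    unfolding h_def using f_measurable rep_measurable by measurable
  have zero: "(\<integral>\<^sup>+z. h z * indicator (E \<inter> ball x0 R) z \<partial>\<nu>) = 0" if R: "R > 0" for R
  proof -
    define I where "I = (\<integral>\<^sup>+z. h z * indicator (E \<inter> ball x0 R) z \<partial>\<nu>)"
    define C where "C = (1 + K_scales + K_holder) * N * A * (A * (R + \<rho>) powr s) / (a * (1/2) powr s)"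
    have main: "I \<le> ennreal (C * r powr \<beta>)" if r: "0 < r" "r \<le> \<rho>" for r
    proof -
      have ra: "admissible r" by (rule admissible_le[OF \<rho> r])
      define L where "L = a * (r / 2) powr s"
      have L: "L > 0" using a_pos r by (simp add: L_def)
      let ?h = "\<lambda>z. h z * indicator (E \<inter> ball x0 R) z"
      have "ennreal L * I = (\<integral>\<^sup>+z. ennreal L * ?h z \<partial>\<nu>)"
        unfolding I_def by (rule nn_integral_cmult[symmetric]) measurable
      also have "\<dots> \<le> (\<integral>\<^sup>+z. ?h z * emeasure \<nu> (E \<inter> ball z r) \<partial>\<nu>)"
      proof (rule nn_integral_mono)
        fix z assume "z \<in> space \<nu>"
        then have z: "z \<in> E" by (simp add: space_nu)
        have "?h z * ennreal L \<le> ?h z * emeasure \<nu> (E \<inter> ball z r)"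
          using measure_ball_bounds(1)[OF z ra] emeasure_ball_finite[OF z]
          by (intro mult_left_mono) (auto simp: emeasure_eq_ennreal_measure less_top L_def ennreal_leI)
        then show "ennreal L * ?h z \<le> ?h z * emeasure \<nu> (E \<inter> ball z r)" by (simp only: mult.commute)
      qed
      also have "\<dots> = (\<integral>\<^sup>+y. (\<integral>\<^sup>+z. ?h z * indicator (ball y r) z \<partial>\<nu>) \<partial>\<nu>)"
        by (rule nn_integral_emeasure_ball[OF sigma_finite_nu id_measurable]) measurable
      also have "\<dots> \<le> (\<integral>\<^sup>+y. ennreal ((1 + K_scales + K_holder) * N * A * r powr (s + \<beta>)) * indicator (E \<inter> ball x0 (R + r)) y \<partial>\<nu>)"
      proof (rule nn_integral_mono)
        fix y assume "y \<in> space \<nu>"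
        then have y: "y \<in> E" by (simp add: space_nu)
        have "(\<integral>\<^sup>+z. ?h z * indicator (ball y r) z \<partial>\<nu>)
            \<le> (\<integral>\<^sup>+z. (h z * indicator (E \<inter> ball y r) z) * indicator (E \<inter> ball x0 (R + r)) y \<partial>\<nu>)"
        proof (rule nn_integral_mono)
          fix z
          show "?h z * indicator (ball y r) z \<le> h z * indicator (E \<inter> ball y r) z * indicator (E \<inter> ball x0 (R + r)) y"
            using y dist_triangle[of x0 y z] by (auto simp: indicator_def dist_commute)
        qed
        also have "\<dots> = (\<integral>\<^sup>+z. h z * indicator (E \<inter> ball y r) z \<partial>\<nu>) * indicator (E \<inter> ball x0 (R + r)) y"
          by (rule nn_integral_multc) measurable
        also have "\<dots> \<le> ennreal ((1 + K_scales + K_holder) * N * A * r powr (s + \<beta>)) * indicator (E \<inter> ball x0 (R + r)) y"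
          using nn_integral_diff_ball_le[OF y ra] unfolding h_def by (intro mult_right_mono) auto
        finally show "(\<integral>\<^sup>+z. ?h z * indicator (ball y r) z \<partial>\<nu>)
            \<le> ennreal ((1 + K_scales + K_holder) * N * A * r powr (s + \<beta>)) * indicator (E \<inter> ball x0 (R + r)) y" .
      qed
      also have "\<dots> = ennreal ((1 + K_scales + K_holder) * N * A * r powr (s + \<beta>)) * emeasure \<nu> (E \<inter> ball x0 (R + r))"
        by (rule nn_integral_cmult_indicator) simp
      also have "\<dots> \<le> ennreal ((1 + K_scales + K_holder) * N * A * r powr (s + \<beta>)) * ennreal (A * (R + \<rho>) powr s)"
      proof (intro mult_left_mono)
        have "emeasure \<nu> (E \<inter> ball x0 (R + r)) \<le> ennreal (A * (R + r) powr s)"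
          by (rule upper[OF x0]) (use R r in auto)
        also have "\<dots> \<le> ennreal (A * (R + \<rho>) powr s)"
          using R r A_pos s_pos by (intro ennreal_leI mult_left_mono powr_mono2) auto
        finally show "emeasure \<nu> (E \<inter> ball x0 (R + r)) \<le> ennreal (A * (R + \<rho>) powr s)" .
      qed auto
      also have "\<dots> = ennreal ((1 + K_scales + K_holder) * N * A * r powr (s + \<beta>) * (A * (R + \<rho>) powr s))"
        using A_pos K_pos N_nonneg by (intro ennreal_mult[symmetric]) auto
      also have "(1 + K_scales + K_holder) * N * A * r powr (s + \<beta>) * (A * (R + \<rho>) powr s) = L * (C * r powr \<beta>)"
        using a_pos r by (simp add: C_def L_def powr_divide powr_add field_simps)
      also have "ennreal (L * (C * r powr \<beta>)) = ennreal L * ennreal (C * r powr \<beta>)"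
        using L by (simp add: ennreal_mult')
      finally have "ennreal L * I \<le> ennreal L * ennreal (C * r powr \<beta>)" .
      then show "I \<le> ennreal (C * r powr \<beta>)" using L by (subst (asm) ennreal_mult_le_mult_iff) auto
    qed
    have "((\<lambda>r. ennreal (C * r powr \<beta>)) \<longlongrightarrow> ennreal (C * 0)) (at_right 0)"
      using beta by (intro tendsto_ennrealI tendsto_mult tendsto_const tendsto_zero_powrI[where b = \<beta>])
        (auto simp: eventually_at_filter)
    moreover have "eventually (\<lambda>r. I \<le> ennreal (C * r powr \<beta>)) (at_right 0)"
      using \<rho> main by (intro eventually_at_rightI[of 0 \<rho>]) (auto simp: admissible_def)
    ultimately have "I \<le> ennreal (C * 0)" by (rule tendsto_lowerbound) simp
    then show ?thesis by (simp add: I_def)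
  qed
  have "AE z in \<nu>. \<forall>n::nat. h z * indicator (E \<inter> ball x0 (real (Suc n))) z = 0"
    unfolding AE_all_countable
  proof
    fix n :: nat
    have "(\<lambda>z. h z * indicator (E \<inter> ball x0 (real (Suc n))) z) \<in> borel_measurable \<nu>" by measurable
    from nn_integral_0_iff_AE[OF this] zero[of "real (Suc n)"]
    show "AE z in \<nu>. h z * indicator (E \<inter> ball x0 (real (Suc n))) z = 0" by simp
  qed
  then show ?thesis
  proof (rule AE_mp, intro AE_I2 impI)
    fix z assume z: "z \<in> space \<nu>" and all: "\<forall>n::nat. h z * indicator (E \<inter> ball x0 (real (Suc n))) z = 0"
    obtain n :: nat where "dist x0 z < real n" using reals_Archimedean2 by blast
    then have "z \<in> E \<inter> ball x0 (real (Suc n))" using z by (simp add: space_nu)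
    then have "h z = 0" using all[rule_format, of n] by (simp add: indicator_def)
    then show "f z = rep z" by (simp add: h_def)
  qed
qed

text \<open>
  Two continuous functions that differ at a point of \<open>E\<close> differ on a ball, which has positive measure.
\<close>

lemma rep_eq_continuous:
  assumes f: "continuous_on E f" and x: "x \<in> E"
  shows "f x = rep x"
proof (rule ccontr)
  assume ne: "f x \<noteq> rep x"
  obtain \<rho> where \<rho>: "admissible \<rho>" using ex_admissible by blast
  have "continuous_on E (\<lambda>y. f y - rep y)" by (intro continuous_on_diff f continuous_on_rep)
  then have "\<exists>d>0. \<forall>y\<in>E. dist y x < d \<longrightarrow> dist (f y - rep y) (f x - rep x) < \<bar>f x - rep x\<bar>"
    using x ne unfolding continuous_on_iff by (metis zero_less_abs_iff right_minus_eq)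
  then obtain d where d: "d > 0" "\<And>y. y \<in> E \<Longrightarrow> dist y x < d \<Longrightarrow> f y \<noteq> rep y"
    by (fastforce simp: dist_real_def)
  define r where "r = min d \<rho>"
  have ra: "admissible r" by (rule admissible_le[OF \<rho>]) (use d \<rho> in \<open>auto simp: r_def admissible_def\<close>)
  have ae: "AE y in \<nu>. y \<notin> E \<inter> ball x r"
    using AE_rep by eventually_elim (use d in \<open>auto simp: r_def dist_commute\<close>)
  have eq: "{y \<in> space \<nu>. \<not> y \<notin> E \<inter> ball x r} = E \<inter> ball x r" by (auto simp: space_nu)
  have "emeasure \<nu> (E \<inter> ball x r) = 0" using AE_iff_measurable[OF ball_sets eq] ae by simp
  then show False using measure_ball_bounds(3)[OF x ra] by (simp add: measure_def)
qed

end

section \<open>Smooth extension of Hoelder functions\<close>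

lemma (in ahlfors_measure) integrable_kernel:
  assumes p: "s < p" and x: "x \<notin> E"
  shows "integrable \<nu> (\<lambda>y. norm (x - y) powr (- p))"
proof (rule integrableI_nonneg)
  obtain K where "(\<integral>\<^sup>+y. ennreal (dist x y powr (- p)) \<partial>\<nu>) \<le> ennreal (K * infdist x E powr (s - p))"
    using nn_integral_kernel_le[OF p] x by blast
  then show "(\<integral>\<^sup>+y. ennreal (norm (x - y) powr (- p)) \<partial>\<nu>) < \<infinity>"
    by (simp add: dist_norm) (meson ennreal_less_top le_less_trans)
  show "(\<lambda>y. norm (x - y) powr (- p)) \<in> borel_measurable \<nu>"
    by (rule borel_measurable_nu) measurable
qed auto

text \<open>
  The exponent \<open>2 * k\<close> exceeds \<open>s + 1\<close>, so the kernel remains integrable against functions that grow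
  like a power \<open>\<beta> < 1\<close> of the distance.
\<close>

locale holder_function = ahlfors_measure E s A a \<nu>
  for E :: "'a::euclidean_space set" and s A a :: real and \<nu> :: "'a measure" +
  fixes g :: "'a \<Rightarrow> real" and \<beta> L \<Lambda> :: real and k :: nat
  assumes beta: "0 < \<beta>" "\<beta> < 1" and L_nonneg: "0 \<le> L"
    and two_points: "\<exists>y\<in>E. \<exists>z\<in>E. y \<noteq> z"
    and g_measurable: "g \<in> borel_measurable \<nu>"
    and g_holder: "\<And>x y. x \<in> E \<Longrightarrow> y \<in> E \<Longrightarrow> \<bar>g x - g y\<bar> \<le> L * dist x y powr \<beta>"
    and k: "s + 1 < real (2 * k)" and Lambda: "0 < \<Lambda>"
    and ratio: "\<And>x. x \<notin> E \<Longrightarrow> (\<integral>\<^sup>+y. ennreal (dist x y powr (\<beta> - real (2 * k))) \<partial>\<nu>)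
     \<le> ennreal (\<Lambda> * infdist x E powr \<beta>) * (\<integral>\<^sup>+y. ennreal (dist x y powr (- real (2 * k))) \<partial>\<nu>)"
begin

abbreviation "\<kappa> \<equiv> riesz k :: 'a \<Rightarrow> real"

definition mass :: "'a \<Rightarrow> real" where "mass x = (LINT y|\<nu>. 1 * \<kappa> (x - y))"

definition excess :: "real \<Rightarrow> 'a \<Rightarrow> real" where "excess c x = (LINT y|\<nu>. (g y - c) * \<kappa> (x - y))"

text \<open>
  Compared with its value at the point of \<open>E\<close> nearest to \<open>x\<close>, the function \<open>g\<close> grows at most like a
  power of the distance to \<open>x\<close> itself, the variable of the kernel.
\<close>

lemma g_bound:
  assumes x: "x \<notin> E" and x': "x' \<in> E" "dist x x' = infdist x E" and y: "y \<in> E"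
  shows "\<bar>g y - g x'\<bar> \<le> 2 * L * norm (x - y) powr \<beta>"
proof -
  have "dist y x' \<le> 2 * norm (x - y)"
    using dist_triangle[of y x' x] x' infdist_le[OF y, of x] by (simp add: dist_norm norm_minus_commute)
  then have "dist y x' powr \<beta> \<le> 2 * norm (x - y) powr \<beta>" using beta by (intro powr_mult_le) auto
  then have "L * dist y x' powr \<beta> \<le> L * (2 * norm (x - y) powr \<beta>)" using L_nonneg by (rule mult_left_mono)
  then show ?thesis using g_holder[OF y x'(1)] by simp
qed

lemma potential_one: "potential E \<nu> (\<lambda>_. 1) (real (2 * k))"
proof
  fix x m assume "x \<notin> E" "real (2 * k) \<le> m"
  then show "integrable \<nu> (\<lambda>y. 1 * norm (x - y) powr - m)" using k by (simp add: integrable_kernel)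
qed (use closed space_nu id_measurable in auto)

lemma potential_g: "potential E \<nu> (\<lambda>y. g y - c) (real (2 * k))"
proof
  fix x m assume x: "x \<notin> E" and m: "real (2 * k) \<le> m"
  obtain x' where x': "x' \<in> E" "dist x x' = infdist x E" using nearest_point[OF x] by metis
  show "integrable \<nu> (\<lambda>y. (g y - c) * norm (x - y) powr - m)"
  proof (rule Bochner_Integration.integrable_bound)
    show "integrable \<nu> (\<lambda>y. 2 * L * norm (x - y) powr (- (m - \<beta>)) + \<bar>g x' - c\<bar> * norm (x - y) powr (- m))"
      using k m beta x
      by (intro Bochner_Integration.integrable_add integrable_mult_right integrable_kernel) auto
    have "(\<lambda>y. norm (x - y) powr (- m)) \<in> borel_measurable \<nu>"
      by (rule borel_measurable_nu) measurable
    then show "(\<lambda>y. (g y - c) * norm (x - y) powr - m) \<in> borel_measurable \<nu>"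
      using g_measurable by measurable
    show "AE y in \<nu>. norm ((g y - c) * norm (x - y) powr - m)
      \<le> norm (2 * L * norm (x - y) powr (- (m - \<beta>)) + \<bar>g x' - c\<bar> * norm (x - y) powr (- m))"
    proof (rule AE_I2)
      fix y assume "y \<in> space \<nu>"
      then have y: "y \<in> E" by (simp add: space_nu)
      have "\<bar>g y - c\<bar> \<le> 2 * L * norm (x - y) powr \<beta> + \<bar>g x' - c\<bar>"
        using g_bound[OF x x' y] by linarith
      then have "\<bar>g y - c\<bar> * norm (x - y) powr - m \<le> (2 * L * norm (x - y) powr \<beta> + \<bar>g x' - c\<bar>) * norm (x - y) powr - m"
        by (rule mult_right_mono) simp
      also have "\<dots> = 2 * L * norm (x - y) powr (- (m - \<beta>)) + \<bar>g x' - c\<bar> * norm (x - y) powr (- m)"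
        by (simp add: algebra_simps powr_add[symmetric])
      finally show "norm ((g y - c) * norm (x - y) powr - m)
        \<le> norm (2 * L * norm (x - y) powr (- (m - \<beta>)) + \<bar>g x' - c\<bar> * norm (x - y) powr (- m))"
        by (simp add: abs_mult)
    qed
  qed
qed (use closed space_nu id_measurable g_measurable in auto)

sublocale P1: potential E \<nu> "\<lambda>_. 1" "real (2 * k)" by (rule potential_one)

lemma mass_pot: "mass = P1.pot \<kappa>"
  by (simp add: fun_eq_iff mass_def P1.pot_def)

lemma excess_pot: "excess c = potential.pot \<nu> (\<lambda>y. g y - c) \<kappa>"
proof -
  interpret P: potential E \<nu> "\<lambda>y. g y - c" "real (2 * k)" by (rule potential_g)
  show ?thesis by (simp add: fun_eq_iff excess_def P.pot_def)
qed

lemma kappa_continuous: "continuous_on (- {0}) \<kappa>"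
  by (rule C_on_imp_continuous[OF riesz_C_on])

lemma kappa_eq: "x \<notin> E \<Longrightarrow> y \<in> E \<Longrightarrow> \<kappa> (x - y) = norm (x - y) powr (- real (2 * k))"
  by (rule riesz_eq) auto

lemma integrable_kappa: "x \<notin> E \<Longrightarrow> integrable \<nu> (\<lambda>y. \<kappa> (x - y))"
  using P1.pot_integrable[OF _ kappa_continuous riesz_homogeneous order_refl, of x] by simp

lemma integrable_g_kappa: "x \<notin> E \<Longrightarrow> integrable \<nu> (\<lambda>y. (g y - c) * \<kappa> (x - y))"
proof -
  interpret P: potential E \<nu> "\<lambda>y. g y - c" "real (2 * k)" by (rule potential_g)
  show "x \<notin> E \<Longrightarrow> ?thesis"
    using P.pot_integrable[OF _ kappa_continuous riesz_homogeneous order_refl, of x] by simp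
qed

lemma mass_nn_integral:
  assumes x: "x \<notin> E"
  shows "(\<integral>\<^sup>+y. ennreal (dist x y powr (- real (2 * k))) \<partial>\<nu>) = ennreal (mass x)"
proof -
  have "(\<integral>\<^sup>+y. ennreal (dist x y powr (- real (2 * k))) \<partial>\<nu>) = (\<integral>\<^sup>+y. ennreal (\<kappa> (x - y)) \<partial>\<nu>)"
    by (intro nn_integral_cong) (use x kappa_eq in \<open>auto simp: space_nu dist_norm\<close>)
  also have "\<dots> = ennreal (mass x)"
    unfolding mass_def using integrable_kappa[OF x]
    by (subst nn_integral_eq_integral) (auto simp: riesz_def)
  finally show ?thesis .
qed

lemma mass_pos: assumes x: "x \<notin> E" shows "0 < mass x"
proof -
  obtain y z where yz: "y \<in> E" "z \<in> E" "y \<noteq> z" using two_points by blast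
  have "0 < ennreal (mass x)"
    using nn_integral_kernel_pos[OF x _ yz, of "real (2 * k)"] unfolding mass_nn_integral[OF x] by simp
  then show ?thesis by (simp add: ennreal_less_zero_iff)
qed

lemma weighted_le:
  assumes x: "x \<notin> E"
  shows "integrable \<nu> (\<lambda>y. norm (x - y) powr \<beta> * \<kappa> (x - y))"
    "(LINT y|\<nu>. norm (x - y) powr \<beta> * \<kappa> (x - y)) \<le> \<Lambda> * infdist x E powr \<beta> * mass x"
proof -
  have eq: "norm (x - y) powr \<beta> * \<kappa> (x - y) = norm (x - y) powr (- (real (2 * k) - \<beta>))" if "y \<in> space \<nu>" for y
    using that x by (simp add: kappa_eq space_nu powr_add[symmetric])
  have "integrable \<nu> (\<lambda>y. norm (x - y) powr (- (real (2 * k) - \<beta>)))"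
    using k beta by (intro integrable_kernel x) simp
  moreover have "integrable \<nu> (\<lambda>y. norm (x - y) powr \<beta> * \<kappa> (x - y))
      \<longleftrightarrow> integrable \<nu> (\<lambda>y. norm (x - y) powr (- (real (2 * k) - \<beta>)))"
    by (rule Bochner_Integration.integrable_cong[OF refl eq])
  ultimately show int: "integrable \<nu> (\<lambda>y. norm (x - y) powr \<beta> * \<kappa> (x - y))" by blast
  have "ennreal (LINT y|\<nu>. norm (x - y) powr \<beta> * \<kappa> (x - y)) = (\<integral>\<^sup>+y. ennreal (norm (x - y) powr \<beta> * \<kappa> (x - y)) \<partial>\<nu>)"
    using int by (intro nn_integral_eq_integral[symmetric]) (auto simp: riesz_def)
  also have "\<dots> = (\<integral>\<^sup>+y. ennreal (dist x y powr (\<beta> - real (2 * k))) \<partial>\<nu>)"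
    by (intro nn_integral_cong) (simp add: eq dist_norm)
  also have "\<dots> \<le> ennreal (\<Lambda> * infdist x E powr \<beta>) * ennreal (mass x)"
    using ratio[OF x] unfolding mass_nn_integral[OF x] .
  also have "\<dots> = ennreal (\<Lambda> * infdist x E powr \<beta> * mass x)"
    using mass_pos[OF x] Lambda by (intro ennreal_mult[symmetric]) auto
  finally show "(LINT y|\<nu>. norm (x - y) powr \<beta> * \<kappa> (x - y)) \<le> \<Lambda> * infdist x E powr \<beta> * mass x"
    using mass_pos[OF x] Lambda by (simp add: ennreal_le_iff)
qed

text \<open>
  Off \<open>E\<close> this is the average of \<open>g\<close> with respect to the normalised Riesz weights.
\<close>

definition F :: "'a \<Rightarrow> real" where
  "F x = (if x \<in> E then g x else excess 0 x / mass x)"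

text \<open>
  Weighted averages commute with adding constants. The constant can therefore be adapted to the
  point at which \<open>F\<close> is examined.
\<close>

lemma F_eq: assumes x: "x \<notin> E" shows "F x = c + excess c x * inverse (mass x)"
proof -
  have "excess c x = (LINT y|\<nu>. (g y - 0) * \<kappa> (x - y) - c * \<kappa> (x - y))"
    unfolding excess_def by (intro Bochner_Integration.integral_cong) (auto simp: algebra_simps)
  also have "\<dots> = excess 0 x - c * mass x"
    unfolding excess_def mass_def
    by (subst Bochner_Integration.integral_diff[OF integrable_g_kappa[OF x] integrable_mult_right[OF integrable_kappa[OF x]]]) simp
  finally show ?thesis using x mass_pos[OF x] by (simp add: F_def field_simps)
qed

lemma open_compl_E: "open (- E)" using closed by (simp add: open_Compl)

lemma mass_C_on: "C_on j mass (- E)"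
  unfolding mass_pot by (rule P1.pot_C_on[OF riesz_C_on riesz_homogeneous order_refl])

lemma excess_C_on: "C_on j (excess c) (- E)"
  unfolding excess_pot by (rule potential.pot_C_on[OF potential_g riesz_C_on riesz_homogeneous order_refl])

lemma F_smooth: "smooth_on F (- E)"
  unfolding smooth_on_def
proof
  fix j
  have "C_on j (\<lambda>x. 0 + excess 0 x * inverse (mass x)) (- E)"
    using mass_pos by (intro C_on_add C_on_mult C_on_const C_on_inverse open_compl_E excess_C_on mass_C_on) force
  then show "C_on j F (- E)"
    by (rule C_on_cong[OF open_compl_E, rotated]) (use F_eq[of _ 0] in simp)
qed

lemma excess_bound:
  assumes x: "x \<notin> E" and x': "x' \<in> E" "dist x x' = infdist x E"
  shows "\<bar>excess (g x') x\<bar> \<le> 2 * L * \<Lambda> * infdist x E powr \<beta> * mass x"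
proof -
  have "\<bar>excess (g x') x\<bar> \<le> (LINT y|\<nu>. 2 * L * (norm (x - y) powr \<beta> * \<kappa> (x - y)))"
    unfolding excess_def
  proof (rule abs_integral_le[OF integrable_g_kappa[OF x] integrable_mult_right[OF weighted_le(1)[OF x]]])
    fix y assume "y \<in> space \<nu>"
    then have "\<bar>g y - g x'\<bar> * \<kappa> (x - y) \<le> (2 * L * norm (x - y) powr \<beta>) * \<kappa> (x - y)"
      by (intro mult_right_mono g_bound x x') (auto simp: space_nu riesz_def)
    then show "\<bar>(g y - g x') * \<kappa> (x - y)\<bar> \<le> 2 * L * (norm (x - y) powr \<beta> * \<kappa> (x - y))"
      by (simp add: abs_mult riesz_def mult_ac)
  qed
  also have "\<dots> \<le> 2 * L * (\<Lambda> * infdist x E powr \<beta> * mass x)"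
    using weighted_le(2)[OF x] L_nonneg by (simp add: mult_left_mono)
  finally show ?thesis by (simp add: mult_ac)
qed

lemma F_nearest:
  assumes x: "x \<notin> E" and x': "x' \<in> E" "dist x x' = infdist x E"
  shows "\<bar>F x - g x'\<bar> \<le> 2 * L * \<Lambda> * infdist x E powr \<beta>"
proof -
  have "\<bar>F x - g x'\<bar> = \<bar>excess (g x') x\<bar> / mass x"
    using mass_pos[OF x] by (simp add: F_eq[OF x, of "g x'"] abs_mult divide_inverse)
  also have "\<dots> \<le> 2 * L * \<Lambda> * infdist x E powr \<beta>"
    using excess_bound[OF assms] mass_pos[OF x] by (simp add: divide_le_eq)
  finally show ?thesis .
qed

lemma F_boundary:
  assumes \<xi>: "\<xi> \<in> E"
  shows "\<bar>F x - g \<xi>\<bar> \<le> (2 * \<Lambda> + 2) * L * dist x \<xi> powr \<beta>"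
proof (cases "x \<in> E")
  case True
  have "L * dist x \<xi> powr \<beta> \<le> (2 * \<Lambda> + 2) * (L * dist x \<xi> powr \<beta>)"
    using L_nonneg Lambda mult_right_mono[of 1 "2 * \<Lambda> + 2" "L * dist x \<xi> powr \<beta>"] by simp
  then show ?thesis using g_holder[OF True \<xi>] True by (simp add: F_def mult.assoc)
next
  case False
  obtain x' where x': "x' \<in> E" "dist x x' = infdist x E" using nearest_point[OF False] by metis
  have d: "infdist x E \<le> dist x \<xi>" by (rule infdist_le[OF \<xi>])
  have "\<bar>F x - g x'\<bar> \<le> 2 * L * \<Lambda> * infdist x E powr \<beta>" by (rule F_nearest[OF False x'])
  also have "\<dots> \<le> 2 * L * \<Lambda> * dist x \<xi> powr \<beta>"
    using d beta L_nonneg Lambda infdist_nonneg[of x E] by (intro mult_left_mono powr_mono2) auto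
  finally have 1: "\<bar>F x - g x'\<bar> \<le> 2 * L * \<Lambda> * dist x \<xi> powr \<beta>" .
  have "dist x' \<xi> \<le> 2 * dist x \<xi>" using dist_triangle[of x' \<xi> x] x' d by (simp add: dist_commute)
  then have "dist x' \<xi> powr \<beta> \<le> 2 * dist x \<xi> powr \<beta>" using beta by (intro powr_mult_le) auto
  then have "L * dist x' \<xi> powr \<beta> \<le> L * (2 * dist x \<xi> powr \<beta>)" using L_nonneg by (rule mult_left_mono)
  then have "\<bar>g x' - g \<xi>\<bar> \<le> L * (2 * dist x \<xi> powr \<beta>)" using g_holder[OF x'(1) \<xi>] by linarith
  with 1 have "\<bar>F x - g \<xi>\<bar> \<le> 2 * L * \<Lambda> * dist x \<xi> powr \<beta> + L * (2 * dist x \<xi> powr \<beta>)" by linarith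
  then show ?thesis by (simp add: algebra_simps)
qed

text \<open>
  With \<open>c = g x'\<close> the derivative falls on the kernel, at the price of a factor \<open>1 / norm (x - y)\<close>.
  Together with the growth of \<open>g - c\<close> this yields the decreasing power \<open>\<beta> - 1\<close> of \<open>norm (x - y)\<close>, which is
  largest at the distance \<open>D\<close> to \<open>E\<close>; what remains is \<open>mass x\<close>, cancelled by the normalisation.
  The derivative of the normalising factor is handled by \<open>excess_bound\<close>.
\<close>

lemma F_gradient:
  assumes x: "x \<notin> E"
  shows "norm (grad F x) \<le> 4 * real k * (1 + \<Lambda>) * L * infdist x E powr (\<beta> - 1)"
proof -
  obtain x' where x': "x' \<in> E" "dist x x' = infdist x E" "0 < infdist x E"
    "\<And>y. y \<in> E \<Longrightarrow> infdist x E \<le> dist x y" using nearest_point[OF x] by metis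
  define D where "D = infdist x E"
  define c where "c = g x'"
  interpret P: potential E \<nu> "\<lambda>y. g y - c" "real (2 * k)" by (rule potential_g)
  define dk where "dk h z = frechet_derivative \<kappa> (at z) h" for h z
  have dk_hom: "homogeneous (- (real (2 * k) + 1)) (dk h)" for h
  proof -
    have "\<kappa> differentiable (at z)" if "z \<noteq> 0" for z
      using riesz_C_on[where j = "Suc 0" and k = k and 'a = 'a] that by simp
    from homogeneous_derivative[OF riesz_homogeneous this, of h] show ?thesis
      unfolding dk_def[abs_def] by simp
  qed
  have dk_cont: "continuous_on (- {0}) (dk h)" for h
    using riesz_C_on[where j = "Suc 0" and k = k and 'a = 'a] unfolding dk_def[abs_def] by simp
  have C2: "C_on 2 \<kappa> (- {0})" by (rule riesz_C_on)
  have xE: "x \<in> - E" using x by simp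
  have du: "(mass has_derivative (\<lambda>h. P1.pot (dk h) x)) (at x)"
    unfolding mass_pot dk_def[abs_def] by (rule P1.pot_has_derivative[OF x C2 riesz_homogeneous order_refl])
  have dv: "(excess c has_derivative (\<lambda>h. P.pot (dk h) x)) (at x)"
    unfolding excess_pot dk_def[abs_def] by (rule P.pot_has_derivative[OF x C2 riesz_homogeneous order_refl])
  have u0: "mass x \<noteq> 0" using mass_pos[OF x] by simp
  define DF where "DF h = excess c x * (- (inverse (mass x) * P1.pot (dk h) x * inverse (mass x))) + P.pot (dk h) x * inverse (mass x)" for h
  have "((\<lambda>w. c + excess c w * inverse (mass w)) has_derivative (\<lambda>h. 0 + DF h)) (at x)"
    unfolding DF_def
    by (intro has_derivative_add has_derivative_const has_derivative_mult dv Deriv.has_derivative_inverse[OF u0 du])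
  then have DF: "(F has_derivative DF) (at x)"
    using has_derivative_transform_within_open[OF _ open_compl_E xE, of _ _ _ F] F_eq[of _ c] by simp
  have dk_bound: "\<bar>dk h (x - y)\<bar> \<le> 2 * real k * norm h * norm (x - y) powr (- 1) * \<kappa> (x - y)" if y: "y \<in> E" for h y
  proof -
    have ne: "x - y \<noteq> 0" using x y by auto
    have "\<bar>dk h (x - y)\<bar> = 2 * real k * \<bar>(x - y) \<bullet> h\<bar> * riesz (Suc k) (x - y)"
      using riesz_derivative[OF ne, of k h] by (simp add: dk_def abs_mult riesz_def)
    also have "\<dots> \<le> 2 * real k * (norm (x - y) * norm h) * riesz (Suc k) (x - y)"
      by (intro mult_right_mono mult_left_mono Cauchy_Schwarz_ineq2) (auto simp: riesz_def)
    also have "riesz (Suc k) (x - y) = norm (x - y) powr (- 2) * \<kappa> (x - y)"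
      using ne by (simp add: riesz_eq powr_add[symmetric])
    also have "2 * real k * (norm (x - y) * norm h) * (norm (x - y) powr (- 2) * \<kappa> (x - y))
      = 2 * real k * norm h * (norm (x - y) * norm (x - y) powr (- 2)) * \<kappa> (x - y)" by (simp add: mult_ac)
    also have "norm (x - y) * norm (x - y) powr (- 2) = norm (x - y) powr (- 1)"
      using ne by (simp add: powr_mult_base)
    finally show ?thesis .
  qed
  have Dle: "D \<le> norm (x - y)" if "y \<in> E" for y using x'(4)[OF that] by (simp add: D_def dist_norm)
  have D0: "0 < D" using x' by (simp add: D_def)
  have kn: "0 \<le> \<kappa> z" for z by (simp add: riesz_def)
  have Du: "\<bar>P1.pot (dk h) x\<bar> \<le> 2 * real k * norm h * D powr (- 1) * mass x" for h
  proof -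
    have "\<bar>P1.pot (dk h) x\<bar> \<le> (LINT y|\<nu>. 2 * real k * norm h * D powr (- 1) * \<kappa> (x - y))"
      unfolding P1.pot_def
    proof (rule abs_integral_le)
      show "integrable \<nu> (\<lambda>y. 1 * dk h (x - y))" by (rule P1.pot_integrable[OF x dk_cont dk_hom]) simp
      show "integrable \<nu> (\<lambda>y. 2 * real k * norm h * D powr (- 1) * \<kappa> (x - y))"
        by (rule integrable_mult_right) (rule integrable_kappa[OF x])
      fix y assume "y \<in> space \<nu>"
      then have y: "y \<in> E" by (simp add: space_nu)
      have "2 * real k * norm h * norm (x - y) powr (- 1) * \<kappa> (x - y) \<le> 2 * real k * norm h * D powr (- 1) * \<kappa> (x - y)"
        using Dle[OF y] D0 kn by (intro mult_right_mono mult_left_mono powr_mono2') auto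
      then show "\<bar>1 * dk h (x - y)\<bar> \<le> 2 * real k * norm h * D powr (- 1) * \<kappa> (x - y)"
        using dk_bound[OF y, of h] by simp
    qed
    also have "\<dots> = 2 * real k * norm h * D powr (- 1) * mass x" by (simp add: mass_def)
    finally show ?thesis .
  qed
  have Dv: "\<bar>P.pot (dk h) x\<bar> \<le> 4 * real k * L * norm h * D powr (\<beta> - 1) * mass x" for h
  proof -
    have "\<bar>P.pot (dk h) x\<bar> \<le> (LINT y|\<nu>. 4 * real k * L * norm h * D powr (\<beta> - 1) * \<kappa> (x - y))"
      unfolding P.pot_def
    proof (rule abs_integral_le)
      show "integrable \<nu> (\<lambda>y. (g y - c) * dk h (x - y))" by (rule P.pot_integrable[OF x dk_cont dk_hom]) simp
      show "integrable \<nu> (\<lambda>y. 4 * real k * L * norm h * D powr (\<beta> - 1) * \<kappa> (x - y))"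
        by (rule integrable_mult_right) (rule integrable_kappa[OF x])
      fix y assume "y \<in> space \<nu>"
      then have y: "y \<in> E" by (simp add: space_nu)
      have "\<bar>(g y - c) * dk h (x - y)\<bar> \<le> (2 * L * norm (x - y) powr \<beta>) * (2 * real k * norm h * norm (x - y) powr (- 1) * \<kappa> (x - y))"
        unfolding abs_mult c_def
        by (intro mult_mono g_bound x x' y dk_bound) (use L_nonneg in auto)
      also have "\<dots> = 4 * real k * L * norm h * norm (x - y) powr (\<beta> - 1) * \<kappa> (x - y)"
        by (simp add: powr_add[of _ \<beta> "- 1", simplified] mult_ac)
      also have "\<dots> \<le> 4 * real k * L * norm h * D powr (\<beta> - 1) * \<kappa> (x - y)"
        using Dle[OF y] D0 kn L_nonneg beta by (intro mult_right_mono mult_left_mono powr_mono2') auto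
      finally show "\<bar>(g y - c) * dk h (x - y)\<bar> \<le> 4 * real k * L * norm h * D powr (\<beta> - 1) * \<kappa> (x - y)" .
    qed
    also have "\<dots> = 4 * real k * L * norm h * D powr (\<beta> - 1) * mass x" by (simp add: mass_def)
    finally show ?thesis .
  qed
  have "\<bar>DF h\<bar> \<le> (4 * real k * (1 + \<Lambda>) * L * D powr (\<beta> - 1)) * norm h" for h
  proof -
    have up: "mass x > 0" by (rule mass_pos[OF x])
    have "\<bar>DF h\<bar> \<le> \<bar>excess c x * (inverse (mass x) * P1.pot (dk h) x * inverse (mass x))\<bar> + \<bar>P.pot (dk h) x * inverse (mass x)\<bar>"
      unfolding DF_def using abs_triangle_ineq[of "- (excess c x * (inverse (mass x) * P1.pot (dk h) x * inverse (mass x)))" "P.pot (dk h) x * inverse (mass x)"] by simp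
    also have "\<dots> = (\<bar>excess c x\<bar> / mass x) * (\<bar>P1.pot (dk h) x\<bar> / mass x) + \<bar>P.pot (dk h) x\<bar> / mass x"
      using up by (simp add: abs_mult divide_inverse mult_ac)
    also have "\<dots> \<le> (2 * L * \<Lambda> * D powr \<beta>) * (2 * real k * norm h * D powr (- 1)) + 4 * real k * L * norm h * D powr (\<beta> - 1)"
    proof (intro add_mono mult_mono)
      show "\<bar>excess c x\<bar> / mass x \<le> 2 * L * \<Lambda> * D powr \<beta>"
        using excess_bound[OF x x'(1,2)] up by (simp add: divide_le_eq c_def D_def)
      show "\<bar>P1.pot (dk h) x\<bar> / mass x \<le> 2 * real k * norm h * D powr (- 1)"
        using Du[of h] up by (simp add: divide_le_eq)
      show "\<bar>P.pot (dk h) x\<bar> / mass x \<le> 4 * real k * L * norm h * D powr (\<beta> - 1)"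
        using Dv[of h] up by (simp add: divide_le_eq)
    qed (use L_nonneg Lambda up in auto)
    also have "\<dots> = (4 * real k * (1 + \<Lambda>) * L * D powr (\<beta> - 1)) * norm h"
    proof -
      have "D powr \<beta> * D powr (- 1) = D powr (\<beta> - 1)" by (simp only: powr_add[symmetric]) simp
      then have "(2 * L * \<Lambda> * D powr \<beta>) * (2 * real k * norm h * D powr (- 1)) = 4 * real k * \<Lambda> * L * norm h * D powr (\<beta> - 1)"
        by (simp only: mult_ac)
      then show ?thesis by (simp add: algebra_simps)
    qed
    finally show ?thesis .
  qed
  from norm_grad_le[OF DF this] show ?thesis by (simp add: D_def)
qed

end

text \<open>
  The Hoelder representative of \<open>f\<close> is extended; the constant is fixed before \<open>f\<close> is chosen.
\<close>

lemma (in ahlfors_measure) campanato_extension: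
  assumes \<beta>: "0 < \<beta>" "\<beta> < 1" and two: "y0 \<in> E" "z0 \<in> E" "y0 \<noteq> z0"
  shows "\<exists>K>0. \<forall>f N. campanato_function E s A a \<nu> f \<beta> N \<longrightarrow>
    (\<exists>F. smooth_on F (- E) \<and>
      (\<forall>x. x \<notin> E \<longrightarrow> norm (grad F x) \<le> K * N * infdist x E powr (\<beta> - 1)) \<and>
      (\<forall>x. \<forall>\<xi>\<in>E. \<bar>F x - F \<xi>\<bar> \<le> K * N * dist x \<xi> powr \<beta>) \<and>
      (AE x in \<nu>. f x = F x) \<and> (continuous_on E f \<longrightarrow> (\<forall>x\<in>E. F x = f x)))"
proof -
  obtain k :: nat where k: "s + 1 < real (2 * k)"
  proof -
    obtain j :: nat where "s + 1 < real j" using reals_Archimedean2 by blast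
    then show ?thesis using that[of j] by simp
  qed
  obtain \<Lambda> where \<Lambda>: "\<Lambda> > 0" "\<And>x. x \<notin> E \<Longrightarrow> (\<integral>\<^sup>+y. ennreal (dist x y powr (\<beta> - real (2 * k))) \<partial>\<nu>)
     \<le> ennreal (\<Lambda> * infdist x E powr \<beta>) * (\<integral>\<^sup>+y. ennreal (dist x y powr (- real (2 * k))) \<partial>\<nu>)"
    using nn_integral_kernel_ratio[of \<beta> "real (2 * k)"] k \<beta> by auto
  define K_step where "K_step = A * 6 powr s / a"
  define K_scales where "K_scales = K_step / (1 - (1/2) powr \<beta>)"
  define K1 where "K1 = K_scales + 2 * (K_step + K_scales)"
  define K2 where "K2 = 4 * real k * (1 + \<Lambda>) + (2 * \<Lambda> + 2)"
  have "(1/2::real) powr \<beta> < 1" using \<beta> by (simp add: powr01_less_one)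
  then have "K_step > 0" "K_scales > 0" using A_pos a_pos by (auto simp: K_step_def K_scales_def)
  then have K1: "K1 > 0" by (simp add: K1_def)
  have K2: "4 * real k * (1 + \<Lambda>) \<le> K2" "2 * \<Lambda> + 2 \<le> K2" "0 < K2"
    using \<Lambda>(1) by (auto simp: K2_def intro: add_nonneg_pos)
  show ?thesis
  proof (intro exI[of _ "K2 * K1"] conjI allI impI)
    show "0 < K2 * K1" using K1 K2 by simp
    fix f N assume "campanato_function E s A a \<nu> f \<beta> N"
    then interpret c: campanato_function E s A a \<nu> f \<beta> N .
    have "c.K_holder = K1"
      by (simp add: c.K_holder_def c.K_scales_def c.K_step_def K1_def K_scales_def K_step_def)
    then interpret h: holder_function E s A a \<nu> c.rep \<beta> "K1 * N" \<Lambda> k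
      using c.rep_holder c.rep_measurable c.N_nonneg K1 \<beta> k \<Lambda> two by unfold_locales auto
    have KN: "0 \<le> K1 * N" using K1 c.N_nonneg by simp
    have F_E: "h.F x = c.rep x" if "x \<in> E" for x using that by (simp add: h.F_def)
    have "norm (grad h.F x) \<le> K2 * K1 * N * infdist x E powr (\<beta> - 1)" if "x \<notin> E" for x
      unfolding mult.assoc[of K2 K1]
      by (rule order_trans[OF h.F_gradient[OF that]]) (intro mult_right_mono K2 KN; simp)
    moreover have "\<bar>h.F x - h.F \<xi>\<bar> \<le> K2 * K1 * N * dist x \<xi> powr \<beta>" if "\<xi> \<in> E" for x \<xi>
      unfolding mult.assoc[of K2 K1] F_E[OF that]
      by (rule order_trans[OF h.F_boundary[OF that]]) (intro mult_right_mono K2 KN; simp)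
    moreover have "AE x in \<nu>. x \<in> E" by (rule AE_I2) (simp add: space_nu)
    then have "AE x in \<nu>. f x = h.F x" using c.AE_rep by eventually_elim (simp add: F_E)
    moreover have "continuous_on E f \<longrightarrow> (\<forall>x\<in>E. h.F x = f x)"
      using c.rep_eq_continuous F_E by simp
    ultimately show "\<exists>F. smooth_on F (- E) \<and>
      (\<forall>x. x \<notin> E \<longrightarrow> norm (grad F x) \<le> K2 * K1 * N * infdist x E powr (\<beta> - 1)) \<and>
      (\<forall>x. \<forall>\<xi>\<in>E. \<bar>F x - F \<xi>\<bar> \<le> K2 * K1 * N * dist x \<xi> powr \<beta>) \<and>
      (AE x in \<nu>. f x = F x) \<and> (continuous_on E f \<longrightarrow> (\<forall>x\<in>E. F x = f x))"
      using h.F_smooth by (intro exI[of _ h.F]) auto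
  qed
qed

section \<open>Estimates for the extension on a domain\<close>

text \<open>
  What the extension theorem asks of an extension \<open>F\<close> of a single function \<open>f\<close>, with
  aperture constant \<open>1/2\<close> for the Whitney balls and \<open>C\<close> for the implicit constants.
\<close>

definition controlled_extension ::
    "nat \<Rightarrow> real \<Rightarrow> 'a::euclidean_space set \<Rightarrow> real \<Rightarrow> real \<Rightarrow> real \<Rightarrow> ('a \<Rightarrow> real) \<Rightarrow> ('a \<Rightarrow> real) \<Rightarrow> bool" where
  "controlled_extension n s \<Omega> \<alpha> \<beta> C f F \<longleftrightarrow>
     (\<forall>c\<in>{0<..1/2}.
         smooth_on F \<Omega> \<and>
         (SUP \<xi>\<in>frontier \<Omega>. N_sharp \<Omega> \<alpha> \<beta> c F \<xi>) +
           (SUP x\<in>\<Omega>. ennreal (dist_compl \<Omega> x powr (1 - \<beta>) * norm (grad F x)))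
           \<le> ennreal C * campanato_norm s \<beta> \<Omega> f \<and>
         (SUP \<xi>\<in>frontier \<Omega>. carleson n \<Omega> s \<beta> c (grad F) \<xi>)
           \<le> ennreal C * campanato_norm s \<beta> \<Omega> f \<and>
         (AE \<xi> in surface_measure s \<Omega>. nontangential_limit_at \<Omega> F f \<xi>)) \<and>
      (f \<in> Lip \<beta> (frontier \<Omega>) \<longrightarrow>
         F \<in> Lip \<beta> (closure \<Omega>) \<and> continuous_on (closure \<Omega>) F \<and>
         (\<forall>\<xi>\<in>frontier \<Omega>. F \<xi> = f \<xi>))"

text \<open>
  The segment from \<open>x\<close> to a nearest point of the complement crosses the boundary.
\<close>

lemma dist_compl_eq:
  fixes \<Omega> :: "'a::euclidean_space set"
  assumes op: "open \<Omega>" and ne: "frontier \<Omega> \<noteq> {}" and x: "x \<in> \<Omega>"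
  shows "dist_compl \<Omega> x = infdist x (frontier \<Omega>)"
proof (rule antisym)
  have sub: "frontier \<Omega> \<subseteq> - \<Omega>" using op by (auto simp: frontier_def interior_open)
  show "dist_compl \<Omega> x \<le> infdist x (frontier \<Omega>)"
    unfolding dist_compl_def by (rule infdist_mono[OF sub ne])
  have "- \<Omega> \<noteq> {}" using sub ne by blast
  then obtain x' where x': "x' \<in> - \<Omega>" "infdist x (- \<Omega>) = dist x x'"
    using infdist_attains_inf[of "- \<Omega>" x] op by (auto simp: closed_Compl)
  have "closed_segment x x' \<inter> frontier \<Omega> \<noteq> {}"
    using x x' by (intro connected_Int_frontier) auto
  then obtain w where w: "w \<in> closed_segment x x'" "w \<in> frontier \<Omega>" by blast
  have "infdist x (frontier \<Omega>) \<le> dist x w" by (rule infdist_le[OF w(2)])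
  also have "\<dots> \<le> dist x x'" using dist_in_closed_segment[OF w(1)] by (simp add: dist_commute)
  finally show "infdist x (frontier \<Omega>) \<le> dist_compl \<Omega> x" by (simp add: dist_compl_def x')
qed

lemma powr_half_le: "0 < \<beta> \<Longrightarrow> 0 \<le> t \<Longrightarrow> (t / 2) powr (\<beta> - 1) \<le> 2 * t powr (\<beta> - 1)" for t \<beta> :: real
  using powr_mono[of "1 - \<beta>" 1 "2::real"] powr_minus_divide[of 2 "\<beta> - 1"]
    mult_right_mono[of "2 powr (1 - \<beta>)" 2 "t powr (\<beta> - 1)"]
  by (simp add: powr_divide)

text \<open>
  The properties of an extension from which the estimates on the domain follow. The distance in the
  gradient bound is that to the boundary, which equals the one to the complement (\<open>dist_compl_eq\<close>).
\<close>

locale smooth_extension =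
  fixes \<Omega> :: "'a::euclidean_space set" and F :: "'a \<Rightarrow> real" and \<beta> H :: real
  assumes op: "open \<Omega>" and ne: "frontier \<Omega> \<noteq> {}" and \<beta>: "0 < \<beta>" "\<beta> < 1" and H: "0 \<le> H"
    and smooth: "smooth_on F \<Omega>"
    and gradient: "\<And>x. x \<in> \<Omega> \<Longrightarrow> norm (grad F x) \<le> H * infdist x (frontier \<Omega>) powr (\<beta> - 1)"
    and boundary: "\<And>x \<xi>. x \<in> closure \<Omega> \<Longrightarrow> \<xi> \<in> frontier \<Omega> \<Longrightarrow> \<bar>F x - F \<xi>\<bar> \<le> H * dist x \<xi> powr \<beta>"
begin

abbreviation "\<delta> x \<equiv> infdist x (frontier \<Omega>)"

lemma frontier_disjoint: "x \<in> \<Omega> \<Longrightarrow> x \<notin> frontier \<Omega>"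
  using op by (simp add: frontier_def interior_open)

lemma delta_pos: "x \<in> \<Omega> \<Longrightarrow> 0 < \<delta> x"
  using infdist_pos_not_in_closed[OF frontier_closed ne] frontier_disjoint by blast

lemma ball_delta: assumes x: "x \<in> \<Omega>" shows "ball x (\<delta> x) \<subseteq> \<Omega>"
proof
  fix y assume y: "y \<in> ball x (\<delta> x)"
  show "y \<in> \<Omega>"
  proof (rule ccontr)
    assume "y \<notin> \<Omega>"
    then have "infdist x (- \<Omega>) \<le> dist x y" by (intro infdist_le) simp
    then show False using y dist_compl_eq[OF op ne x] by (simp add: dist_compl_def)
  qed
qed

lemma delta_half: "y \<in> ball x (\<delta> x / 2) \<Longrightarrow> \<delta> x / 2 \<le> \<delta> y"
  using infdist_triangle[of x "frontier \<Omega>" y] by simp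

lemma F_derivative: "x \<in> \<Omega> \<Longrightarrow> (F has_derivative (\<lambda>h. h \<bullet> grad F x)) (at x)"
proof -
  assume x: "x \<in> \<Omega>"
  have "C_on (Suc 0) F \<Omega>" using smooth by (simp only: smooth_on_def)
  then have d: "(F has_derivative frechet_derivative F (at x)) (at x)" by (rule C_on_SucD[OF _ x])
  then show ?thesis unfolding has_derivative_grad[OF d] .
qed

text \<open>
  Points that are close compared with their distance to the boundary are joined by a segment along
  which the gradient is bounded. Otherwise the boundary point nearest to one of them is within three
  times their distance of both.
\<close>

lemma holder_closure:
  assumes x: "x \<in> closure \<Omega>" and y: "y \<in> closure \<Omega>"
  shows "\<bar>F x - F y\<bar> \<le> 5 * H * dist x y powr \<beta>"
proof -
  have le5: "H * dist x y powr \<beta> \<le> 5 * H * dist x y powr \<beta>" using H by (intro mult_right_mono) auto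
  consider "y \<in> frontier \<Omega>" | "x \<in> frontier \<Omega>" | "x \<in> \<Omega>" "y \<in> \<Omega>"
    using x y op by (auto simp: frontier_def interior_open)
  then show ?thesis
  proof cases
    case 1
    then show ?thesis using boundary[OF x 1] le5 by linarith
  next
    case 2
    then show ?thesis using boundary[OF y 2] le5 by (simp add: dist_commute abs_minus_commute)
  next
    case 3
    show ?thesis
    proof (cases "dist x y < \<delta> x / 2")
      case True
      have d0: "0 < \<delta> x" by (rule delta_pos[OF 3(1)])
      have bd: "norm (F x - F y) \<le> (H * (\<delta> x / 2) powr (\<beta> - 1)) * norm (x - y)"
      proof (rule differentiable_bound)
        show "convex (ball x (\<delta> x / 2))" by simp
        fix w assume w: "w \<in> ball x (\<delta> x / 2)"
        then have w\<Omega>: "w \<in> \<Omega>" using ball_delta[OF 3(1)] d0 by auto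
        show "(F has_derivative (\<lambda>h. h \<bullet> grad F w)) (at w within ball x (\<delta> x / 2))"
          by (rule has_derivative_at_withinI[OF F_derivative[OF w\<Omega>]])
        have "norm (grad F w) \<le> H * \<delta> w powr (\<beta> - 1)" by (rule gradient[OF w\<Omega>])
        also have "\<dots> \<le> H * (\<delta> x / 2) powr (\<beta> - 1)"
          using delta_half[OF w] d0 H \<beta> by (intro mult_left_mono powr_mono2') auto
        finally have g: "norm (grad F w) \<le> H * (\<delta> x / 2) powr (\<beta> - 1)" .
        show "onorm (\<lambda>h. h \<bullet> grad F w) \<le> H * (\<delta> x / 2) powr (\<beta> - 1)"
        proof (rule onorm_bound)
          fix h
          have "\<bar>h \<bullet> grad F w\<bar> \<le> norm h * norm (grad F w)" by (rule Cauchy_Schwarz_ineq2)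
          also have "\<dots> \<le> norm h * (H * (\<delta> x / 2) powr (\<beta> - 1))" by (intro mult_left_mono g) simp
          finally show "norm (h \<bullet> grad F w) \<le> H * (\<delta> x / 2) powr (\<beta> - 1) * norm h" by (simp add: mult_ac)
        qed (use H in simp)
      qed (use True d0 in auto)
      show ?thesis
      proof (cases "x = y")
        case False
        then have t: "0 < dist x y" by simp
        have "(\<delta> x / 2) powr (\<beta> - 1) * dist x y \<le> dist x y powr (\<beta> - 1) * dist x y"
          using t True \<beta> by (intro mult_right_mono powr_mono2') auto
        also have "\<dots> = dist x y powr \<beta>" using t powr_mult_base[of "dist x y" "\<beta> - 1"] by (simp add: mult.commute)
        finally have "H * ((\<delta> x / 2) powr (\<beta> - 1) * dist x y) \<le> H * dist x y powr \<beta>" using H by (rule mult_left_mono)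
        then show ?thesis using bd le5 by (simp add: dist_norm mult.assoc)
      qed simp
    next
      case False
      define t where "t = dist x y"
      obtain x' where x': "x' \<in> frontier \<Omega>" "\<delta> x = dist x x'"
        using infdist_attains_inf[OF frontier_closed ne] by blast
      have d1: "dist x x' \<le> 2 * t" using False x' by (simp add: t_def)
      have d2: "dist y x' \<le> 3 * t" using dist_triangle[of y x' x] d1 by (simp add: t_def dist_commute)
      have t0: "0 \<le> t" by (simp add: t_def)
      have "H * dist x x' powr \<beta> \<le> H * (2 * t powr \<beta>)" "H * dist y x' powr \<beta> \<le> H * (3 * t powr \<beta>)"
        using d1 d2 t0 \<beta> H by (auto intro!: mult_left_mono powr_mult_le)
      moreover note boundary[OF x x'(1)] boundary[OF y x'(1)]
      ultimately have "\<bar>F x - F y\<bar> \<le> H * (2 * t powr \<beta>) + H * (3 * t powr \<beta>)" by linarith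
      then show ?thesis by (simp add: t_def algebra_simps)
    qed
  qed
qed

lemma whitney_ball_sub:
  assumes x: "x \<in> \<Omega>" and c: "c \<in> {0<..1/2}" and y: "y \<in> whitney_ball \<Omega> c x"
  shows "y \<in> ball x (\<delta> x / 2)"
proof -
  have "c * \<delta> x \<le> 1 / 2 * \<delta> x" using c delta_pos[OF x] by (intro mult_right_mono) auto
  then show ?thesis using y dist_compl_eq[OF op ne x] by (simp add: whitney_ball_def)
qed

text \<open>
  Since \<open>c \<le> 1/2\<close>, the Whitney ball has diameter at most \<open>\<delta> x\<close>, and the Hoelder bound controls the
  oscillation on all of it.
\<close>

lemma N_sharp_le:
  assumes c: "c \<in> {0<..1/2}"
  shows "N_sharp \<Omega> \<alpha> \<beta> c F \<xi> \<le> ennreal (5 * H)"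
  unfolding N_sharp_def
proof (rule SUP_least)
  fix x assume "x \<in> cone \<Omega> \<alpha> \<xi>"
  then have x: "x \<in> \<Omega>" by (simp add: cone_def)
  have d0: "0 < \<delta> x" by (rule delta_pos[OF x])
  have dc: "dist_compl \<Omega> x = \<delta> x" by (rule dist_compl_eq[OF op ne x])
  let ?B = "whitney_ball \<Omega> c x"
  have B: "?B = ball x (c * \<delta> x)" by (simp add: whitney_ball_def dc)
  have r: "0 < c * \<delta> x" using c d0 by simp
  have sub: "cball x (c * \<delta> x) \<subseteq> \<Omega>"
  proof -
    have "c * \<delta> x \<le> 1 / 2 * \<delta> x" using c d0 by (intro mult_right_mono) auto
    then have "c * \<delta> x < \<delta> x" using d0 by simp
    then have "cball x (c * \<delta> x) \<subseteq> ball x (\<delta> x)" by (intro subsetI) simp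
    then show ?thesis using ball_delta[OF x] by blast
  qed
  have cont: "continuous_on (cball x (c * \<delta> x)) F"
    by (rule continuous_on_subset[OF holder_imp_continuous_on[OF \<beta>(1) holder_closure]])
      (use sub closure_subset in auto)
  have int: "set_integrable lebesgue ?B F"
  proof -
    have "set_integrable lborel (cball x (c * \<delta> x)) F"
      using borel_integrable_compact[OF compact_cball cont] by (simp add: set_integrable_def)
    then have "set_integrable lborel ?B F" by (rule set_integrable_subset) (auto simp: B)
    then show ?thesis unfolding set_integrable_def
      by (subst integrable_completion) (auto intro: borel_measurable_integrable)
  qed
  have pos: "0 < measure lebesgue ?B" unfolding B using content_ball_pos[OF r, of x] by simp
  have "(SUP y\<in>?B. ennreal \<bar>F y - mean lebesgue ?B F\<bar>) \<le> ennreal (5 * H * \<delta> x powr \<beta>)"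
  proof (intro SUP_least ennreal_leI)
    fix y assume y: "y \<in> ?B"
    have "\<bar>F y - mean lebesgue ?B F\<bar> = \<bar>mean lebesgue ?B F - F y\<bar>" by simp
    also have "\<dots> \<le> mean lebesgue ?B (\<lambda>z. \<bar>F z - F y\<bar>)"
      by (rule mean_diff_le[OF _ pos int]) (simp add: B)
    also have "\<dots> \<le> 5 * H * \<delta> x powr \<beta>"
    proof (rule mean_le_const[OF _ pos])
      fix z assume z: "z \<in> ?B"
      have "z \<in> closure \<Omega>" "y \<in> closure \<Omega>"
        using y z sub closure_subset unfolding B by fastforce+
      then have "\<bar>F z - F y\<bar> \<le> 5 * H * dist z y powr \<beta>" by (rule holder_closure)
      also have "\<dots> \<le> 5 * H * \<delta> x powr \<beta>"
      proof (intro mult_left_mono powr_mono2)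
        have "dist z y \<le> dist x z + dist x y" using dist_triangle[of z y x] by (simp add: dist_commute)
        then show "dist z y \<le> \<delta> x" using whitney_ball_sub[OF x c y] whitney_ball_sub[OF x c z] by simp
      qed (use \<beta> H in auto)
      finally show "\<bar>F z - F y\<bar> \<le> 5 * H * \<delta> x powr \<beta>" .
    qed (use H in \<open>auto simp: B\<close>)
    finally show "\<bar>F y - mean lebesgue ?B F\<bar> \<le> 5 * H * \<delta> x powr \<beta>" .
  qed
  then have "ennreal (dist_compl \<Omega> x powr - \<beta>) * (SUP y\<in>?B. ennreal \<bar>F y - mean lebesgue ?B F\<bar>)
      \<le> ennreal (\<delta> x powr - \<beta>) * ennreal (5 * H * \<delta> x powr \<beta>)"
    unfolding dc by (intro mult_left_mono) auto
  also have "\<dots> = ennreal (5 * H)"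
    using H d0 by (simp add: ennreal_mult[symmetric] powr_minus)
  finally show "ennreal (dist_compl \<Omega> x powr - \<beta>) * (SUP y\<in>?B. ennreal \<bar>F y - mean lebesgue ?B F\<bar>) \<le> ennreal (5 * H)" .
qed

lemma gradient_le: "x \<in> \<Omega> \<Longrightarrow> ennreal (dist_compl \<Omega> x powr (1 - \<beta>) * norm (grad F x)) \<le> ennreal H"
proof (rule ennreal_leI)
  assume x: "x \<in> \<Omega>"
  have d0: "0 < \<delta> x" by (rule delta_pos[OF x])
  have "\<delta> x powr (1 - \<beta>) * norm (grad F x) \<le> \<delta> x powr (1 - \<beta>) * (H * \<delta> x powr (\<beta> - 1))"
    by (intro mult_left_mono gradient x) simp
  also have "\<dots> = H * \<delta> x powr ((1 - \<beta>) + (\<beta> - 1))" by (simp only: powr_add mult_ac)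
  also have "\<dots> = H" using d0 by simp
  finally show "dist_compl \<Omega> x powr (1 - \<beta>) * norm (grad F x) \<le> H"
    by (simp add: dist_compl_eq[OF op ne x])
qed

text \<open>
  Since \<open>c \<le> 1/2\<close>, the distance to the boundary on a Whitney ball is at least half of that at its
  centre, so taking the supremum of the gradient over the ball costs a factor \<open>2\<close>. This leaves the
  integral of a power of the distance.
\<close>

lemma carleson_le:
  assumes dim: "DIM('a) = n + 1" and c: "c \<in> {0<..1/2}"
    and K: "\<And>\<xi> r. \<xi> \<in> frontier \<Omega> \<Longrightarrow> r > 0 \<Longrightarrow>
      (\<integral>\<^sup>+x\<in>ball \<xi> r - frontier \<Omega>. ennreal (\<delta> x powr (\<beta> + s - DIM('a))) \<partial>lborel) \<le> ennreal (K * r powr (s + \<beta>))"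
    and K0: "0 \<le> K" and \<xi>: "\<xi> \<in> frontier \<Omega>"
  shows "carleson n \<Omega> s \<beta> c (grad F) \<xi> \<le> ennreal (2 * K * H)"
  unfolding carleson_def
proof (rule SUP_least)
  fix r :: real assume "r \<in> {0<..}"
  then have r: "r > 0" by simp
  let ?I = "\<lambda>x. (SUP y\<in>whitney_ball \<Omega> c x. ennreal (norm (grad F y))) *
      ennreal (dist_compl \<Omega> x powr (s - real n))"
  have "(\<integral>\<^sup>+x\<in>ball \<xi> r \<inter> \<Omega>. ?I x \<partial>lebesgue) = (\<integral>\<^sup>+x\<in>ball \<xi> r \<inter> \<Omega>. ?I x \<partial>lborel)"
    by (rule nn_integral_completion)
  also have "\<dots> \<le> (\<integral>\<^sup>+x. ennreal (2 * H) * (ennreal (\<delta> x powr (\<beta> + s - DIM('a))) * indicator (ball \<xi> r - frontier \<Omega>) x) \<partial>lborel)"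
  proof (rule nn_integral_mono)
    fix x
    show "?I x * indicator (ball \<xi> r \<inter> \<Omega>) x
      \<le> ennreal (2 * H) * (ennreal (\<delta> x powr (\<beta> + s - DIM('a))) * indicator (ball \<xi> r - frontier \<Omega>) x)"
    proof (cases "x \<in> ball \<xi> r \<inter> \<Omega>")
      case True
      then have x: "x \<in> \<Omega>" by simp
      have d0: "0 < \<delta> x" by (rule delta_pos[OF x])
      have "(SUP y\<in>whitney_ball \<Omega> c x. ennreal (norm (grad F y))) \<le> ennreal (2 * H * \<delta> x powr (\<beta> - 1))"
      proof (intro SUP_least ennreal_leI)
        fix y assume y: "y \<in> whitney_ball \<Omega> c x"
        have yb: "y \<in> ball x (\<delta> x / 2)" by (rule whitney_ball_sub[OF x c y])
        then have y\<Omega>: "y \<in> \<Omega>" using ball_delta[OF x] d0 by auto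
        have "norm (grad F y) \<le> H * \<delta> y powr (\<beta> - 1)" by (rule gradient[OF y\<Omega>])
        also have "\<dots> \<le> H * (\<delta> x / 2) powr (\<beta> - 1)"
          using delta_half[OF yb] d0 H \<beta> by (intro mult_left_mono powr_mono2') auto
        also have "\<dots> \<le> H * (2 * \<delta> x powr (\<beta> - 1))"
          using powr_half_le[of \<beta> "\<delta> x"] \<beta> d0 H by (intro mult_left_mono) auto
        finally show "norm (grad F y) \<le> 2 * H * \<delta> x powr (\<beta> - 1)" by simp
      qed
      then have "?I x \<le> ennreal (2 * H * \<delta> x powr (\<beta> - 1)) * ennreal (\<delta> x powr (s - real n))"
        unfolding dist_compl_eq[OF op ne x] by (rule mult_right_mono) simp
      also have "\<dots> = ennreal (2 * H * (\<delta> x powr (\<beta> - 1) * \<delta> x powr (s - real n)))"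
        using H by (simp add: ennreal_mult[symmetric] mult_ac)
      also have "\<delta> x powr (\<beta> - 1) * \<delta> x powr (s - real n) = \<delta> x powr (\<beta> + s - DIM('a))"
        by (simp add: powr_add[symmetric] dim algebra_simps)
      also have "ennreal (2 * H * \<delta> x powr (\<beta> + s - DIM('a))) = ennreal (2 * H) * ennreal (\<delta> x powr (\<beta> + s - DIM('a)))"
        using H by (intro ennreal_mult) auto
      finally show ?thesis using True frontier_disjoint[OF x] by simp
    qed simp
  qed
  also have "\<dots> = ennreal (2 * H) * (\<integral>\<^sup>+x\<in>ball \<xi> r - frontier \<Omega>. ennreal (\<delta> x powr (\<beta> + s - DIM('a))) \<partial>lborel)"
  proof (rule nn_integral_cmult, intro borel_measurable_times_ennreal borel_measurable_indicator)
    have "\<delta> \<in> borel_measurable borel"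
      by (intro borel_measurable_continuous_onI continuous_on_infdist continuous_on_id)
    then show "(\<lambda>x. ennreal (\<delta> x powr (\<beta> + s - DIM('a)))) \<in> borel_measurable lborel" by measurable
  qed simp
  also have "\<dots> \<le> ennreal (2 * H) * ennreal (K * r powr (s + \<beta>))"
    by (intro mult_left_mono K \<xi> r) simp
  finally have "ennreal (1 / r powr (s + \<beta>)) *
    (\<integral>\<^sup>+x\<in>ball \<xi> r \<inter> \<Omega>. ?I x \<partial>lebesgue)
    \<le> ennreal (1 / r powr (s + \<beta>)) * (ennreal (2 * H) * ennreal (K * r powr (s + \<beta>)))"
    by (rule mult_left_mono) simp
  also have "\<dots> = ennreal (2 * K * H)"
    using H K0 r by (simp add: ennreal_mult[symmetric])
  finally show "ennreal (1 / r powr (s + \<beta>)) *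
    (\<integral>\<^sup>+x\<in>ball \<xi> r \<inter> \<Omega>. ?I x \<partial>lebesgue) \<le> ennreal (2 * K * H)" .
qed

lemma F_continuous: "continuous_on (closure \<Omega>) F"
  by (rule holder_imp_continuous_on[OF \<beta>(1) holder_closure])

lemma F_Lip: "F \<in> Lip \<beta> (closure \<Omega>)"
  using holder_closure Lip_iff_holder[OF \<beta>(1)] by blast

lemma nontangential:
  assumes \<xi>: "\<xi> \<in> frontier \<Omega>" and f: "f \<xi> = F \<xi>"
  shows "nontangential_limit_at \<Omega> F f \<xi>"
  unfolding nontangential_limit_at_def
proof (intro exI[of _ 1] conjI allI impI)
  fix X :: "nat \<Rightarrow> 'a"
  assume X: "(\<forall>k. X k \<in> cone \<Omega> 1 \<xi>) \<and> X \<longlonglongrightarrow> \<xi>"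
  then have "X k \<in> closure \<Omega>" for k using closure_subset by (auto simp: cone_def)
  moreover have "\<xi> \<in> closure \<Omega>" using \<xi> by (simp add: frontier_def)
  ultimately have "(\<lambda>k. F (X k)) \<longlonglongrightarrow> F \<xi>"
    using continuous_on_tendsto_compose[OF F_continuous, of X \<xi> sequentially] X by simp
  then show "(\<lambda>k. F (X k)) \<longlonglongrightarrow> f \<xi>" by (simp add: f)
qed simp

lemma controlled_extension:
  assumes dim: "DIM('a) = n + 1"
    and K: "\<And>\<xi> r. \<xi> \<in> frontier \<Omega> \<Longrightarrow> r > 0 \<Longrightarrow>
      (\<integral>\<^sup>+x\<in>ball \<xi> r - frontier \<Omega>. ennreal (\<delta> x powr (\<beta> + s - DIM('a))) \<partial>lborel) \<le> ennreal (K * r powr (s + \<beta>))"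
    and K0: "0 \<le> K"
    and H6: "ennreal (6 * H) \<le> ennreal C * campanato_norm s \<beta> \<Omega> f"
    and HK: "ennreal (2 * K * H) \<le> ennreal C * campanato_norm s \<beta> \<Omega> f"
    and ae: "AE \<xi> in surface_measure s \<Omega>. f \<xi> = F \<xi>"
    and lip: "f \<in> Lip \<beta> (frontier \<Omega>) \<Longrightarrow> \<forall>\<xi>\<in>frontier \<Omega>. F \<xi> = f \<xi>"
  shows "controlled_extension n s \<Omega> \<alpha> \<beta> C f F"
  unfolding controlled_extension_def
proof (intro conjI ballI impI smooth F_Lip F_continuous)
  have "AE \<xi> in surface_measure s \<Omega>. \<xi> \<in> frontier \<Omega>"
    by (rule AE_I2) (simp add: surface_measure_def space_restrict_space)
  with ae show "AE \<xi> in surface_measure s \<Omega>. nontangential_limit_at \<Omega> F f \<xi>"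
    by eventually_elim (rule nontangential)
  fix c :: real assume c: "c \<in> {0<..1/2}"
  have "(SUP \<xi>\<in>frontier \<Omega>. N_sharp \<Omega> \<alpha> \<beta> c F \<xi>) +
     (SUP x\<in>\<Omega>. ennreal (dist_compl \<Omega> x powr (1 - \<beta>) * norm (grad F x))) \<le> ennreal (5 * H) + ennreal H"
    by (intro add_mono SUP_least N_sharp_le[OF c] gradient_le)
  also have "\<dots> = ennreal (6 * H)" using H by (simp add: ennreal_plus[symmetric] del: ennreal_plus)
  also note H6
  finally show "(SUP \<xi>\<in>frontier \<Omega>. N_sharp \<Omega> \<alpha> \<beta> c F \<xi>) +
     (SUP x\<in>\<Omega>. ennreal (dist_compl \<Omega> x powr (1 - \<beta>) * norm (grad F x)))
     \<le> ennreal C * campanato_norm s \<beta> \<Omega> f" .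
  have "(SUP \<xi>\<in>frontier \<Omega>. carleson n \<Omega> s \<beta> c (grad F) \<xi>) \<le> ennreal (2 * K * H)"
    by (intro SUP_least carleson_le[OF dim c K K0])
  also note HK
  finally show "(SUP \<xi>\<in>frontier \<Omega>. carleson n \<Omega> s \<beta> c (grad F) \<xi>)
     \<le> ennreal C * campanato_norm s \<beta> \<Omega> f" .
qed (use lip in auto)

end

section \<open>Domains with Ahlfors regular boundary\<close>

lemma dist_le_ediam: "x \<in> E \<Longrightarrow> y \<in> E \<Longrightarrow> ennreal (dist x y) \<le> ediam E"
  unfolding ediam_def by (intro SUP_upper2[of x] SUP_upper2[of y]) auto

text \<open>
  For radii beyond the diameter the set is compact and hence of finite measure, being covered by
  finitely many balls of a fixed radius \<open>\<rho>\<close> below the diameter. As \<open>r\<close> exceeds \<open>\<rho>\<close>, that measure is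
  at most a multiple of \<open>r powr s\<close>.
\<close>

lemma ahlfors_regular_upper:
  fixes E :: "'a::euclidean_space set"
  assumes reg: "ahlfors_regular s C0 E" and s: "0 < s"
  shows "\<exists>A>0. \<forall>x\<in>E. \<forall>r>0. emeasure (hausdorff s) (E \<inter> ball x r) \<le> ennreal (A * r powr s)"
proof (cases "ediam E = 0")
  case True
  have "emeasure (hausdorff s) (E \<inter> ball x r) = 0" if "x \<in> E" for x r
  proof -
    have "y = x" if "y \<in> E" for y
      using dist_le_ediam[OF that \<open>x \<in> E\<close>] True by (simp add: ennreal_eq_0_iff)
    then have "E \<inter> ball x r \<subseteq> {x}" by blast
    then have "emeasure (hausdorff s) (E \<inter> ball x r) \<le> emeasure (hausdorff s) {x}"
      by (rule emeasure_mono) (auto intro!: closed_sets_hausdorff)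
    then show ?thesis by (simp add: hausdorff_singleton)
  qed
  then show ?thesis by (intro exI[of _ 1]) auto
next
  case False
  have C0: "C0 > 0" and cl: "closed E" using reg by (auto simp: ahlfors_regular_def)
  have up: "emeasure (hausdorff s) (E \<inter> ball x r) \<le> ennreal (C0 * r powr s)"
    if "x \<in> E" "r > 0" "ennreal r < ediam E" for x r
    using reg that by (auto simp: ahlfors_regular_def)
  obtain \<rho> where \<rho>: "\<rho> > 0" "ennreal \<rho> < ediam E"
  proof -
    have "0 < ediam E" using False by (simp add: zero_less_iff_neq_zero)
    then obtain e where e: "0 < e" "e < ediam E" using dense by blast
    have "e < top" using e by (metis less_top_ennreal order_less_trans top.not_eq_extremum less_le_trans top_greatest)
    then show ?thesis using that[of "enn2real e"] e by (simp add: enn2real_positive_iff)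
  qed
  \<comment> \<open>an unbounded \<open>E\<close> has no radii beyond its diameter, so its value is arbitrary\<close>
  define Mb where "Mb = (if bounded E then enn2real (emeasure (hausdorff s) E) else 0)"
  have fin: "emeasure (hausdorff s) E < top" if b: "bounded E"
  proof -
    have "compact E" using b cl by (simp add: compact_eq_bounded_closed)
    then obtain T where T: "T \<subseteq> E" "finite T" "E \<subseteq> (\<Union>x\<in>T. ball x \<rho>)"
      using compactE_image[of E E "\<lambda>x. ball x \<rho>"] \<rho> by (metis UN_I centre_in_ball open_ball subsetI)
    have E_eq: "E = (\<Union>x\<in>T. E \<inter> ball x \<rho>)" using T by auto
    have "(\<lambda>x. E \<inter> ball x \<rho>) ` T \<subseteq> sets (hausdorff s)"
      using cl by (auto intro!: borel_sets_hausdorff)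
    from emeasure_subadditive_finite[OF T(2) this]
    have "emeasure (hausdorff s) E \<le> (\<Sum>x\<in>T. emeasure (hausdorff s) (E \<inter> ball x \<rho>))"
      unfolding E_eq[symmetric] .
    also have "\<dots> \<le> (\<Sum>x\<in>T. ennreal (C0 * \<rho> powr s))"
      by (intro sum_mono up) (use T \<rho> in auto)
    also have "\<dots> < top" by (simp add: ennreal_mult_less_top of_nat_less_top)
    finally show ?thesis .
  qed
  define A where "A = max C0 (Mb / \<rho> powr s)"
  have A: "A > 0" by (rule less_le_trans[OF C0]) (simp add: A_def)
  show ?thesis
  proof (intro exI[of _ A] conjI A ballI allI impI)
    fix x r assume x: "x \<in> E" and r: "(0::real) < r"
    show "emeasure (hausdorff s) (E \<inter> ball x r) \<le> ennreal (A * r powr s)"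
    proof (cases "ennreal r < ediam E")
      case True
      have "C0 * r powr s \<le> A * r powr s" by (intro mult_right_mono) (auto simp: A_def)
      then show ?thesis using up[OF x r True] by (meson ennreal_leI order_trans)
    next
      case False
      have "dist x y \<le> r" if "y \<in> E" for y
      proof -
        have "ennreal (dist x y) \<le> ennreal r"
          using dist_le_ediam[OF x that] False by simp
        then show ?thesis using r by (simp add: ennreal_le_iff)
      qed
      then have b: "bounded E" by (auto simp: bounded_def)
      have "ennreal \<rho> < ennreal r" using \<rho>(2) False by simp
      then have \<rho>r: "\<rho> \<le> r" using r by (simp add: ennreal_less_iff \<rho> less_imp_le)
      have "emeasure (hausdorff s) (E \<inter> ball x r) \<le> emeasure (hausdorff s) E"
        by (rule emeasure_mono) (use cl closed_sets_hausdorff in auto)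
      also have "\<dots> = ennreal Mb" using fin[OF b] b by (simp add: Mb_def)
      also have "\<dots> \<le> ennreal (A * r powr s)"
      proof (rule ennreal_leI)
        have "Mb = Mb / \<rho> powr s * \<rho> powr s" using \<rho> by simp
        also have "\<dots> \<le> A * r powr s"
        proof (rule mult_mono)
          show "Mb / \<rho> powr s \<le> A" by (simp add: A_def)
          show "\<rho> powr s \<le> r powr s" using \<rho> \<rho>r s by (intro powr_mono2) auto
        qed (use A in auto)
        finally show "Mb \<le> A * r powr s" .
      qed
      finally show ?thesis .
    qed
  qed
qed

lemma ahlfors_measure_hausdorff:
  fixes E :: "'a::euclidean_space set"
  assumes reg: "ahlfors_regular s C0 E" and s: "0 < s" and ne: "E \<noteq> {}"
  shows "\<exists>A a. ahlfors_measure E s A a (restrict_space (hausdorff s) E)"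
proof -
  have C0: "C0 > 0" and cl: "closed E" using reg by (auto simp: ahlfors_regular_def)
  obtain A where A: "A > 0" "\<And>x r. x \<in> E \<Longrightarrow> r > 0 \<Longrightarrow> emeasure (hausdorff s) (E \<inter> ball x r) \<le> ennreal (A * r powr s)"
    using ahlfors_regular_upper[OF reg s] by blast
  have em: "emeasure (restrict_space (hausdorff s) E) (E \<inter> ball x r) = emeasure (hausdorff s) (E \<inter> ball x r)" for x r
    by (rule emeasure_restrict_space) (use closed_sets_hausdorff[OF cl] in auto)
  have "ahlfors_measure E s A (inverse C0) (restrict_space (hausdorff s) E)"
  proof
    show "(\<lambda>x. x) \<in> borel_measurable (restrict_space (hausdorff s) E)"
      by (rule measurable_restrict_space1[OF measurable_hausdorff_borel])
    fix x r assume x: "x \<in> E" and r: "(0::real) < r"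
    show "emeasure (restrict_space (hausdorff s) E) (E \<inter> ball x r) \<le> ennreal (A * r powr s)"
      using A(2)[OF x r] by (simp add: em)
    show "ennreal (inverse C0 * r powr s) \<le> emeasure (restrict_space (hausdorff s) E) (E \<inter> ball x r) \<or>
      (\<forall>y\<in>E. \<forall>z\<in>E. dist y z \<le> r)"
    proof (cases "ennreal r < ediam E")
      case True
      then show ?thesis using reg x r by (simp add: em ahlfors_regular_def)
    next
      case False
      have "dist y z \<le> r" if "y \<in> E" "z \<in> E" for y z
      proof -
        have "ennreal (dist y z) \<le> ennreal r"
          using dist_le_ediam[OF that] False by simp
        then show ?thesis using r by (simp add: ennreal_le_iff)
      qed
      then show ?thesis by blast
    qed
  qed (use cl ne s A C0 in \<open>auto simp: space_restrict_space\<close>)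
  then show ?thesis by blast
qed

text \<open>
  If \<open>s < n\<close>, the domain is the complement of a regular set \<open>E\<close>, and the boundary is all of \<open>E\<close>
  because \<open>E\<close> has no interior.
\<close>

lemma AR_with_frontier:
  fixes \<Omega> :: "'a::euclidean_space set"
  assumes AR: "AR_with n s C0 cs \<Omega>" and dim: "DIM('a) = n + 1" and s: "0 < s" "s \<le> real n"
  shows "open \<Omega>" "ahlfors_regular s C0 (frontier \<Omega>)"
proof -
  have "open \<Omega> \<and> ahlfors_regular s C0 (frontier \<Omega>)"
  proof (cases "s = real n")
    case True
    then show ?thesis using AR by (simp add: AR_with_def)
  next
    case False
    then obtain E where E: "ahlfors_regular s C0 E" "\<Omega> = - E" using AR by (auto simp: AR_with_def)
    have cl: "closed E" using E by (simp add: ahlfors_regular_def)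
    have "interior E = {}"
    proof (cases "E = {}")
      case False
      then obtain A a where "ahlfors_measure E s A a (restrict_space (hausdorff s) E)"
        using ahlfors_measure_hausdorff[OF E(1) s(1)] by blast
      then show ?thesis using ahlfors_measure.empty_interior dim s(2) by fastforce
    qed simp
    then have "frontier E = E" using cl by (simp add: frontier_def)
    then have "frontier \<Omega> = E" by (simp add: E(2) frontier_complement)
    then show ?thesis using E cl by (simp add: open_Compl)
  qed
  then show "open \<Omega>" "ahlfors_regular s C0 (frontier \<Omega>)" by auto
qed

lemma campanato_oscillation:
  assumes fin: "campanato_norm s \<beta> \<Omega> f < top" and x: "x \<in> frontier \<Omega>" and r: "0 < r"
    and yz: "y \<in> frontier \<Omega>" "z \<in> frontier \<Omega>" "r < 2 * dist y z"
  shows "mean (surface_measure s \<Omega>) (frontier \<Omega> \<inter> ball x r)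
      (\<lambda>y. \<bar>f y - mean (surface_measure s \<Omega>) (frontier \<Omega> \<inter> ball x r) f\<bar>)
    \<le> enn2real (campanato_norm s \<beta> \<Omega> f) * r powr \<beta>" (is "?m \<le> ?N * _")
proof -
  have "ennreal r < ennreal (2 * dist y z)" using yz(3) r by (simp add: ennreal_less_iff)
  also have "\<dots> = 2 * ennreal (dist y z)" by (simp add: ennreal_mult)
  also have "\<dots> \<le> 2 * ediam (frontier \<Omega>)" by (intro mult_left_mono dist_le_ediam yz) simp
  finally have adm: "r \<in> {r. 0 < r \<and> ennreal r < 2 * ediam (frontier \<Omega>)}" using r by simp
  have "ennreal (1 / r powr \<beta> * ?m) \<le> campanato_norm s \<beta> \<Omega> f"
    unfolding campanato_norm_def
    by (rule SUP_upper2[OF x], rule SUP_upper2[OF adm]) (simp add: Let_def Int_commute)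
  also have "\<dots> = ennreal ?N" using fin by simp
  finally have "1 / r powr \<beta> * ?m \<le> ?N" by (simp add: ennreal_le_iff)
  then show ?thesis using r by (simp add: divide_le_eq mult.commute)
qed

text \<open>
  If the boundary is empty or a single point, no radius is admissible and the Campanato norm is \<open>0\<close>
  for every function; a constant is then an extension without gradient. In the remaining case the
  lower bound makes \<open>\<nu>\<close> non-trivial, and the weighted averages are defined.
\<close>

lemma domain_extension:
  fixes \<Omega> :: "'a::euclidean_space set"
  assumes op: "open \<Omega>" and reg: "ahlfors_regular s C0 (frontier \<Omega>)" and dim: "DIM('a) = n + 1"
    and s: "0 < s" and \<beta>: "0 < \<beta>" "\<beta> < 1"
  shows "\<exists>C>0. \<forall>f\<in>campanato s \<beta> \<Omega>. \<exists>F. controlled_extension n s \<Omega> \<alpha> \<beta> C f F"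
proof (cases "frontier \<Omega> = {}")
  case True
  then have ae: "AE \<xi> in surface_measure s \<Omega>. P \<xi>" for P
    by (intro AE_I2) (simp add: surface_measure_def space_restrict_space)
  have lip: "(\<lambda>_. 0) \<in> Lip \<beta> (closure \<Omega>)"
    unfolding Lip_iff_holder[OF \<beta>(1)] by (intro exI[of _ 0]) simp
  have "controlled_extension n s \<Omega> \<alpha> \<beta> 1 f (\<lambda>_. 0)" for f
    unfolding controlled_extension_def
    using True lip ae by (auto simp: bot_ennreal intro!: SUP_least)
  then show ?thesis by (intro exI[of _ 1]) auto
next
  case ne: False
  define E where "E = frontier \<Omega>"
  define \<nu> where "\<nu> = surface_measure s \<Omega>"
  obtain A a where "ahlfors_measure E s A a (restrict_space (hausdorff s) E)"
    using ahlfors_measure_hausdorff[OF reg s ne] unfolding E_def by auto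
  then interpret ahlfors_measure E s A a \<nu> by (simp add: \<nu>_def surface_measure_def E_def)
  obtain K3 where K3: "K3 > 0" "\<And>\<xi> r. \<xi> \<in> frontier \<Omega> \<Longrightarrow> r > 0 \<Longrightarrow>
    (\<integral>\<^sup>+x\<in>ball \<xi> r - frontier \<Omega>. ennreal (infdist x (frontier \<Omega>) powr (\<beta> + s - DIM('a))) \<partial>lborel)
      \<le> ennreal (K3 * r powr (s + \<beta>))"
    using nn_integral_infdist_powr[OF \<beta>] unfolding E_def by auto
  consider p where "E = {p}" | y0 z0 where "y0 \<in> E" "z0 \<in> E" "y0 \<noteq> z0"
    using nonempty by blast
  then show ?thesis
  proof cases
    case (1 p)
    have "controlled_extension n s \<Omega> \<alpha> \<beta> 1 f (\<lambda>_. f p)" for f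
    proof -
      interpret e: smooth_extension \<Omega> "\<lambda>_. f p" \<beta> 0
        using op ne 1 \<beta> by unfold_locales (auto simp: E_def)
      have "AE \<xi> in surface_measure s \<Omega>. f \<xi> = f p"
        by (rule AE_I2) (use space_nu 1 in \<open>simp add: \<nu>_def\<close>)
      then show ?thesis
        using 1 K3(1) by (intro e.controlled_extension[OF dim K3(2)]) (auto simp: E_def)
    qed
    then show ?thesis by (intro exI[of _ 1]) auto
  next
    case (2 y0 z0)
    obtain K where K: "0 < K" and ext: "\<forall>f N. campanato_function E s A a \<nu> f \<beta> N \<longrightarrow>
      (\<exists>F. smooth_on F (- E) \<and>
        (\<forall>x. x \<notin> E \<longrightarrow> norm (grad F x) \<le> K * N * infdist x E powr (\<beta> - 1)) \<and>
        (\<forall>x. \<forall>\<xi>\<in>E. \<bar>F x - F \<xi>\<bar> \<le> K * N * dist x \<xi> powr \<beta>) \<and>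
        (AE x in \<nu>. f x = F x) \<and> (continuous_on E f \<longrightarrow> (\<forall>x\<in>E. F x = f x)))"
      using campanato_extension[OF \<beta> 2] by blast
    define C where "C = 6 * K + 2 * K3 * K"
    have C: "C > 0" using K K3(1) by (simp add: C_def add_pos_pos)
    have CK: "6 * K \<le> C" "2 * K3 * K \<le> C" using K K3(1) by (auto simp: C_def)
    have "\<exists>F. controlled_extension n s \<Omega> \<alpha> \<beta> C f F" if f: "f \<in> campanato s \<beta> \<Omega>" for f
    proof -
      define N where "N = enn2real (campanato_norm s \<beta> \<Omega> f)"
      have fin: "campanato_norm s \<beta> \<Omega> f < top" and loc: "locally_integrable \<nu> f"
        using f by (auto simp: campanato_def \<nu>_def)
      have norm_eq: "campanato_norm s \<beta> \<Omega> f = ennreal N" and N0: "0 \<le> N"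
        using fin by (auto simp: N_def)
      have "campanato_function E s A a \<nu> f \<beta> N"
      proof (unfold_locales)
        show "f \<in> borel_measurable \<nu>" using loc by (simp add: locally_integrable_def)
        show "set_integrable \<nu> (E \<inter> ball x r) f" for x r
        proof -
          have "compact (E \<inter> cball x r)" using closed by (intro closed_Int_compact) auto
          then have "set_integrable \<nu> (E \<inter> cball x r) f"
            using loc by (simp add: locally_integrable_def space_nu)
          then show ?thesis by (rule set_integrable_subset) auto
        qed
        show "mean \<nu> (E \<inter> ball x r) (\<lambda>y. \<bar>f y - mean \<nu> (E \<inter> ball x r) f\<bar>) \<le> N * r powr \<beta>"
          if "x \<in> E" "0 < r" "\<exists>y\<in>E. \<exists>z\<in>E. r < 2 * dist y z" for x r
          using that campanato_oscillation[OF fin] unfolding N_def \<nu>_def E_def by blast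
      qed (use \<beta> N0 2 in auto)
      from ext[rule_format, OF this] obtain F where F: "smooth_on F (- E)"
          "\<forall>x. x \<notin> E \<longrightarrow> norm (grad F x) \<le> K * N * infdist x E powr (\<beta> - 1)"
          "\<forall>x. \<forall>\<xi>\<in>E. \<bar>F x - F \<xi>\<bar> \<le> K * N * dist x \<xi> powr \<beta>"
          "AE x in \<nu>. f x = F x" "continuous_on E f \<longrightarrow> (\<forall>x\<in>E. F x = f x)"
        by blast
      have sub: "\<Omega> \<subseteq> - E" using op by (auto simp: E_def frontier_def interior_open)
      interpret e: smooth_extension \<Omega> F \<beta> "K * N"
      proof
        show "smooth_on F \<Omega>" using F(1) C_on_subset[OF _ sub] by (simp add: smooth_on_def)
        show "norm (grad F x) \<le> K * N * infdist x (frontier \<Omega>) powr (\<beta> - 1)" if "x \<in> \<Omega>" for x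
          using F(2) sub that by (auto simp: E_def)
        show "\<bar>F x - F \<xi>\<bar> \<le> K * N * dist x \<xi> powr \<beta>" if "\<xi> \<in> frontier \<Omega>" for x \<xi>
          using F(3) that by (auto simp: E_def)
      qed (use op ne \<beta> K N0 in auto)
      have CN: "ennreal C * campanato_norm s \<beta> \<Omega> f = ennreal (C * N)"
        using C by (simp add: norm_eq ennreal_mult')
      have "controlled_extension n s \<Omega> \<alpha> \<beta> C f F"
      proof (rule e.controlled_extension[OF dim K3(2)])
        show "ennreal (6 * (K * N)) \<le> ennreal C * campanato_norm s \<beta> \<Omega> f"
          using mult_right_mono[OF CK(1) N0] unfolding CN by (simp add: ennreal_leI mult.assoc)
        show "ennreal (2 * K3 * (K * N)) \<le> ennreal C * campanato_norm s \<beta> \<Omega> f"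
          using mult_right_mono[OF CK(2) N0] unfolding CN by (simp add: ennreal_leI mult.assoc)
        show "AE \<xi> in surface_measure s \<Omega>. f \<xi> = F \<xi>" using F(4) unfolding \<nu>_def .
        assume "f \<in> Lip \<beta> (frontier \<Omega>)"
        then have "continuous_on E f"
          using holder_imp_continuous_on[OF \<beta>(1)] unfolding Lip_iff_holder[OF \<beta>(1)] E_def by blast
        then show "\<forall>\<xi>\<in>frontier \<Omega>. F \<xi> = f \<xi>" using F(5) by (simp add: E_def)
      qed (use K3(1) in auto)
      then show ?thesis by blast
    qed
    then show ?thesis using C by blast
  qed
qed

theorem theorem1p5:
  fixes n :: nat and s C0 cs :: real
  assumes "DIM('a::euclidean_space) = n + 1" and "n \<ge> 1" and "0 < s" and "s \<le> real n"
  shows "\<exists>c0\<in>{0<..1/2}. \<forall>\<Omega> :: 'a set. AR_with n s C0 cs \<Omega> \<longrightarrow>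
    (\<forall>\<alpha>>0. \<forall>\<beta>\<in>{0<..<1}. \<exists>C>0. \<forall>f\<in>campanato s \<beta> \<Omega>. \<exists>F :: 'a \<Rightarrow> real.
      (\<forall>c\<in>{0<..c0}.
         smooth_on F \<Omega> \<and>
         (SUP \<xi>\<in>frontier \<Omega>. N_sharp \<Omega> \<alpha> \<beta> c F \<xi>) +
           (SUP x\<in>\<Omega>. ennreal (dist_compl \<Omega> x powr (1 - \<beta>) * norm (grad F x)))
           \<le> ennreal C * campanato_norm s \<beta> \<Omega> f \<and>
         (SUP \<xi>\<in>frontier \<Omega>. carleson n \<Omega> s \<beta> c (grad F) \<xi>)
           \<le> ennreal C * campanato_norm s \<beta> \<Omega> f \<and>
         (AE \<xi> in surface_measure s \<Omega>. nontangential_limit_at \<Omega> F f \<xi>)) \<and>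
      (f \<in> Lip \<beta> (frontier \<Omega>) \<longrightarrow>
         F \<in> Lip \<beta> (closure \<Omega>) \<and> continuous_on (closure \<Omega>) F \<and>
         (\<forall>\<xi>\<in>frontier \<Omega>. F \<xi> = f \<xi>)))"
proof -
  have key: "\<exists>C>0. \<forall>f\<in>campanato s \<beta> \<Omega>. \<exists>F. controlled_extension n s \<Omega> \<alpha> \<beta> C f F"
    if "AR_with n s C0 cs \<Omega>" and "\<beta> \<in> {0<..<1}" for \<Omega> :: "'a set" and \<alpha> \<beta>
    using domain_extension[OF AR_with_frontier[OF that(1) assms(1,3,4)] assms(1,3), of \<beta> \<alpha>] that(2) by simp
  show ?thesis
    by (intro bexI[of _ "1/2"] allI impI ballI key[unfolded controlled_extension_def]) simp_all
qed

end
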